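(* For any block-stable class $\mathcal{A}$ of graphs there exist constants $c_1=c_1(\mathcal{A})>0$ and $c_2=c_2(\mathcal{A})>0$ such that for any $t>1$ and any $n$ with $\mathcal{A}^c_n\ne\emptyset$, for $\mathrm{G}^c_n$ a uniformly random element of $\mathcal{A}^c_n$, $$\mathbf{P}\left(\operatorname{Diam}(\mathrm{G}^c_n)\ge t n^{1/2}\right)<c_1\exp(-c_2t^2).$$
   Context: Graphs are finite and simple, and classes of graphs are closed under isomorphism. A bridge in a graph is an edge whose deletion increases the number of connected components. A block in a graph is either a maximal $2$-connected subgraph or the subgraph formed by a bridge or an isolated vertex. A class $\mathcal{A}$ of graphs is block-stable when a graph $G$ is in $\mathcal{A}$ if and only if each block of $G$ is in $\mathcal{A}$. The block-diameter $\operatorname{Diam}(G)$ is the greatest number of blocks that any path in $G$ passes through (a path passes through a block if it uses an edge of it; a single-vertex path at an isolated vertex passes through that block). $\mathcal{A}_n$ is the set of graphs in $\mathcal{A}$ with vertex set $[n]=\{1,\dots,n\}$, and $\mathcal{A}^c_n$ is the set of connected graphs in $\mathcal{A}_n$. *)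

theory Defs
  imports "Graph_Theory.Graph_Theory" "HOL-Probability.Probability_Mass_Function"
begin

text \<open>
  A finite simple graph is a \<^locale>\<open>pair_graph\<close>: a finite, symmetric, loop-free digraph whose arcs
  are ordered pairs of vertices, an edge \<open>uv\<close> being represented by both \<open>(u,v)\<close> and \<open>(v,u)\<close>.
  The graph without vertices is allowed; it is not connected.
\<close>

definition delete_edge :: "'a pair_pre_digraph \<Rightarrow> 'a \<Rightarrow> 'a \<Rightarrow> 'a pair_pre_digraph" where
  "delete_edge G u v = G\<lparr>parcs := parcs G - {(u, v), (v, u)}\<rparr>"

text \<open>The arcs are symmetric, so the strongly connected components are the connected components.\<close>

definition is_bridge :: "'a pair_pre_digraph \<Rightarrow> 'a \<Rightarrow> 'a \<Rightarrow> bool" where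
  "is_bridge G u v \<longleftrightarrow> (u, v) \<in> parcs G \<and>
     card (pre_digraph.sccs (with_proj G)) < card (pre_digraph.sccs (with_proj (delete_edge G u v)))"

text \<open>Two-connected graphs have at least three vertices, so a single edge is not two-connected.\<close>

definition two_connected :: "('a, 'b) pre_digraph \<Rightarrow> bool" where
  "two_connected G \<longleftrightarrow> graph G \<and> 3 \<le> card (verts G) \<and> Digraph_Component.connected G \<and>
     (\<forall>v \<in> verts G. Digraph_Component.connected (pre_digraph.del_vert G v))"

definition is_block :: "'a pair_pre_digraph \<Rightarrow> 'a pair_pre_digraph \<Rightarrow> bool" where
  "is_block G B \<longleftrightarrow>
     pre_digraph.max_subgraph (with_proj G) two_connected (with_proj B) \<or>
     (\<exists>u v. is_bridge G u v \<and> B = \<lparr>pverts = {u, v}, parcs = {(u, v), (v, u)}\<rparr>) \<or>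
     (\<exists>v \<in> pverts G. (\<forall>w. (v, w) \<notin> parcs G) \<and> B = \<lparr>pverts = {v}, parcs = {}\<rparr>)"

text \<open>
  A block with a single vertex is an isolated vertex, so the second disjunct is about the
  single-vertex path at an isolated vertex.
\<close>

definition passes_through :: "'a vwalk \<Rightarrow> 'a pair_pre_digraph \<Rightarrow> bool" where
  "passes_through p B \<longleftrightarrow>
     set (vwalk_arcs p) \<inter> parcs B \<noteq> {} \<or> (\<exists>v. p = [v] \<and> pverts B = {v})"

definition block_diam :: "'a pair_pre_digraph \<Rightarrow> nat" where
  "block_diam G = Max {card {B. is_block G B \<and> passes_through p B} | p. vpath p (with_proj G)}"

text \<open>
  Every finite graph has an isomorphic copy on natural numbers, so a class closed under isomorphism
  is determined by its members whose vertices are natural numbers.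
\<close>

definition graph_class :: "nat pair_pre_digraph set \<Rightarrow> bool" where
  "graph_class \<A> \<longleftrightarrow> (\<forall>G \<in> \<A>. pair_graph G) \<and>
     (\<forall>G \<in> \<A>. \<forall>H. digraph_iso (with_proj G) (with_proj H) \<longrightarrow> H \<in> \<A>)"

definition block_stable :: "nat pair_pre_digraph set \<Rightarrow> bool" where
  "block_stable \<A> \<longleftrightarrow>
     (\<forall>G. pair_graph G \<longrightarrow> (G \<in> \<A> \<longleftrightarrow> (\<forall>B. is_block G B \<longrightarrow> B \<in> \<A>)))"

definition connected_on :: "nat pair_pre_digraph set \<Rightarrow> nat \<Rightarrow> nat pair_pre_digraph set" where
  "connected_on \<A> n = {G \<in> \<A>. pverts G = {1..n} \<and> Digraph_Component.connected (with_proj G)}"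

lemma finite_connected_on:
  assumes "graph_class \<A>"
  shows "finite (connected_on \<A> n)"
proof (rule finite_subset)
  show "connected_on \<A> n \<subseteq>
      (\<lambda>E. \<lparr>pverts = {1..n}, parcs = E\<rparr>) ` Pow ({1..n} \<times> {1..n})"
  proof
    fix G assume G: "G \<in> connected_on \<A> n"
    then interpret pair_graph G
      using assms by (auto simp: graph_class_def connected_on_def)
    have V: "pverts G = {1..n}"
      using G by (simp add: connected_on_def)
    then have "G = \<lparr>pverts = {1..n}, parcs = parcs G\<rparr>"
      by simp
    moreover have "parcs G \<subseteq> {1..n} \<times> {1..n}"
      using in_arcsD1 in_arcsD2 unfolding V by auto
    ultimately show "G \<in> (\<lambda>E. \<lparr>pverts = {1..n}, parcs = E\<rparr>) ` Pow ({1..n} \<times> {1..n})"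
      by blast
  qed
qed simp

end

theory Submission
  imports Defs
begin

text \<open>
  Root a connected graph on \<open>{1..n}\<close> at \<open>1\<close> and detach every block from its vertex closest to the
  root. Inside the class, the resulting family of rooted blocks can be reattached in any acyclic way,
  so given the family the graph is a uniformly random acyclic map \<open>p\<close> from blocks to vertices. A path
  only uses blocks above one of its two ends, so the block-diameter is at most twice the maximal depth.

  Weighted forms of Cayley's formula give that a fixed vertex has depth above \<open>l\<close> with probability at
  most \<open>exp (- l\<^sup>2 / 2n)\<close>, and the same holds inside the subtree of a block, which given its vertex
  set is again uniform. To avoid a union bound over the vertices, let \<open>X\<^bsub>m,l\<^esub>\<close> be the number of pairs
  \<open>(u, v)\<close> where the subtree of the block \<open>u\<close> has at most \<open>m\<close> vertices and contains \<open>v\<close> at relative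
  depth at least \<open>l\<close>. Then \<open>E X\<^bsub>m,l+1\<^esub> \<le> exp (- l\<^sup>2 / 2m) E X\<^bsub>m,0\<^esub>\<close>, and the trivial bound
  \<open>X\<^bsub>m,0\<^esub> \<le> n l + X\<^bsub>m,l\<^esub>\<close> with \<open>l \<approx> \<surd>m\<close> gives \<open>E X\<^bsub>m,0\<^esub> = O(n \<surd>m)\<close>. Along a branch of length
  \<open>2x\<surd>n\<close> the subtree sizes decrease from \<open>n\<close>, so for some \<open>k\<close> at least \<open>x\<surd>n / 2\<^sup>k\<close> of them lie
  between \<open>m/16\<close> and \<open>m\<close>, where \<open>m = n / 16\<^sup>k\<close>; this makes \<open>X\<^bsub>m,l\<^esub>\<close> at least \<open>l m / 16\<close> for half
  that length \<open>l\<close>, and Markov's inequality summed over \<open>k\<close> gives the bound.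
\<close>

section \<open>Attachments of pieces\<close>

text \<open>A union bound over the end vertices would cost a factor \<open>n\<close>, which no
  constant absorbs when \<open>t\<close> is bounded; averaging over pairs avoids this, because a
  single deep point forces many pairs. The counting is done for abstract pieces of arbitrary sizes,
  with a root that may consist of several points, since this setting is stable under both operations
  that occur: merging a piece into the one that carries it, and cutting out a subtree, where all
  points of the top piece become root points. The ratio \<open>16\<close> and the weights
  \<open>2^-k\<close> are matched. At scale \<open>m = n/16^k\<close> a stretch of length
  \<open>x sqrt n / 2^k\<close> has length \<open>x 2^k sqrt m\<close>, so its Gaussian exponent is
  of order \<open>4^k x^2\<close>; this absorbs the factor of order \<open>16^k / 2^k\<close> that
  Markov's inequality loses at that scale. The resulting constants depend neither on the class nor
  on the sizes of the blocks.\<close>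

text \<open>
  The points \<open>v\<close> with \<open>\<pi> v = Some d\<close> form the piece \<open>d\<close>, those with \<open>\<pi> v = None\<close> form the root;
  \<open>p d\<close> is the point that the piece \<open>d\<close> is attached to.
\<close>

definition up1 :: "('v \<Rightarrow> 'd option) \<Rightarrow> ('d \<Rightarrow> 'v) \<Rightarrow> 'v \<Rightarrow> 'v" where
  "up1 \<pi> p v = (case \<pi> v of None \<Rightarrow> v | Some d \<Rightarrow> p d)"

primrec up :: "('v \<Rightarrow> 'd option) \<Rightarrow> ('d \<Rightarrow> 'v) \<Rightarrow> nat \<Rightarrow> 'v \<Rightarrow> 'v" where
  "up \<pi> p 0 v = v"
| "up \<pi> p (Suc k) v = up \<pi> p k (up1 \<pi> p v)"

definition grounded :: "('v \<Rightarrow> 'd option) \<Rightarrow> ('d \<Rightarrow> 'v) \<Rightarrow> 'v \<Rightarrow> bool" where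
  "grounded \<pi> p v \<longleftrightarrow> (\<exists>k. \<pi> (up \<pi> p k v) = None)"

definition depth :: "('v \<Rightarrow> 'd option) \<Rightarrow> ('d \<Rightarrow> 'v) \<Rightarrow> 'v \<Rightarrow> nat" where
  "depth \<pi> p v = (LEAST k. \<pi> (up \<pi> p k v) = None)"

definition pieces :: "'v set \<Rightarrow> 'd set \<Rightarrow> ('v \<Rightarrow> 'd option) \<Rightarrow> bool" where
  "pieces V D \<pi> \<longleftrightarrow> finite V \<and> finite D \<and> \<pi> ` V \<subseteq> insert None (Some ` D) \<and>
     (\<forall>d \<in> D. \<exists>v \<in> V. \<pi> v = Some d)"

definition attachments :: "'v set \<Rightarrow> 'd set \<Rightarrow> ('v \<Rightarrow> 'd option) \<Rightarrow> ('d \<Rightarrow> 'v) set" where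
  "attachments V D \<pi> = {p \<in> D \<rightarrow>\<^sub>E V. \<forall>v \<in> V. grounded \<pi> p v}"

lemma up1_None [simp]: "\<pi> v = None \<Longrightarrow> up1 \<pi> p v = v"
  by (simp add: up1_def)

lemma up1_Some [simp]: "\<pi> v = Some d \<Longrightarrow> up1 \<pi> p v = p d"
  by (simp add: up1_def)

lemma up_None [simp]: "\<pi> v = None \<Longrightarrow> up \<pi> p k v = v"
  by (induction k) auto

lemma up_add: "up \<pi> p (i + j) v = up \<pi> p i (up \<pi> p j v)"
  by (induction j arbitrary: v) auto

lemma grounded_None: "\<pi> v = None \<Longrightarrow> grounded \<pi> p v"
  by (auto simp: grounded_def)

lemma grounded_Some:
  assumes "\<pi> v = Some d"
  shows "grounded \<pi> p v \<longleftrightarrow> grounded \<pi> p (p d)"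
proof
  assume "grounded \<pi> p v"
  then obtain k where k: "\<pi> (up \<pi> p k v) = None"
    by (auto simp: grounded_def)
  with assms show "grounded \<pi> p (p d)"
    by (cases k) (auto simp: grounded_def)
next
  assume "grounded \<pi> p (p d)"
  then obtain k where "\<pi> (up \<pi> p k (p d)) = None"
    by (auto simp: grounded_def)
  with assms have "\<pi> (up \<pi> p (Suc k) v) = None"
    by simp
  then show "grounded \<pi> p v"
    unfolding grounded_def by blast
qed

lemma grounded_up: "grounded \<pi> p v \<Longrightarrow> grounded \<pi> p (up \<pi> p k v)"
proof (induction k arbitrary: v)
  case (Suc k)
  then show ?case
    by (cases "\<pi> v") (auto simp: grounded_Some)
qed simp

lemma grounded_induct [consumes 1, case_names None Some]:
  assumes "grounded \<pi> p v"
    and "\<And>v. \<pi> v = None \<Longrightarrow> P v"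
    and "\<And>v d. \<pi> v = Some d \<Longrightarrow> grounded \<pi> p (p d) \<Longrightarrow> P (p d) \<Longrightarrow> P v"
  shows "P v"
proof -
  obtain k where "\<pi> (up \<pi> p k v) = None"
    using assms(1) by (auto simp: grounded_def)
  then show ?thesis
  proof (induction k arbitrary: v)
    case 0
    then show ?case using assms(2) by simp
  next
    case (Suc k)
    show ?case
    proof (cases "\<pi> v")
      case None
      then show ?thesis using assms(2) by simp
    next
      case (Some d)
      then have "\<pi> (up \<pi> p k (p d)) = None"
        using Suc.prems by simp
      then show ?thesis
        using assms(3)[OF Some] Suc.IH by (auto simp: grounded_def)
    qed
  qed
qed

lemma depth_None [simp]: "\<pi> v = None \<Longrightarrow> depth \<pi> p v = 0"
  by (simp add: depth_def)

lemma depth_Some: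
  assumes "grounded \<pi> p v" and "\<pi> v = Some d"
  shows "depth \<pi> p v = Suc (depth \<pi> p (p d))"
proof -
  obtain k where "\<pi> (up \<pi> p k v) = None"
    using assms(1) by (auto simp: grounded_def)
  then have "(LEAST k. \<pi> (up \<pi> p k v) = None) = Suc (LEAST k. \<pi> (up \<pi> p (Suc k) v) = None)"
    using assms(2) by (intro Least_Suc) auto
  then show ?thesis
    using assms(2) by (simp add: depth_def)
qed

lemma depth_eq_0_iff: "grounded \<pi> p v \<Longrightarrow> depth \<pi> p v = 0 \<longleftrightarrow> \<pi> v = None"
  by (cases "\<pi> v") (auto simp: depth_Some)

lemma depth_up: "grounded \<pi> p v \<Longrightarrow> depth \<pi> p (up \<pi> p k v) = depth \<pi> p v - k"
proof (induction k arbitrary: v)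
  case (Suc k)
  then show ?case
    by (cases "\<pi> v") (auto simp: depth_Some grounded_Some)
qed simp

lemma up_eq_None_iff: "grounded \<pi> p v \<Longrightarrow> \<pi> (up \<pi> p k v) = None \<longleftrightarrow> depth \<pi> p v \<le> k"
  using depth_eq_0_iff[OF grounded_up] depth_up by (metis diff_is_0_eq)

lemma depth_eq_if_piece_eq:
  assumes "grounded \<pi> p v" "grounded \<pi> p w" "\<pi> v = \<pi> w"
  shows "depth \<pi> p v = depth \<pi> p w"
  using assms depth_Some[of \<pi> p v] depth_Some[of \<pi> p w] by (cases "\<pi> w") auto

text \<open>Each step of a climb along \<open>up\<close> lowers the depth by one until the root is
  reached, and the points of one piece have equal depth, so a climb meets a piece at most once. The
  difference of depths is truncated; it determines the step because both steps lie before the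
  root.\<close>

lemma up_piece_unique:
  assumes g: "grounded \<pi> p v" and i: "\<pi> (up \<pi> p i v) = Some d" and j: "\<pi> (up \<pi> p j v) = Some d"
  shows "i = j"
proof -
  have "depth \<pi> p v - i = depth \<pi> p v - j"
    using depth_eq_if_piece_eq[OF grounded_up[OF g] grounded_up[OF g], of i j] i j depth_up[OF g] by simp
  moreover have "\<not> depth \<pi> p v \<le> i" "\<not> depth \<pi> p v \<le> j"
    using i j up_eq_None_iff[OF g] by (metis option.distinct(1))+
  ultimately show ?thesis by linarith
qed

lemma attachment_in: "p \<in> attachments V D \<pi> \<Longrightarrow> d \<in> D \<Longrightarrow> p d \<in> V"
  by (auto simp: attachments_def)

lemma attachment_grounded: "p \<in> attachments V D \<pi> \<Longrightarrow> v \<in> V \<Longrightarrow> grounded \<pi> p v"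
  by (auto simp: attachments_def)

lemma pieces_Some: "pieces V D \<pi> \<Longrightarrow> v \<in> V \<Longrightarrow> \<pi> v = Some d \<Longrightarrow> d \<in> D"
  by (force simp: pieces_def)

lemma up1_in: "pieces V D \<pi> \<Longrightarrow> p \<in> D \<rightarrow> V \<Longrightarrow> v \<in> V \<Longrightarrow> up1 \<pi> p v \<in> V"
  by (cases "\<pi> v") (auto dest: pieces_Some)

lemma up_in: "pieces V D \<pi> \<Longrightarrow> p \<in> D \<rightarrow> V \<Longrightarrow> v \<in> V \<Longrightarrow> up \<pi> p k v \<in> V"
  by (induction k arbitrary: v) (auto intro: up1_in)

lemma finite_attachments: "pieces V D \<pi> \<Longrightarrow> finite (attachments V D \<pi>)"
  unfolding attachments_def pieces_def
  by (rule finite_subset[of _ "D \<rightarrow>\<^sub>E V"]) (auto intro: finite_PiE)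

section \<open>Merging a piece into its carrier\<close>

definition absorb :: "('v \<Rightarrow> 'd option) \<Rightarrow> 'd \<Rightarrow> 'v \<Rightarrow> 'v \<Rightarrow> 'd option" where
  "absorb \<pi> y w v = (if \<pi> v = Some y then \<pi> w else \<pi> v)"

lemma pieces_absorb:
  assumes "pieces V D \<pi>" "w \<in> V" "\<pi> w \<noteq> Some y"
  shows "pieces V (D - {y}) (absorb \<pi> y w)"
  unfolding pieces_def
proof (intro conjI ballI)
  show "absorb \<pi> y w ` V \<subseteq> insert None (Some ` (D - {y}))"
    using assms by (force simp: pieces_def absorb_def)
  fix d assume "d \<in> D - {y}"
  then obtain v where "v \<in> V" "\<pi> v = Some d" "d \<noteq> y"
    using assms by (auto simp: pieces_def)
  then show "\<exists>v\<in>V. absorb \<pi> y w v = Some d"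
    by (intro bexI[of _ v]) (auto simp: absorb_def)
qed (use assms in \<open>auto simp: pieces_def\<close>)

lemma not_grounded_loop:
  assumes "grounded \<pi> p v" and "\<pi> v = Some y"
  shows "\<pi> (p y) \<noteq> Some y"
proof
  assume "\<pi> (p y) = Some y"
  then have "depth \<pi> p v = depth \<pi> p (p y)"
    using assms grounded_Some[of \<pi> v y p] by (auto intro: depth_eq_if_piece_eq)
  then show False
    using depth_Some[OF assms] by simp
qed

text \<open>After the merge a climb takes the same route with the step from \<open>y\<close> to
  \<open>p y\<close> left out, so it ends in the root exactly when it did before. The assumption on
  \<open>p y\<close> rules out merging \<open>y\<close> into itself.\<close>

lemma grounded_absorb_iff:
  assumes P: "pieces V D \<pi>" "p \<in> D \<rightarrow> V" "\<pi> (p y) \<noteq> Some y" "v \<in> V"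
  defines "p' \<equiv> restrict p (D - {y})" and "\<pi>' \<equiv> absorb \<pi> y (p y)"
  shows "grounded \<pi>' p' v \<longleftrightarrow> grounded \<pi> p v"
proof
  assume "grounded \<pi> p v"
  then show "grounded \<pi>' p' v"
    using \<open>v \<in> V\<close>
  proof (induction rule: grounded_induct)
    case (None v)
    then show ?case by (intro grounded_None) (simp add: \<pi>'_def absorb_def)
  next
    case (Some v d)
    have d: "d \<in> D" using P Some by (auto dest: pieces_Some)
    then have IH: "grounded \<pi>' p' (p d)" using Some P by auto
    show ?case
    proof (cases "d = y")
      case True
      have eq: "\<pi>' v = \<pi>' (p y)"
        using True Some P by (auto simp: \<pi>'_def absorb_def)
      show ?thesis
        using IH eq True grounded_Some[of \<pi>' v _ p'] grounded_Some[of \<pi>' "p y" _ p']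
        by (cases "\<pi>' (p y)") (auto intro: grounded_None)
    next
      case False
      have "\<pi>' v = Some d" "p' d = p d"
        using False Some d by (auto simp: \<pi>'_def absorb_def p'_def)
      then show ?thesis using IH grounded_Some[of \<pi>' v d p'] by simp
    qed
  qed
next
  assume "grounded \<pi>' p' v"
  then show "grounded \<pi> p v"
    using \<open>v \<in> V\<close>
  proof (induction rule: grounded_induct)
    case (None v)
    show ?case
    proof (cases "\<pi> v = Some y")
      case True
      then show ?thesis
        using None grounded_Some[of \<pi> v y p] by (auto simp: \<pi>'_def absorb_def intro: grounded_None)
    next
      case False
      then show ?thesis using None by (auto simp: \<pi>'_def absorb_def intro: grounded_None)
    qed
  next
    case (Some v d)
    show ?case
    proof (cases "\<pi> v = Some y")
      case True
      then have yD: "y \<in> D" using Some P by (auto dest: pieces_Some)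
      then have "p y \<in> V" using P by auto
      have d: "\<pi> (p y) = Some d" using True Some by (auto simp: \<pi>'_def absorb_def)
      then have "d \<in> D" "d \<noteq> y" using P \<open>p y \<in> V\<close> by (auto dest: pieces_Some)
      then have "p' d = p d" "p d \<in> V" using P by (auto simp: p'_def)
      then have "grounded \<pi> p (p d)" using Some by simp
      then show ?thesis using d True grounded_Some by metis
    next
      case False
      then have d: "\<pi> v = Some d" using Some by (auto simp: \<pi>'_def absorb_def)
      then have "d \<in> D" "d \<noteq> y" using P Some False by (auto dest: pieces_Some)
      then have "p' d = p d" "p d \<in> V" using P by (auto simp: p'_def)
      then have "grounded \<pi> p (p d)" using Some by simp
      then show ?thesis using d grounded_Some by metis
    qed
  qed
qed

lemma attachments_absorb_bij:
  assumes P: "pieces V D \<pi>" "y \<in> D" "w \<in> V" "\<pi> w \<noteq> Some y"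
  shows "bij_betw (\<lambda>p. restrict p (D - {y})) {p \<in> attachments V D \<pi>. p y = w}
           (attachments V (D - {y}) (absorb \<pi> y w))"
proof (rule bij_betw_byWitness[where f' = "\<lambda>q. q(y := w)"])
  show "\<forall>p\<in>{p \<in> attachments V D \<pi>. p y = w}. (restrict p (D - {y}))(y := w) = p"
    using P by (auto simp: attachments_def fun_eq_iff PiE_def extensional_def)
  show "\<forall>q\<in>attachments V (D - {y}) (absorb \<pi> y w). restrict (q(y := w)) (D - {y}) = q"
    by (auto simp: attachments_def fun_eq_iff PiE_def extensional_def)
  show "(\<lambda>p. restrict p (D - {y})) ` {p \<in> attachments V D \<pi>. p y = w}
      \<subseteq> attachments V (D - {y}) (absorb \<pi> y w)"
  proof clarify
    fix p assume p: "p \<in> attachments V D \<pi>" "w = p y"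
    then show "restrict p (D - {y}) \<in> attachments V (D - {y}) (absorb \<pi> y (p y))"
      using P grounded_absorb_iff[of V D \<pi> p y] by (auto simp: attachments_def)
  qed
  show "(\<lambda>q. q(y := w)) ` attachments V (D - {y}) (absorb \<pi> y w)
      \<subseteq> {p \<in> attachments V D \<pi>. p y = w}"
  proof clarify
    fix q assume q: "q \<in> attachments V (D - {y}) (absorb \<pi> y w)"
    have 1: "q(y := w) \<in> D \<rightarrow>\<^sub>E V"
      using q P by (auto simp: attachments_def PiE_def extensional_def)
    have 2: "restrict (q(y := w)) (D - {y}) = q"
      using q by (auto simp: attachments_def fun_eq_iff PiE_def extensional_def)
    have "grounded \<pi> (q(y := w)) v" if "v \<in> V" for v
      using grounded_absorb_iff[of V D \<pi> "q(y := w)" y v] P 1 2 that q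
      by (auto simp: attachments_def PiE_def)
    then show "q(y := w) \<in> attachments V D \<pi> \<and> (q(y := w)) y = w"
      using 1 by (auto simp: attachments_def)
  qed
qed

lemma attachment_no_loop:
  assumes "pieces V D \<pi>" "p \<in> attachments V D \<pi>" "y \<in> D"
  shows "\<pi> (p y) \<noteq> Some y"
proof -
  obtain v where "v \<in> V" "\<pi> v = Some y"
    using assms by (auto simp: pieces_def)
  then show ?thesis
    using not_grounded_loop[of \<pi> p v y] assms attachment_grounded by metis
qed

lemma card_attachments_split:
  assumes P: "pieces V D \<pi>" "y \<in> D"
  shows "card {p \<in> attachments V D \<pi>. Q p} =
    (\<Sum>w \<in> {w \<in> V. \<pi> w \<noteq> Some y}. card {p \<in> attachments V D \<pi>. p y = w \<and> Q p})"
proof -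
  have eq: "{p \<in> attachments V D \<pi>. Q p} =
      (\<Union>w \<in> {w \<in> V. \<pi> w \<noteq> Some y}. {p \<in> attachments V D \<pi>. p y = w \<and> Q p})"
    using attachment_no_loop[OF P(1) _ P(2)] attachment_in[OF _ P(2)] by auto
  show ?thesis
    unfolding eq using P finite_attachments[OF P(1)]
    by (subst card_UN_disjoint) (auto simp: pieces_def)
qed

text \<open>
  Absorbing a piece into the piece (or the root) that it is attached to leaves a structure of the
  same kind with one piece less; this gives the weighted form of Cayley's formula.
\<close>

lemma card_attachments:
  assumes "pieces V D \<pi>"
  shows "card V * card (attachments V D \<pi>) = card {v \<in> V. \<pi> v = None} * card V ^ card D"
  using assms
proof (induction "card D" arbitrary: D \<pi>)
  case 0
  then have [simp]: "D = {}" by (simp add: pieces_def)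
  have N: "\<pi> v = None" if "v \<in> V" for v using 0 that by (auto simp: pieces_def)
  then have "attachments V D \<pi> = {\<lambda>_. undefined}"
    by (auto simp: attachments_def intro: grounded_None)
  moreover have "{v \<in> V. \<pi> v = None} = V" using N by auto
  ultimately show ?case by simp
next
  case (Suc k)
  then obtain y where y: "y \<in> D" by fastforce
  have fin: "finite V" "finite D" using Suc.prems by (auto simp: pieces_def)
  define U where "U = {v \<in> V. \<pi> v = None}"
  define Y where "Y = {v \<in> V. \<pi> v = Some y}"
  define R where "R = {w \<in> V. \<pi> w \<noteq> None \<and> \<pi> w \<noteq> Some y}"
  have V: "V = U \<union> Y \<union> R" and disj: "U \<inter> Y = {}" "(U \<union> Y) \<inter> R = {}"
    by (auto simp: U_def Y_def R_def)
  have finU: "finite U" "finite Y" "finite R" using fin by (auto simp: U_def Y_def R_def)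
  have cV: "card V = card U + card Y + card R"
    using disj finU by (simp add: V card_Un_disjoint)
  have k: "k = card (D - {y})" using Suc(2) y fin by simp
  have IH: "card V * card (attachments V (D - {y}) (absorb \<pi> y w)) =
      card {v \<in> V. absorb \<pi> y w v = None} * card V ^ k" if "w \<in> V" "\<pi> w \<noteq> Some y" for w
    using Suc(1)[OF k pieces_absorb[OF Suc.prems that]] k by simp
  have c: "card {p \<in> attachments V D \<pi>. p y = w} = card (attachments V (D - {y}) (absorb \<pi> y w))"
    if "w \<in> V" "\<pi> w \<noteq> Some y" for w
    using bij_betw_same_card[OF attachments_absorb_bij[OF Suc.prems y that]] .
  have split: "{w \<in> V. \<pi> w \<noteq> Some y} = U \<union> R" by (auto simp: U_def R_def)
  have a: "{v \<in> V. absorb \<pi> y w v = None} = U \<union> Y" if "w \<in> U" for w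
    using that by (auto simp: U_def Y_def absorb_def)
  have b: "{v \<in> V. absorb \<pi> y w v = None} = U" if "w \<in> R" for w
    using that by (auto simp: U_def R_def absorb_def)
  have "card V * card (attachments V D \<pi>) =
      (\<Sum>w \<in> U \<union> R. card V * card (attachments V (D - {y}) (absorb \<pi> y w)))"
    using card_attachments_split[OF Suc.prems y, of "\<lambda>_. True"] c
    by (simp add: split sum_distrib_left) (rule sum.cong, auto simp: U_def R_def)
  also have "\<dots> = (\<Sum>w \<in> U \<union> R. card {v \<in> V. absorb \<pi> y w v = None} * card V ^ k)"
    using IH by (intro sum.cong) (auto simp: U_def R_def)
  also have "\<dots> = (\<Sum>w \<in> U. card (U \<union> Y) * card V ^ k) + (\<Sum>w \<in> R. card U * card V ^ k)"
    using finU disj a b by (subst sum.union_disjoint) auto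
  \<comment> \<open>Attaching \<open>y\<close> to the root enlarges the root by \<open>Y\<close>,
    attaching it elsewhere keeps the root: \<open>|U| (|U| + |Y|) + |R| |U| = |U| |V|\<close>. The
    factor \<open>card V\<close> on the left of the claim avoids the exponent
    \<open>card D - 1\<close>, which would be truncated at \<open>D = {}\<close>.\<close>
  also have "\<dots> = card U * card V ^ Suc k"
    using disj finU by (simp add: cV card_Un_disjoint algebra_simps)
  finally show ?case
    using Suc(2) by (simp add: U_def)
qed

text \<open>For \<open>w\<close> outside the root the merge keeps the root and removes one piece, so
  Cayley's count drops by exactly the factor \<open>card V\<close>. In other words, \<open>y\<close>
  hangs at each such \<open>w\<close> with probability \<open>1 / card V\<close>.\<close>

lemma card_attachments_absorb:
  assumes P: "pieces V D \<pi>" and y: "y \<in> D" and w: "w \<in> V" "\<pi> w = Some d" "d \<noteq> y"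
  shows "card V * card (attachments V (D - {y}) (absorb \<pi> y w)) = card (attachments V D \<pi>)"
proof -
  have fin: "finite V" "finite D" using P by (auto simp: pieces_def)
  have "card D = Suc (card (D - {y}))" using y fin by (metis card.remove)
  moreover have "{v \<in> V. absorb \<pi> y w v = None} = {v \<in> V. \<pi> v = None}"
    using w by (auto simp: absorb_def)
  moreover have "card V > 0" using w fin by (auto simp: card_gt_0_iff)
  ultimately show ?thesis
    using card_attachments[OF P] card_attachments[OF pieces_absorb[OF P w(1)], of y] w by simp
qed

text \<open>Points of \<open>y\<close> are one step deeper than \<open>p y\<close>, so a climb that
  starts no deeper than \<open>p y\<close> never meets \<open>y\<close> and is not touched by the
  merge.\<close>

lemma depth_absorb:
  assumes P: "pieces V D \<pi>" and p: "p \<in> attachments V D \<pi>" and y: "y \<in> D"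
    and u: "u \<in> V" "depth \<pi> p u \<le> depth \<pi> p (p y)"
  shows "depth (absorb \<pi> y (p y)) (restrict p (D - {y})) u = depth \<pi> p u"
proof -
  let ?\<pi>' = "absorb \<pi> y (p y)" and ?p' = "restrict p (D - {y})"
  have "grounded \<pi> p u" using p u attachment_grounded by metis
  then show ?thesis using u
  proof (induction rule: grounded_induct)
    case (None v)
    then show ?case by (simp add: absorb_def)
  next
    case (Some v d)
    have gv: "grounded \<pi> p v" using p Some attachment_grounded by metis
    have d: "d \<in> D" using P Some by (auto dest: pieces_Some)
    have dv: "depth \<pi> p v = Suc (depth \<pi> p (p d))"
      using depth_Some gv Some by metis
    have "d \<noteq> y"
      using Some.prems dv by auto
    then have eq: "?\<pi>' v = Some d" "?p' d = p d"
      using d Some by (auto simp: absorb_def)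
    have pd: "p d \<in> V" using p d by (rule attachment_in)
    have IH: "depth ?\<pi>' ?p' (p d) = depth \<pi> p (p d)"
      using Some.IH[OF pd] Some.prems dv by linarith
    have "grounded ?\<pi>' ?p' v"
      using grounded_absorb_iff[OF P, of p y v] attachment_no_loop[OF P p y] p Some gv
      by (auto simp: attachments_def)
    from depth_Some[OF this eq(1)] show ?case
      unfolding eq(2) IH dv .
  qed
qed

text \<open>The climb from \<open>y\<close> is revealed step by step. To continue, the carrier
  \<open>w\<close> must lie outside both the root and \<open>y\<close>, which has probability at
  most \<open>1 - q/n \<le> exp (- q/n)\<close> for \<open>q\<close> the size of \<open>y\<close>.
  Merging \<open>y\<close> into the piece of \<open>w\<close> makes the current piece larger by at
  least one point, so the exponents \<open>q, q + 1, q + 2, ...\<close> add up. The size of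
  \<open>y\<close> occurs in the bound because it changes in the induction.\<close>

lemma depth_tail:
  assumes "pieces V D \<pi>" and "y \<in> D"
  shows "real (card {p \<in> attachments V D \<pi>. l \<le> depth \<pi> p (p y)}) \<le>
    real (card (attachments V D \<pi>)) *
      exp (- (real l * real (card {v \<in> V. \<pi> v = Some y}) + real l * (real l - 1) / 2) / card V)"
  using assms
proof (induction l arbitrary: D \<pi> y)
  case 0
  then show ?case by simp
next
  case (Suc l)
  have fin: "finite V" "finite D" using Suc.prems by (auto simp: pieces_def)
  note P = Suc.prems(1) and y = Suc.prems(2)
  define n where "n = real (card V)"
  define q where "q = real (card {v \<in> V. \<pi> v = Some y})"
  define R where "R = {w \<in> V. \<pi> w \<noteq> None \<and> \<pi> w \<noteq> Some y}"
  define A where "A = real (card (attachments V D \<pi>))"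
  have n0: "n > 0"
    using P y fin by (force simp: n_def card_gt_0_iff pieces_def)
  let ?E = "exp (- (real l * (q + 1) + real l * (real l - 1) / 2) / n)"
  have bound: "real (card {p \<in> attachments V D \<pi>. p y = w \<and> Suc l \<le> depth \<pi> p (p y)}) \<le>
      (if w \<in> R then A / n * ?E else 0)" if w: "w \<in> V" "\<pi> w \<noteq> Some y" for w
  proof (cases "\<pi> w")
    case None
    then have empty: "{p \<in> attachments V D \<pi>. p y = w \<and> Suc l \<le> depth \<pi> p (p y)} = {}"
      by auto
    show ?thesis unfolding empty using None by (simp add: R_def)
  next
    case (Some d)
    with w have d: "d \<noteq> y" "d \<in> D" using P by (auto dest: pieces_Some)
    let ?\<pi>' = "absorb \<pi> y w" and ?D' = "D - {y}"
    have "card {p \<in> attachments V D \<pi>. p y = w \<and> Suc l \<le> depth \<pi> p (p y)} \<le>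
        card {p' \<in> attachments V ?D' ?\<pi>'. l \<le> depth ?\<pi>' p' (p' d)}"
    proof (rule card_inj_on_le[where f = "\<lambda>p. restrict p ?D'"])
      show "inj_on (\<lambda>p. restrict p ?D')
          {p \<in> attachments V D \<pi>. p y = w \<and> Suc l \<le> depth \<pi> p (p y)}"
        using attachments_absorb_bij[OF P y w] unfolding bij_betw_def
        by (auto elim!: inj_on_subset)
      show "finite {p' \<in> attachments V ?D' ?\<pi>'. l \<le> depth ?\<pi>' p' (p' d)}"
        using finite_attachments[OF pieces_absorb[OF P w]] by simp
      show "(\<lambda>p. restrict p ?D') ` {p \<in> attachments V D \<pi>. p y = w \<and> Suc l \<le> depth \<pi> p (p y)}
          \<subseteq> {p' \<in> attachments V ?D' ?\<pi>'. l \<le> depth ?\<pi>' p' (p' d)}"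
      proof clarify
        fix p assume p: "p \<in> attachments V D \<pi>" "Suc l \<le> depth \<pi> p (p y)" "w = p y"
        have 1: "restrict p ?D' \<in> attachments V ?D' (absorb \<pi> y (p y))"
          using attachments_absorb_bij[OF P y w] p unfolding bij_betw_def by auto
        have "depth \<pi> p (p y) = Suc (depth \<pi> p (p d))"
          using Some p attachment_grounded w depth_Some by metis
        then have "depth (absorb \<pi> y (p y)) (restrict p ?D') (p d) = depth \<pi> p (p d)"
          and "l \<le> depth \<pi> p (p d)"
          using depth_absorb[OF P p(1) y, of "p d"] attachment_in[OF p(1) d(2)] p by auto
        then show "restrict p ?D' \<in> attachments V ?D' (absorb \<pi> y (p y)) \<and>
            l \<le> depth (absorb \<pi> y (p y)) (restrict p ?D') (restrict p ?D' d)"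
          using 1 d by simp
      qed
    qed
    then have "real (card {p \<in> attachments V D \<pi>. p y = w \<and> Suc l \<le> depth \<pi> p (p y)}) \<le>
        real (card {p' \<in> attachments V ?D' ?\<pi>'. l \<le> depth ?\<pi>' p' (p' d)})"
      by linarith
    also have "\<dots> \<le> real (card (attachments V ?D' ?\<pi>')) *
        exp (- (real l * real (card {v \<in> V. ?\<pi>' v = Some d}) + real l * (real l - 1) / 2) / card V)"
      using Suc.IH[OF pieces_absorb[OF P w], of d] d by simp
    also have "\<dots> \<le> real (card (attachments V ?D' ?\<pi>')) * ?E"
    proof -
      have "{v \<in> V. ?\<pi>' v = Some d} = {v \<in> V. \<pi> v = Some y} \<union> {v \<in> V. \<pi> v = Some d}"
        using Some d by (auto simp: absorb_def)
      moreover have "card \<dots> = card {v \<in> V. \<pi> v = Some y} + card {v \<in> V. \<pi> v = Some d}"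
        using fin d by (intro card_Un_disjoint) auto
      moreover have "card {v \<in> V. \<pi> v = Some d} > 0"
        using fin w Some by (auto simp: card_gt_0_iff)
      ultimately have "q + 1 \<le> real (card {v \<in> V. ?\<pi>' v = Some d})"
        by (simp add: q_def)
      then have "real l * (q + 1) \<le> real l * real (card {v \<in> V. ?\<pi>' v = Some d})"
        by (intro mult_left_mono) auto
      then show ?thesis
        using n0 by (intro mult_left_mono) (auto simp: n_def divide_right_mono)
    qed
    also have "\<dots> = A / n * ?E"
    proof -
      have "n * real (card (attachments V ?D' ?\<pi>')) = A"
        unfolding n_def A_def card_attachments_absorb[OF P y w(1) Some d(1), symmetric] by simp
      then show ?thesis using n0 by (simp add: eq_divide_eq mult.commute)
    qed
    finally have "real (card {p \<in> attachments V D \<pi>. p y = w \<and> Suc l \<le> depth \<pi> p (p y)}) \<le>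
        A / n * ?E" .
    moreover have "w \<in> R" using w Some by (simp add: R_def)
    ultimately show ?thesis by simp
  qed
  have RV: "{w \<in> V. \<pi> w \<noteq> Some y} \<inter> R = R" by (auto simp: R_def)
  have "real (card {p \<in> attachments V D \<pi>. Suc l \<le> depth \<pi> p (p y)}) \<le>
      (\<Sum>w \<in> {w \<in> V. \<pi> w \<noteq> Some y}. if w \<in> R then A / n * ?E else 0)"
    by (subst card_attachments_split[OF P y], subst of_nat_sum, rule sum_mono) (use bound in blast)
  also have "\<dots> = real (card R) * (A / n * ?E)"
    using fin RV by (subst sum.inter_restrict[symmetric]) auto
  also have "\<dots> = A * (real (card R) / n) * ?E" by simp
  also have "\<dots> \<le> A * exp (- q / n) * ?E"
  proof -
    have "card (R \<union> {v \<in> V. \<pi> v = Some y}) \<le> card V"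
      using fin by (intro card_mono) (auto simp: R_def)
    moreover have "card (R \<union> {v \<in> V. \<pi> v = Some y}) = card R + card {v \<in> V. \<pi> v = Some y}"
      using fin by (intro card_Un_disjoint) (auto simp: R_def)
    ultimately have "real (card R) \<le> n - q"
      by (simp add: n_def q_def)
    then have "real (card R) / n \<le> 1 + (- q / n)"
      using n0 by (simp add: field_simps)
    also have "\<dots> \<le> exp (- q / n)" by (rule exp_ge_add_one_self)
    finally show ?thesis by (intro mult_right_mono mult_left_mono) (auto simp: A_def)
  qed
  also have "A * exp (- q / n) * ?E = A * exp (- (real (Suc l) * q + real (Suc l) * (real (Suc l) - 1) / 2) / n)"
  proof -
    have eq: "- q + - (real l * (q + 1) + real l * (real l - 1) / 2) =
        - (real (Suc l) * q + real (Suc l) * (real (Suc l) - 1) / 2)"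
      by (simp add: field_simps)
    have "exp (- q / n) * ?E = exp (- (real (Suc l) * q + real (Suc l) * (real (Suc l) - 1) / 2) / n)"
      unfolding eq[symmetric] add_divide_distrib by (rule exp_add[symmetric])
    then show ?thesis by (simp only: mult.assoc)
  qed
  finally have "real (card {p \<in> attachments V D \<pi>. Suc l \<le> depth \<pi> p (p y)}) \<le>
      A * exp (- (real (Suc l) * q + real (Suc l) * (real (Suc l) - 1) / 2) / n)" .
  then show ?case unfolding A_def n_def q_def .
qed

section \<open>Subtrees\<close>

text \<open>The step from \<open>v\<close> to the carrier of its piece accounts for the shift from
  \<open>l\<close> to \<open>Suc l\<close>. The piece has at least one point, and
  \<open>l + l (l - 1) / 2 \<ge> l^2 / 2\<close>.\<close>

lemma depth_tail_point:
  assumes P: "pieces V D \<pi>" and v: "v \<in> V"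
  shows "real (card {p \<in> attachments V D \<pi>. Suc l \<le> depth \<pi> p v}) \<le>
    real (card (attachments V D \<pi>)) * exp (- (real l)\<^sup>2 / (2 * card V))"
proof (cases "\<pi> v")
  case None
  then have "{p \<in> attachments V D \<pi>. Suc l \<le> depth \<pi> p v} = {}" by simp
  then show ?thesis by (simp only: card.empty) simp
next
  case (Some y)
  have y: "y \<in> D" using P v Some by (rule pieces_Some)
  have fin: "finite V" using P by (simp add: pieces_def)
  let ?q = "real (card {v \<in> V. \<pi> v = Some y})"
  have q: "1 \<le> ?q" using fin v Some by (auto simp: Suc_le_eq card_gt_0_iff)
  have "depth \<pi> p v = Suc (depth \<pi> p (p y))" if "p \<in> attachments V D \<pi>" for p
    using depth_Some[of \<pi> p v y] Some attachment_grounded[OF that v] by simp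
  then have "{p \<in> attachments V D \<pi>. Suc l \<le> depth \<pi> p v} =
      {p \<in> attachments V D \<pi>. l \<le> depth \<pi> p (p y)}" by auto
  also have "real (card \<dots>) \<le> real (card (attachments V D \<pi>)) *
      exp (- (real l * ?q + real l * (real l - 1) / 2) / card V)"
    by (rule depth_tail[OF P y])
  also have "\<dots> \<le> real (card (attachments V D \<pi>)) * exp (- (real l)\<^sup>2 / (2 * card V))"
  proof -
    have "(real l)\<^sup>2 / 2 \<le> real l * 1 + real l * (real l - 1) / 2"
      by (simp add: power2_eq_square field_simps)
    also have "\<dots> \<le> real l * ?q + real l * (real l - 1) / 2"
      using q by (intro add_mono mult_left_mono) auto
    finally have "- (real l * ?q + real l * (real l - 1) / 2) / card V \<le> - ((real l)\<^sup>2 / 2) / card V"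
      by (intro divide_right_mono) auto
    then show ?thesis by (intro mult_left_mono) (auto simp: field_simps)
  qed
  finally show ?thesis .
qed

definition sub :: "'v set \<Rightarrow> ('v \<Rightarrow> 'd option) \<Rightarrow> ('d \<Rightarrow> 'v) \<Rightarrow> 'd \<Rightarrow> 'v set" where
  "sub V \<pi> p u = {v \<in> V. \<exists>j. \<pi> (up \<pi> p j v) = Some u}"

definition cut_at :: "('v \<Rightarrow> 'd option) \<Rightarrow> 'd \<Rightarrow> 'v \<Rightarrow> 'd option" where
  "cut_at \<pi> u v = (if \<pi> v = Some u then None else \<pi> v)"

text \<open>For \<open>W\<close> the set below \<open>u\<close>, a piece lies inside
  \<open>W\<close> or avoids it, so one point of \<open>d\<close> in \<open>W\<close> decides. The
  piece \<open>u\<close> is left out: it becomes the root of the inner structure, and its own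
  attachment belongs to the outside.\<close>

definition inner :: "'d set \<Rightarrow> ('v \<Rightarrow> 'd option) \<Rightarrow> 'd \<Rightarrow> 'v set \<Rightarrow> 'd set" where
  "inner D \<pi> u W = {d \<in> D. d \<noteq> u \<and> (\<exists>v \<in> W. \<pi> v = Some d)}"

lemma sub_own: "v \<in> V \<Longrightarrow> \<pi> v = Some u \<Longrightarrow> v \<in> sub V \<pi> p u"
  unfolding sub_def by (auto intro!: exI[of _ 0])

lemma sub_None: "\<pi> v = None \<Longrightarrow> v \<notin> sub V \<pi> p u"
  by (auto simp: sub_def)

lemma sub_step:
  assumes "v \<in> V" "p d \<in> V" "\<pi> v = Some d" "d \<noteq> u"
  shows "v \<in> sub V \<pi> p u \<longleftrightarrow> p d \<in> sub V \<pi> p u"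
proof
  assume "v \<in> sub V \<pi> p u"
  then obtain j where "\<pi> (up \<pi> p j v) = Some u" by (auto simp: sub_def)
  then show "p d \<in> sub V \<pi> p u" using assms by (cases j) (auto simp: sub_def)
next
  assume "p d \<in> sub V \<pi> p u"
  then obtain j where "\<pi> (up \<pi> p j (p d)) = Some u" by (auto simp: sub_def)
  then have "\<pi> (up \<pi> p (Suc j) v) = Some u" using assms by simp
  then show "v \<in> sub V \<pi> p u" using assms unfolding sub_def by blast
qed

lemma sub_subset: "sub V \<pi> p u \<subseteq> V"
  by (auto simp: sub_def)

lemma sub_piece:
  assumes p: "pieces V D \<pi>" "p \<in> D \<rightarrow> V" and v: "v \<in> V" "w \<in> V" "\<pi> v = \<pi> w" "v \<in> sub V \<pi> p u"
  shows "w \<in> sub V \<pi> p u"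
proof -
  obtain d where d: "\<pi> v = Some d" using v(4) sub_None by (metis option.exhaust)
  have "p d \<in> V" using p(2) pieces_Some[OF p(1) v(1) d] by auto
  then show ?thesis
    using sub_own[of w V \<pi> u p] sub_step[of v V p d \<pi> u] sub_step[of w V p d \<pi> u] v d
    by (cases "d = u") auto
qed

lemma attachment_root_notin_sub:
  assumes P: "pieces V D \<pi>" and p: "p \<in> attachments V D \<pi>" and u: "u \<in> D"
  shows "p u \<notin> sub V \<pi> p u"
proof
  assume "p u \<in> sub V \<pi> p u"
  then obtain j where j: "\<pi> (up \<pi> p j (p u)) = Some u" by (auto simp: sub_def)
  obtain v where v: "v \<in> V" "\<pi> v = Some u" using P u by (auto simp: pieces_def)
  have "\<pi> (up \<pi> p (Suc j) v) = Some u" "\<pi> (up \<pi> p 0 v) = Some u" using v j by auto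
  then show False using up_piece_unique[OF attachment_grounded[OF p v(1)]] by blast
qed

text \<open>
  Once the set of points below a piece and the attachments outside it are prescribed, the
  attachments below the piece range over a structure of the same kind, with the piece as root.
\<close>

context
  fixes V :: "'v set" and D :: "'d set" and \<pi> u p0 W Z F
  assumes P: "pieces V D \<pi>" and p0: "p0 \<in> attachments V D \<pi>" and u: "u \<in> D"
  defines "W \<equiv> sub V \<pi> p0 u" and "Z \<equiv> inner D \<pi> u W"
  defines "F \<equiv> {p \<in> attachments V D \<pi>. sub V \<pi> p u = W \<and> restrict p (D - Z) = restrict p0 (D - Z)}"
begin

lemma W_V: "W \<subseteq> V" by (simp add: W_def sub_subset)

lemma Z_D: "Z \<subseteq> D" "u \<notin> Z" by (auto simp: Z_def inner_def)

lemma W_piece: "v \<in> V \<Longrightarrow> w \<in> V \<Longrightarrow> \<pi> v = \<pi> w \<Longrightarrow> v \<in> W \<Longrightarrow> w \<in> W"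
  unfolding W_def using sub_piece[OF P, of p0 v w u] p0 by (auto simp: attachments_def)

lemma W_Some:
  assumes "v \<in> W" obtains d where "\<pi> v = Some d" "d = u \<or> d \<in> Z"
proof (cases "\<pi> v")
  case None
  then show ?thesis using assms by (simp add: W_def sub_None)
next
  case (Some d)
  then have "d = u \<or> d \<in> Z"
    using assms P W_V by (auto simp: Z_def inner_def dest: pieces_Some)
  then show ?thesis using Some that by blast
qed

lemma not_W_Some:
  assumes "v \<in> V" "v \<notin> W" "\<pi> v = Some d"
  shows "d \<in> D" "d \<notin> Z" "d \<noteq> u" "p0 d \<in> V - W"
proof -
  show d: "d \<in> D" using P assms by (auto dest: pieces_Some)
  show du: "d \<noteq> u" using assms by (auto simp: W_def sub_own)
  show "d \<notin> Z"
  proof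
    assume "d \<in> Z"
    then obtain w where "w \<in> W" "\<pi> w = Some d" by (auto simp: Z_def inner_def)
    then show False using W_piece[of w v] assms W_V by auto
  qed
  have "p0 d \<in> V" using p0 d by (rule attachment_in)
  moreover from this have "p0 d \<notin> W"
    using sub_step[of v V p0 d \<pi> u] assms du by (auto simp: W_def)
  ultimately show "p0 d \<in> V - W" by blast
qed

lemma p0_u: "p0 u \<in> V - W"
  using attachment_root_notin_sub[OF P p0 u] attachment_in[OF p0 u] by (auto simp: W_def)

lemma fiber_in_W: "p \<in> F \<Longrightarrow> d \<in> Z \<Longrightarrow> p d \<in> W"
proof -
  assume p: "p \<in> F" and d: "d \<in> Z"
  obtain v where v: "v \<in> W" "\<pi> v = Some d" "d \<in> D" "d \<noteq> u" using d by (auto simp: Z_def inner_def)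
  have "p d \<in> V" using p v by (auto simp: F_def intro: attachment_in)
  then show "p d \<in> W" using sub_step[of v V p d \<pi> u] v p W_V by (auto simp: F_def)
qed

text \<open>Cutting at \<open>u\<close> turns the number of steps up to \<open>u\<close> into a
  depth, so that the tail bound for the depth of a point becomes available below
  \<open>u\<close>.\<close>

lemma fiber_inner:
  assumes p: "p \<in> F" and "v \<in> W" and "\<pi> (up \<pi> p j v) = Some u"
  shows "grounded (cut_at \<pi> u) (restrict p Z) v \<and> depth (cut_at \<pi> u) (restrict p Z) v = j"
  using assms(2,3)
proof (induction j arbitrary: v)
  case 0
  then show ?case by (simp add: cut_at_def grounded_None)
next
  case (Suc j)
  have g: "grounded \<pi> p v" using p Suc.prems W_V by (auto simp: F_def intro: attachment_grounded)
  obtain d where d: "\<pi> v = Some d" "d = u \<or> d \<in> Z" using Suc.prems W_Some by blast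
  have "d \<noteq> u" using up_piece_unique[OF g, of 0 u "Suc j"] d Suc.prems by auto
  with d have dZ: "d \<in> Z" by simp
  have c: "cut_at \<pi> u v = Some d" using d \<open>d \<noteq> u\<close> by (simp add: cut_at_def)
  have "\<pi> (up \<pi> p j (p d)) = Some u" using Suc.prems d by simp
  then have IH: "grounded (cut_at \<pi> u) (restrict p Z) (p d)" "depth (cut_at \<pi> u) (restrict p Z) (p d) = j"
    using Suc.IH[OF fiber_in_W[OF p dZ]] by blast+
  moreover have r: "restrict p Z d = p d" using dZ by simp
  ultimately have "grounded (cut_at \<pi> u) (restrict p Z) v"
    using grounded_Some[of "cut_at \<pi> u" v d "restrict p Z", OF c] by simp
  with depth_Some[OF this c] r IH(2) this show ?case by metis
qed

lemma pieces_inner: "pieces W Z (cut_at \<pi> u)"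
  unfolding pieces_def
proof (intro conjI ballI)
  show "finite W" "finite Z"
    using P W_V Z_D by (auto simp: pieces_def intro: finite_subset)
  show "cut_at \<pi> u ` W \<subseteq> insert None (Some ` Z)"
    using W_Some by (force simp: cut_at_def)
  fix d assume "d \<in> Z"
  then obtain v where "v \<in> W" "\<pi> v = Some d" "d \<noteq> u" by (auto simp: Z_def inner_def)
  then show "\<exists>v\<in>W. cut_at \<pi> u v = Some d"
    by (intro bexI[of _ v]) (auto simp: cut_at_def)
qed

lemma fiber_restrict: "p \<in> F \<Longrightarrow> restrict p Z \<in> attachments W Z (cut_at \<pi> u)"
proof -
  assume p: "p \<in> F"
  have "grounded (cut_at \<pi> u) (restrict p Z) v" if "v \<in> W" for v
  proof -
    have "v \<in> sub V \<pi> p u" using that p by (simp add: F_def)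
    then show ?thesis using fiber_inner[OF p that] by (auto simp: sub_def)
  qed
  then show ?thesis using fiber_in_W[OF p] by (auto simp: attachments_def)
qed

text \<open>Outside \<open>W\<close> a climb uses only \<open>p0\<close> and never enters
  \<open>W\<close>; inside, \<open>q\<close> leads up to \<open>u\<close>, whose carrier
  \<open>p0 u\<close> lies outside again. Hence the combined map is acyclic and has exactly
  \<open>W\<close> below \<open>u\<close>.\<close>

lemma extend_fiber:
  assumes q: "q \<in> attachments W Z (cut_at \<pi> u)"
  defines "p \<equiv> \<lambda>d. if d \<in> Z then q d else p0 d"
  shows "p \<in> F"
proof -
  have qW: "q d \<in> W" if "d \<in> Z" for d using q that by (rule attachment_in)
  have 1: "p \<in> D \<rightarrow>\<^sub>E V"
  proof (rule PiE_I)
    show "p d \<in> V" if "d \<in> D" for d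
      using qW[of d] W_V attachment_in[OF p0 that] by (auto simp: p_def)
    show "p d = undefined" if "d \<notin> D" for d
      using that Z_D p0 by (auto simp: p_def attachments_def PiE_def extensional_def)
  qed
  have out: "grounded \<pi> p v" if v: "v \<in> V - W" for v
  proof -
    have "grounded \<pi> p0 v" using attachment_grounded[OF p0, of v] v by blast
    then show ?thesis using v
    proof (induction rule: grounded_induct)
      case (Some v d)
      then have "p d = p0 d" "p0 d \<in> V - W" using not_W_Some[of v d] by (auto simp: p_def)
      then show ?case using Some grounded_Some[of \<pi> v d p] by simp
    qed (auto intro: grounded_None)
  qed
  have ins: "grounded \<pi> p v \<and> (\<exists>j. \<pi> (up \<pi> p j v) = Some u)" if "v \<in> W" for v
    using attachment_grounded[OF q that] that
  proof (induction rule: grounded_induct)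
    case (None v)
    then have v: "\<pi> v = Some u" using W_Some[of v] by (auto simp: cut_at_def split: if_splits)
    have "p u = p0 u" using Z_D by (simp add: p_def)
    then have "grounded \<pi> p v" using out[of "p u"] p0_u grounded_Some[of \<pi> v u p] v by simp
    then show ?case using v by (auto intro!: exI[of _ 0])
  next
    case (Some v d)
    then have v: "\<pi> v = Some d" "d \<noteq> u" by (auto simp: cut_at_def split: if_splits)
    then have d: "d \<in> Z" using W_Some[of v] Some by auto
    then have pd: "p d = q d" by (simp add: p_def)
    then obtain j where g: "grounded \<pi> p (p d)" "\<pi> (up \<pi> p j (p d)) = Some u" using Some qW[OF d] by auto
    then have "\<pi> (up \<pi> p (Suc j) v) = Some u" using v by simp
    then show ?case using g grounded_Some[of \<pi> v d p] v by blast
  qed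
  have att: "p \<in> attachments V D \<pi>" using 1 out ins by (auto simp: attachments_def)
  have stay: "up \<pi> p j v \<in> V - W" if "v \<in> V - W" for v j
    using that
  proof (induction j arbitrary: v)
    case (Suc j)
    show ?case
    proof (cases "\<pi> v")
      case (Some d)
      then have "p d = p0 d" "p0 d \<in> V - W" using not_W_Some[of v d] Suc.prems by (auto simp: p_def)
      then show ?thesis using Suc.IH[of "p d"] Some by simp
    qed (use Suc in simp)
  qed simp
  have "sub V \<pi> p u = W"
  proof
    show "W \<subseteq> sub V \<pi> p u" using ins W_V by (auto simp: sub_def)
    show "sub V \<pi> p u \<subseteq> W"
    proof
      fix v assume v: "v \<in> sub V \<pi> p u"
      then obtain j where j: "\<pi> (up \<pi> p j v) = Some u" by (auto simp: sub_def)
      show "v \<in> W"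
      proof (rule ccontr)
        assume "v \<notin> W"
        then have "up \<pi> p j v \<in> V - W" using stay[of v j] v by (simp add: sub_def)
        then show False using j sub_own[of "up \<pi> p j v" V \<pi> u p0] by (auto simp: W_def)
      qed
    qed
  qed
  then show ?thesis using att by (auto simp: F_def p_def fun_eq_iff)
qed

lemma fiber_bij: "bij_betw (\<lambda>p. restrict p Z) F (attachments W Z (cut_at \<pi> u))"
proof (rule bij_betw_byWitness[where f' = "\<lambda>q d. if d \<in> Z then q d else p0 d"])
  show "\<forall>p\<in>F. (\<lambda>d. if d \<in> Z then restrict p Z d else p0 d) = p"
  proof clarify
    fix p assume p: "p \<in> F"
    have "p d = p0 d" if "d \<notin> Z" for d
    proof (cases "d \<in> D")
      case True
      have "restrict p (D - Z) d = restrict p0 (D - Z) d" using p by (simp add: F_def)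
      then show ?thesis using that True by simp
    next
      case False
      then show ?thesis using p p0 by (auto simp: F_def attachments_def PiE_def extensional_def)
    qed
    then show "(\<lambda>d. if d \<in> Z then restrict p Z d else p0 d) = p" by auto
  qed
  show "\<forall>q\<in>attachments W Z (cut_at \<pi> u). restrict (\<lambda>d. if d \<in> Z then q d else p0 d) Z = q"
    by (auto simp: fun_eq_iff attachments_def PiE_def extensional_def)
  show "(\<lambda>p. restrict p Z) ` F \<subseteq> attachments W Z (cut_at \<pi> u)"
    using fiber_restrict by blast
  show "(\<lambda>q d. if d \<in> Z then q d else p0 d) ` attachments W Z (cut_at \<pi> u) \<subseteq> F"
    using extend_fiber by blast
qed

text \<open>On the fibre the inner part ranges over all attachments of \<open>W\<close>, so the
  depth tail applies to each single point of \<open>W\<close>; exchanging the sums over attachments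
  and points adds these tails up.\<close>

lemma fiber_sum:
  "(\<Sum>p \<in> F. real (card {v \<in> V. \<exists>j \<ge> Suc l. \<pi> (up \<pi> p j v) = Some u})) \<le>
    exp (- (real l)\<^sup>2 / (2 * card W)) * (\<Sum>p \<in> F. real (card (sub V \<pi> p u)))"
proof -
  let ?c = "cut_at \<pi> u" and ?E = "exp (- (real l)\<^sup>2 / (2 * card W))"
  have finF: "finite F" using finite_attachments[OF P] by (simp add: F_def)
  have finW: "finite W" using pieces_inner by (simp add: pieces_def)
  have eq: "{v \<in> V. \<exists>j \<ge> Suc l. \<pi> (up \<pi> p j v) = Some u} = {v \<in> W. Suc l \<le> depth ?c (restrict p Z) v}"
    if p: "p \<in> F" for p
  proof -
    have W: "W = sub V \<pi> p u" using p by (simp add: F_def)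
    show ?thesis using fiber_inner[OF p] unfolding W by (fastforce simp: sub_def)
  qed
  have "(\<Sum>p \<in> F. real (card {v \<in> V. \<exists>j \<ge> Suc l. \<pi> (up \<pi> p j v) = Some u})) =
      (\<Sum>p \<in> F. \<Sum>v \<in> W. if Suc l \<le> depth ?c (restrict p Z) v then 1 else 0)"
    using finW by (intro sum.cong) (auto simp: eq simp flip: sum.inter_filter)
  also have "\<dots> = (\<Sum>v \<in> W. \<Sum>p \<in> F. if Suc l \<le> depth ?c (restrict p Z) v then 1 else 0)"
    by (rule sum.swap)
  also have "\<dots> = (\<Sum>v \<in> W. real (card {p \<in> F. Suc l \<le> depth ?c (restrict p Z) v}))"
    using finF by (intro sum.cong) (auto simp flip: sum.inter_filter)
  also have "\<dots> \<le> (\<Sum>v \<in> W. real (card F) * ?E)"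
  proof (rule sum_mono)
    fix v assume v: "v \<in> W"
    have "card {p \<in> F. Suc l \<le> depth ?c (restrict p Z) v} \<le>
        card {q \<in> attachments W Z ?c. Suc l \<le> depth ?c q v}"
    proof (rule card_inj_on_le[where f = "\<lambda>p. restrict p Z"])
      show "inj_on (\<lambda>p. restrict p Z) {p \<in> F. Suc l \<le> depth ?c (restrict p Z) v}"
        using fiber_bij by (auto simp: bij_betw_def elim!: inj_on_subset)
      show "(\<lambda>p. restrict p Z) ` {p \<in> F. Suc l \<le> depth ?c (restrict p Z) v}
          \<subseteq> {q \<in> attachments W Z ?c. Suc l \<le> depth ?c q v}"
        using fiber_restrict by auto
      show "finite {q \<in> attachments W Z ?c. Suc l \<le> depth ?c q v}"
        using finite_attachments[OF pieces_inner] by simp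
    qed
    then have "real (card {p \<in> F. Suc l \<le> depth ?c (restrict p Z) v}) \<le>
        real (card {q \<in> attachments W Z ?c. Suc l \<le> depth ?c q v})" by simp
    also have "\<dots> \<le> real (card (attachments W Z ?c)) * ?E"
      by (rule depth_tail_point[OF pieces_inner v])
    also have "card (attachments W Z ?c) = card F"
      using bij_betw_same_card[OF fiber_bij] by simp
    finally show "real (card {p \<in> F. Suc l \<le> depth ?c (restrict p Z) v}) \<le> real (card F) * ?E" .
  qed
  also have "\<dots> = ?E * (\<Sum>p \<in> F. real (card (sub V \<pi> p u)))"
    by (simp add: F_def)
  finally show ?thesis .
qed

end

section \<open>Pairs of a small subtree and a deep point in it\<close>

definition deep_pairs ::
  "'v set \<Rightarrow> 'd set \<Rightarrow> ('v \<Rightarrow> 'd option) \<Rightarrow> ('d \<Rightarrow> 'v) \<Rightarrow> real \<Rightarrow> nat \<Rightarrow> ('d \<times> 'v) set" where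
  "deep_pairs V D \<pi> p m l = {(u, v). u \<in> D \<and> v \<in> V \<and> real (card (sub V \<pi> p u)) \<le> m \<and>
     (\<exists>j \<ge> l. \<pi> (up \<pi> p j v) = Some u)}"

lemma finite_deep_pairs: "pieces V D \<pi> \<Longrightarrow> finite (deep_pairs V D \<pi> p m l)"
  by (rule finite_subset[of _ "D \<times> V"]) (auto simp: deep_pairs_def pieces_def)

lemma card_deep_pairs:
  assumes "pieces V D \<pi>"
  shows "real (card (deep_pairs V D \<pi> p m l)) = (\<Sum>u \<in> D. if real (card (sub V \<pi> p u)) \<le> m
     then real (card {v \<in> V. \<exists>j \<ge> l. \<pi> (up \<pi> p j v) = Some u}) else 0)"
proof -
  have fin: "finite V" "finite D" using assms by (auto simp: pieces_def)
  have "deep_pairs V D \<pi> p m l = (SIGMA u:D. if real (card (sub V \<pi> p u)) \<le> m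
     then {v \<in> V. \<exists>j \<ge> l. \<pi> (up \<pi> p j v) = Some u} else {})"
    by (auto simp: deep_pairs_def split: if_splits)
  then have "card (deep_pairs V D \<pi> p m l) = (\<Sum>u \<in> D. card (if real (card (sub V \<pi> p u)) \<le> m
     then {v \<in> V. \<exists>j \<ge> l. \<pi> (up \<pi> p j v) = Some u} else {}))"
    using fin by (simp add: card_SigmaI)
  then show ?thesis by (auto intro!: sum.cong)
qed

text \<open>Attachments are grouped by the set below \<open>u\<close> and by their values outside of
  it. Each group is one fibre, and its bound in terms of the size of that set is weakened to
  \<open>m\<close>.\<close>

lemma sum_below_piece:
  assumes P: "pieces V D \<pi>" and u: "u \<in> D" and m: "0 < m"
  defines "A \<equiv> {p \<in> attachments V D \<pi>. real (card (sub V \<pi> p u)) \<le> m}"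
  shows "(\<Sum>p \<in> A. real (card {v \<in> V. \<exists>j \<ge> Suc l. \<pi> (up \<pi> p j v) = Some u})) \<le>
    exp (- (real l)\<^sup>2 / (2 * m)) * (\<Sum>p \<in> A. real (card (sub V \<pi> p u)))"
proof -
  let ?k = "\<lambda>p. (sub V \<pi> p u, restrict p (D - inner D \<pi> u (sub V \<pi> p u)))"
  let ?g = "\<lambda>p. real (card {v \<in> V. \<exists>j \<ge> Suc l. \<pi> (up \<pi> p j v) = Some u})"
  let ?h = "\<lambda>p. real (card (sub V \<pi> p u))"
  have finA: "finite A" using finite_attachments[OF P] by (simp add: A_def)
  have "(\<Sum>p \<in> A. ?g p) = (\<Sum>y \<in> ?k ` A. \<Sum>p \<in> {p \<in> A. ?k p = y}. ?g p)"
    by (rule sum.image_gen[OF finA])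
  also have "\<dots> \<le> (\<Sum>y \<in> ?k ` A. exp (- (real l)\<^sup>2 / (2 * m)) * (\<Sum>p \<in> {p \<in> A. ?k p = y}. ?h p))"
  proof (rule sum_mono)
    fix y assume "y \<in> ?k ` A"
    then obtain p0 where p0: "p0 \<in> A" "y = ?k p0" by blast
    then have p0': "p0 \<in> attachments V D \<pi>" by (simp add: A_def)
    let ?W = "sub V \<pi> p0 u"
    have F: "{p \<in> A. ?k p = y} = {p \<in> attachments V D \<pi>. sub V \<pi> p u = ?W \<and>
        restrict p (D - inner D \<pi> u ?W) = restrict p0 (D - inner D \<pi> u ?W)}"
      using p0 by (auto simp: A_def)
    have "(\<Sum>p \<in> {p \<in> A. ?k p = y}. ?g p) \<le>
        exp (- (real l)\<^sup>2 / (2 * card ?W)) * (\<Sum>p \<in> {p \<in> A. ?k p = y}. ?h p)"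
      unfolding F by (rule fiber_sum[OF P p0' u])
    also have "\<dots> \<le> exp (- (real l)\<^sup>2 / (2 * m)) * (\<Sum>p \<in> {p \<in> A. ?k p = y}. ?h p)"
    proof (rule mult_right_mono)
      obtain v where "v \<in> V" "\<pi> v = Some u" using P u by (auto simp: pieces_def)
      then have "v \<in> ?W" by (rule sub_own)
      then have "card ?W > 0"
        using P by (auto simp: card_gt_0_iff pieces_def intro: finite_subset[OF sub_subset])
      moreover have "real (card ?W) \<le> m" using p0 by (simp add: A_def)
      ultimately show "exp (- (real l)\<^sup>2 / (2 * card ?W)) \<le> exp (- (real l)\<^sup>2 / (2 * m))"
        using m by (simp add: frac_le)
    qed (simp add: sum_nonneg)
    finally show "(\<Sum>p \<in> {p \<in> A. ?k p = y}. ?g p) \<le>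
        exp (- (real l)\<^sup>2 / (2 * m)) * (\<Sum>p \<in> {p \<in> A. ?k p = y}. ?h p)" .
  qed
  also have "\<dots> = exp (- (real l)\<^sup>2 / (2 * m)) * (\<Sum>y \<in> ?k ` A. \<Sum>p \<in> {p \<in> A. ?k p = y}. ?h p)"
    by (simp add: sum_distrib_left)
  also have "(\<Sum>y \<in> ?k ` A. \<Sum>p \<in> {p \<in> A. ?k p = y}. ?h p) = (\<Sum>p \<in> A. ?h p)"
    by (rule sum.image_gen[OF finA, symmetric])
  finally show ?thesis .
qed

lemma sum_deep_pairs_decay:
  assumes P: "pieces V D \<pi>" and m: "0 < m"
  shows "(\<Sum>p \<in> attachments V D \<pi>. real (card (deep_pairs V D \<pi> p m (Suc l)))) \<le>
    exp (- (real l)\<^sup>2 / (2 * m)) * (\<Sum>p \<in> attachments V D \<pi>. real (card (deep_pairs V D \<pi> p m 0)))"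
proof -
  let ?A = "attachments V D \<pi>" and ?E = "exp (- (real l)\<^sup>2 / (2 * m))"
  have S: "(\<Sum>p \<in> ?A. real (card (deep_pairs V D \<pi> p m i))) =
     (\<Sum>u \<in> D. \<Sum>p \<in> {p \<in> ?A. real (card (sub V \<pi> p u)) \<le> m}.
        real (card {v \<in> V. \<exists>j \<ge> i. \<pi> (up \<pi> p j v) = Some u}))" for i
    unfolding card_deep_pairs[OF P]
    by (subst sum.swap) (simp add: sum.inter_filter finite_attachments[OF P])
  show ?thesis
    unfolding S
    by (subst sum_distrib_left, rule sum_mono) (use sum_below_piece[OF P _ m, of _ l] in \<open>simp add: sub_def\<close>)
qed

text \<open>A climb meets one piece per step, so a point occurs in at most \<open>L\<close> pairs at
  relative depth below \<open>L\<close>.\<close>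

lemma card_deep_pairs_0:
  assumes P: "pieces V D \<pi>"
  shows "card (deep_pairs V D \<pi> p m 0) \<le> card V * L + card (deep_pairs V D \<pi> p m L)"
proof -
  have fin: "finite V" using P by (simp add: pieces_def)
  let ?B = "(\<lambda>(v, j). (the (\<pi> (up \<pi> p j v)), v)) ` (V \<times> {..<L})"
  have "deep_pairs V D \<pi> p m 0 \<subseteq> ?B \<union> deep_pairs V D \<pi> p m L"
  proof clarify
    fix u v assume uv: "(u, v) \<in> deep_pairs V D \<pi> p m 0" "(u, v) \<notin> deep_pairs V D \<pi> p m L"
    then obtain j where j: "\<pi> (up \<pi> p j v) = Some u" "v \<in> V" "j < L"
      by (auto simp: deep_pairs_def not_le)
    then show "(u, v) \<in> ?B" by (intro image_eqI[of _ _ "(v, j)"]) auto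
  qed
  then have "card (deep_pairs V D \<pi> p m 0) \<le> card (?B \<union> deep_pairs V D \<pi> p m L)"
    using fin finite_deep_pairs[OF P] by (intro card_mono) auto
  also have "\<dots> \<le> card ?B + card (deep_pairs V D \<pi> p m L)" by (rule card_Un_le)
  also have "card ?B \<le> card (V \<times> {..<L})" using fin by (intro card_image_le) auto
  finally show ?thesis by (simp add: card_cartesian_product)
qed

text \<open>
  The number of small pieces above an average point is bounded by itself: those within distance
  \<open>L\<close> are at most \<open>L\<close>, and the others are a small fraction of all of them.
\<close>

lemma sum_deep_pairs_0:
  assumes P: "pieces V D \<pi>" and m: "1 \<le> m"
  shows "(\<Sum>p \<in> attachments V D \<pi>. real (card (deep_pairs V D \<pi> p m 0))) \<le>
    9 * card V * sqrt m * card (attachments V D \<pi>)"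
proof -
  let ?A = "attachments V D \<pi>"
  define S where "S i = (\<Sum>p \<in> ?A. real (card (deep_pairs V D \<pi> p m i)))" for i
  define l where "l = nat \<lceil>sqrt m\<rceil>"
  have l: "sqrt m \<le> l" "l \<le> sqrt m + 1"
    using m by (auto simp: l_def real_nat_ceiling_ge of_nat_nat intro: of_int_ceiling_le_add_one)
  have "m \<le> (real l)\<^sup>2"
    using power_mono[OF l(1), of 2] m by simp
  then have "- (real l)\<^sup>2 / (2 * m) \<le> - (1 / 2)" using m by (simp add: field_simps)
  then have "exp (- (real l)\<^sup>2 / (2 * m)) \<le> exp (- (1 / 2))" by simp
  also have "\<dots> \<le> 2 / 3"
    using exp_ge_add_one_self[of "1 / 2"] by (simp add: exp_minus field_simps)
  finally have "exp (- (real l)\<^sup>2 / (2 * m)) * S 0 \<le> 2 / 3 * S 0"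
    by (rule mult_right_mono) (simp add: S_def sum_nonneg)
  moreover have "S (Suc l) \<le> exp (- (real l)\<^sup>2 / (2 * m)) * S 0"
    using sum_deep_pairs_decay[OF P, of m l] m by (simp add: S_def)
  moreover have "S 0 \<le> (\<Sum>p \<in> ?A. real (card V * Suc l) + real (card (deep_pairs V D \<pi> p m (Suc l))))"
    unfolding S_def
  proof (rule sum_mono)
    fix p
    show "real (card (deep_pairs V D \<pi> p m 0)) \<le>
        real (card V * Suc l) + real (card (deep_pairs V D \<pi> p m (Suc l)))"
      using card_deep_pairs_0[OF P, of p m "Suc l"] by linarith
  qed
  moreover have "\<dots> = real (card ?A) * (card V * Suc l) + S (Suc l)"
    by (simp add: S_def sum.distrib)
  \<comment> \<open>Pairs at depth \<open>Suc l\<close> or more are at most the fraction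
    \<open>exp (- 1/2) \<le> 2/3\<close> of all pairs; moving them to the left costs a factor
    \<open>3\<close>. The other factor \<open>3\<close> in \<open>9\<close> comes from
    \<open>Suc l \<le> sqrt m + 2 \<le> 3 sqrt m\<close>.\<close>
  ultimately have "S 0 \<le> 3 * (real (card ?A) * (card V * Suc l))" by linarith
  also have "\<dots> \<le> 3 * (real (card ?A) * (card V * (3 * sqrt m)))"
  proof -
    have "1 \<le> sqrt m" using m by simp
    then have "real (Suc l) \<le> 3 * sqrt m" using l unfolding of_nat_Suc by linarith
    then show ?thesis unfolding of_nat_mult by (intro mult_left_mono) auto
  qed
  finally show ?thesis by (simp add: S_def mult_ac)
qed

section \<open>Sub-Gaussian depth\<close>

lemma up_piece_cong: "\<pi> x = \<pi> y \<Longrightarrow> \<pi> (up \<pi> p k x) = \<pi> (up \<pi> p k y)"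
  by (cases k; cases "\<pi> y") auto

text \<open>Let \<open>i\<close> be the first step in \<open>I\<close>. A point below the piece of
  step \<open>i\<close> goes on along the climb of \<open>v\<close>, and at least \<open>l\<close>
  members of \<open>I\<close> lie \<open>l\<close> or more steps beyond \<open>i\<close>. Each of
  their pieces, combined with each of the at least \<open>c\<close> points below the piece of step
  \<open>i\<close>, is a deep pair.\<close>

lemma deep_pairs_lower:
  assumes P: "pieces V D \<pi>" and p: "p \<in> attachments V D \<pi>" and v: "v \<in> V"
    and I: "\<And>j. j \<in> I \<Longrightarrow> \<exists>u. \<pi> (up \<pi> p j v) = Some u \<and>
      c \<le> real (card (sub V \<pi> p u)) \<and> real (card (sub V \<pi> p u)) \<le> m"
    and l: "2 * l \<le> card I" and c: "0 \<le> c"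
  shows "real l * c \<le> card (deep_pairs V D \<pi> p m l)"
proof (cases "l = 0")
  case False
  then have finI: "finite I" and "I \<noteq> {}" using l by (auto intro: card_ge_0_finite)
  define i where "i = Min I"
  have i: "i \<in> I" "\<And>j. j \<in> I \<Longrightarrow> i \<le> j" using finI \<open>I \<noteq> {}\<close> by (auto simp: i_def)
  define w where "w j = the (\<pi> (up \<pi> p j v))" for j
  have w: "\<pi> (up \<pi> p j v) = Some (w j)" "c \<le> real (card (sub V \<pi> p (w j)))"
    "real (card (sub V \<pi> p (w j))) \<le> m" if "j \<in> I" for j
    using I[OF that] by (auto simp: w_def)
  have pV: "p \<in> D \<rightarrow> V" using p by (auto simp: attachments_def)
  have wD: "w j \<in> D" if "j \<in> I" for j
    using pieces_Some[OF P up_in[OF P pV v]] w(1)[OF that] by blast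
  define J where "J = {j \<in> I. i + l \<le> j}"
  have inj_w: "inj_on w J"
  proof (rule inj_onI)
    fix j j' assume "j \<in> J" "j' \<in> J" "w j = w j'"
    then show "j = j'"
      using up_piece_unique[OF attachment_grounded[OF p v], of j "w j" j'] w(1)
      by (auto simp: J_def)
  qed
  have "card (I - J) \<le> card {i..<i + l}"
    using i(2) by (intro card_mono) (auto simp: J_def not_le)
  moreover have "card (I - J) = card I - card J"
    using finI by (intro card_Diff_subset) (auto simp: J_def intro: finite_subset)
  ultimately have "l \<le> card J" using l by simp
  then have "real l * c \<le> real (card J) * real (card (sub V \<pi> p (w i)))"
    using w(2)[OF i(1)] c by (intro mult_mono) auto
  also have "\<dots> = real (card (J \<times> sub V \<pi> p (w i)))" by (simp add: card_cartesian_product)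
  also have "\<dots> \<le> real (card (deep_pairs V D \<pi> p m l))"
  proof (rule of_nat_mono)
    show "card (J \<times> sub V \<pi> p (w i)) \<le> card (deep_pairs V D \<pi> p m l)"
  proof (rule card_inj_on_le[where f = "\<lambda>(j, y). (w j, y)"])
    show "inj_on (\<lambda>(j, y). (w j, y)) (J \<times> sub V \<pi> p (w i))"
      using inj_w by (auto simp: inj_on_def)
    show "(\<lambda>(j, y). (w j, y)) ` (J \<times> sub V \<pi> p (w i)) \<subseteq> deep_pairs V D \<pi> p m l"
    proof clarify
      fix j y assume j: "j \<in> J" and y: "y \<in> sub V \<pi> p (w i)"
      then have jI: "j \<in> I" "i + l \<le> j" by (auto simp: J_def)
      obtain k where k: "\<pi> (up \<pi> p k y) = Some (w i)" "y \<in> V" using y by (auto simp: sub_def)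
      \<comment> \<open>After \<open>k\<close> steps \<open>y\<close> is in the piece
        \<open>w i\<close>. All points of a piece take the same next step, so from there
        \<open>y\<close> visits the same pieces as \<open>v\<close>.\<close>
      have "\<pi> (up \<pi> p ((j - i) + k) y) = \<pi> (up \<pi> p (j - i) (up \<pi> p i v))"
        unfolding up_add using k w(1)[OF i(1)] by (intro up_piece_cong) simp
      also have "\<dots> = Some (w j)"
        using w(1)[OF jI(1)] jI by (simp flip: up_add)
      finally show "(w j, y) \<in> deep_pairs V D \<pi> p m l"
        using jI k wD w(3) by (auto simp: deep_pairs_def intro!: exI[of _ "j - i + k"])
    qed
    show "finite (deep_pairs V D \<pi> p m l)" by (rule finite_deep_pairs[OF P])
  qed
  qed
  finally show ?thesis .
qed simp

section \<open>Bands of subtree sizes along a branch\<close>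

definition level ::
  "'v set \<Rightarrow> ('v \<Rightarrow> 'd option) \<Rightarrow> ('d \<Rightarrow> 'v) \<Rightarrow> 'v \<Rightarrow> nat \<Rightarrow> nat set" where
  "level V \<pi> p v k = {j. j < depth \<pi> p v \<and> (\<exists>u. \<pi> (up \<pi> p j v) = Some u \<and>
     card V < card (sub V \<pi> p u) * 16 ^ Suc k \<and> card (sub V \<pi> p u) * 16 ^ k \<le> card V)}"

lemma finite_level: "finite (level V \<pi> p v k)"
  by (rule finite_subset[of _ "{..<depth \<pi> p v}"]) (auto simp: level_def)

lemma less_16_power: "k < (16::nat) ^ k"
  by (rule less_le_trans[OF less_exp]) (simp add: power_mono)

lemma finite_16_powers: "finite {k. (16::nat) ^ k \<le> n}"
proof (rule finite_subset)
  show "{k. (16::nat) ^ k \<le> n} \<subseteq> {..n}"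
  proof clarify
    fix k assume "(16::nat) ^ k \<le> n"
    then show "k \<le> n" using less_16_power[of k] by linarith
  qed
qed simp

text \<open>A subtree of size \<open>M\<close> belongs to the band
  \<open>n/16^(k+1) < M \<le> n/16^k\<close>, where \<open>k\<close> is least with the first
  inequality; \<open>level\<close> states this by products to avoid division. As
  \<open>M \<ge> 1\<close>, only bands with \<open>16^k \<le> n\<close> occur.\<close>

lemma levels_cover:
  assumes P: "pieces V D \<pi>" and p: "p \<in> attachments V D \<pi>" and v: "v \<in> V"
  shows "{..<depth \<pi> p v} \<subseteq> (\<Union>k \<in> {k. 16 ^ k \<le> card V}. level V \<pi> p v k)"
proof
  fix j assume "j \<in> {..<depth \<pi> p v}"
  then have j: "j < depth \<pi> p v" by simp
  have g: "grounded \<pi> p v" using p v by (rule attachment_grounded)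
  have "\<pi> (up \<pi> p j v) \<noteq> None" using up_eq_None_iff[OF g] j by simp
  then obtain u where u: "\<pi> (up \<pi> p j v) = Some u" by blast
  have fin: "finite V" using P by (simp add: pieces_def)
  define M where "M = card (sub V \<pi> p u)"
  have "v \<in> sub V \<pi> p u" using v u by (auto simp: sub_def)
  then have M0: "0 < M" using fin by (auto simp: M_def card_gt_0_iff intro: finite_subset[OF sub_subset])
  have Mn: "M \<le> card V" unfolding M_def by (rule card_mono[OF fin sub_subset])
  define k where "k = (LEAST k. card V < M * 16 ^ Suc k)"
  have "card V < 16 ^ Suc (card V)"
    using less_16_power[of "card V"] by simp
  also have "\<dots> \<le> M * 16 ^ Suc (card V)" using M0 by simp
  finally have k1: "card V < M * 16 ^ Suc k" unfolding k_def by (rule LeastI)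
  have k2: "M * 16 ^ k \<le> card V"
  proof (cases k)
    case 0
    then show ?thesis using Mn by simp
  next
    case (Suc i)
    then have "\<not> card V < M * 16 ^ Suc i" unfolding k_def by (metis lessI not_less_Least)
    then show ?thesis using Suc by simp
  qed
  have "16 ^ k \<le> M * 16 ^ k" using M0 by simp
  also note k2
  finally have "k \<in> {k. 16 ^ k \<le> card V}" by blast
  moreover have "j \<in> level V \<pi> p v k"
    using k1 k2 j u unfolding M_def by (auto simp: level_def)
  ultimately show "j \<in> (\<Union>k \<in> {k. 16 ^ k \<le> card V}. level V \<pi> p v k)" by blast
qed

lemma sum_half_powers_le: "finite K \<Longrightarrow> (\<Sum>k \<in> K. (1 / 2 :: real) ^ k) \<le> 2"
proof -
  assume K: "finite K"
  have "(\<Sum>k \<in> K. (1 / 2 :: real) ^ k) \<le> (\<Sum>k. (1 / 2) ^ k)"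
    using K by (intro sum_le_suminf summable_geometric) auto
  also have "\<dots> = 2" by (subst suminf_geometric) auto
  finally show ?thesis .
qed

text \<open>The thresholds \<open>x / 2^k\<close> sum to at most \<open>2 x\<close>, so a branch of
  that length cannot stay below all of them.\<close>

lemma large_level:
  fixes x :: real
  assumes P: "pieces V D \<pi>" and p: "p \<in> attachments V D \<pi>" and v: "v \<in> V"
    and x: "0 < x" and d: "2 * x \<le> depth \<pi> p v"
  shows "\<exists>k. 16 ^ k \<le> card V \<and> x * (1 / 2) ^ k \<le> card (level V \<pi> p v k)"
proof (rule ccontr)
  assume asm: "\<not> ?thesis"
  then have small: "real (card (level V \<pi> p v k)) < x * (1 / 2) ^ k" if "16 ^ k \<le> card V" for k
    using asm that by (meson not_le)
  let ?K = "{k. (16::nat) ^ k \<le> card V}"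
  have finK: "finite ?K" by (rule finite_16_powers)
  have "0 < card V" using P v by (auto simp: pieces_def card_gt_0_iff)
  then have "0 \<in> ?K" by simp
  have "depth \<pi> p v = card {..<depth \<pi> p v}" by simp
  also have "\<dots> \<le> card (\<Union>k \<in> ?K. level V \<pi> p v k)"
    using finK finite_level by (intro card_mono levels_cover[OF P p v]) auto
  also have "\<dots> \<le> (\<Sum>k \<in> ?K. card (level V \<pi> p v k))"
    by (rule card_UN_le[OF finK])
  finally have "real (depth \<pi> p v) \<le> (\<Sum>k \<in> ?K. real (card (level V \<pi> p v k)))"
    by (metis of_nat_le_iff of_nat_sum)
  also have "\<dots> < (\<Sum>k \<in> ?K. x * (1 / 2) ^ k)"
    using \<open>0 \<in> ?K\<close> by (intro sum_strict_mono[OF finK]) (blast, simp add: small)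
  also have "\<dots> \<le> x * 2"
    using sum_half_powers_le[OF finK] x by (subst sum_distrib_left[symmetric]) simp
  finally show False using d by simp
qed

text \<open>Markov's inequality for the number of deep pairs at scale \<open>m = n / 16^k\<close>: a
  branch with \<open>T\<close> steps in the band yields at least \<open>(l + 1) m / 16\<close> pairs
  with \<open>l\<close> about \<open>T / 2\<close>, far more than expected.\<close>

lemma card_large_level:
  assumes P: "pieces V D \<pi>" and x: "8 \<le> x" and k: "16 ^ k \<le> card V"
  shows "real (card {p \<in> attachments V D \<pi>. \<exists>v \<in> V. x * sqrt (card V) * (1 / 2) ^ k \<le> card (level V \<pi> p v k)})
    \<le> 72 * exp (- x\<^sup>2 / 32) * (1 / 2) ^ k * card (attachments V D \<pi>)"
proof -
  define A where "A = real (card (attachments V D \<pi>))"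
  define s where "s = sqrt (card V)"
  define m where "m = real (card V) / 16 ^ k"
  define T where "T = x * s * (1 / 2) ^ k"
  define B where "B = {p \<in> attachments V D \<pi>. \<exists>v \<in> V. T \<le> card (level V \<pi> p v k)}"
  have n: "real (card V) = s\<^sup>2" by (simp add: s_def)
  have k': "(16::real) ^ k \<le> card V" using k by (metis of_nat_le_iff of_nat_numeral of_nat_power)
  then have m: "1 \<le> m" by (simp add: m_def)
  have sqrt_pow: "sqrt (16 ^ k) = (4::real) ^ k"
    using real_sqrt_power[of 16 k] by (simp add: real_sqrt_eq_iff)
  then have s: "4 ^ k \<le> s" using k' unfolding s_def by (metis real_sqrt_le_iff)
  have s0: "0 < s" by (rule less_le_trans[OF _ s]) simp
  have sm: "sqrt m = s / 4 ^ k" by (simp add: m_def real_sqrt_divide sqrt_pow s_def)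
  have T8: "8 \<le> T"
  proof -
    have "8 * 4 ^ k * (1 / 2) ^ k \<le> x * s * (1 / 2) ^ k"
      using x s s0 by (intro mult_right_mono mult_mono) auto
    moreover have "8 * 4 ^ k * (1 / 2) ^ k = 8 * (2::real) ^ k"
      by (simp add: power_mult_distrib[symmetric] mult.assoc)
    moreover have "1 \<le> (2::real) ^ k" by simp
    ultimately show ?thesis unfolding T_def by linarith
  qed
  \<comment> \<open>The \<open>- 1\<close> makes room for \<open>Suc l\<close> in the decay bound.
    From \<open>16^k \<le> n\<close> one has \<open>T \<ge> 8\<close>, which keeps \<open>l\<close>
    above \<open>T / 4\<close> in spite of rounding.\<close>
  define l where "l = nat \<lfloor>T / 2\<rfloor> - 1"
  have L: "real (Suc l) \<le> T / 2" "T / 4 \<le> real l"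
  proof -
    have f: "real (nat \<lfloor>T / 2\<rfloor>) = of_int \<lfloor>T / 2\<rfloor>" using T8 by simp
    have "T / 2 - 1 < real (nat \<lfloor>T / 2\<rfloor>)" "real (nat \<lfloor>T / 2\<rfloor>) \<le> T / 2" unfolding f by linarith+
    moreover from this T8 have "1 \<le> nat \<lfloor>T / 2\<rfloor>" by linarith
    then have "real (Suc l) = real (nat \<lfloor>T / 2\<rfloor>)" "real l = real (nat \<lfloor>T / 2\<rfloor>) - 1"
      by (auto simp: l_def)
    ultimately show "real (Suc l) \<le> T / 2" "T / 4 \<le> real l" using T8 by linarith+
  qed
  have X: "real (Suc l) * (m / 16) \<le> real (card (deep_pairs V D \<pi> p m (Suc l)))" if pB: "p \<in> B" for p
  proof -
    obtain v where v: "v \<in> V" "T \<le> card (level V \<pi> p v k)" and p: "p \<in> attachments V D \<pi>"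
      using pB unfolding B_def by blast
    have "real (2 * Suc l) \<le> real (card (level V \<pi> p v k))"
      using L v unfolding of_nat_mult by simp
    then have "2 * Suc l \<le> card (level V \<pi> p v k)" by (simp only: of_nat_le_iff)
    moreover have "\<exists>u. \<pi> (up \<pi> p j v) = Some u \<and>
      m / 16 \<le> real (card (sub V \<pi> p u)) \<and> real (card (sub V \<pi> p u)) \<le> m" if j: "j \<in> level V \<pi> p v k" for j
    proof -
      obtain u where u: "\<pi> (up \<pi> p j v) = Some u"
        "card V < card (sub V \<pi> p u) * 16 ^ Suc k" "card (sub V \<pi> p u) * 16 ^ k \<le> card V"
        using j by (auto simp: level_def)
      have "real (card V) \<le> real (card (sub V \<pi> p u) * 16 ^ Suc k)"
        "real (card (sub V \<pi> p u) * 16 ^ k) \<le> real (card V)"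
        using u by linarith+
      then show ?thesis using u(1) by (simp add: m_def field_simps)
    qed
    ultimately show ?thesis
      by (intro deep_pairs_lower[OF P p v(1), where I = "level V \<pi> p v k"]) (use m in auto)
  qed
  \<comment> \<open>From \<open>T^2 = x^2 4^k m\<close> the exponent is at least
    \<open>x^2 4^k / 32\<close>. By \<open>4^k \<ge> 1 + 3 k\<close> and \<open>x \<ge> 8\<close>
    this exceeds \<open>x^2 / 32\<close> by at least \<open>6 k\<close>, and
    \<open>exp 6 \<ge> 2^6\<close> makes the excess worth a factor \<open>16^-k\<close>.\<close>
  have E: "exp (- (real l)\<^sup>2 / (2 * m)) \<le> exp (- x\<^sup>2 / 32) / 16 ^ k"
  proof -
    have "T\<^sup>2 = x\<^sup>2 * 4 ^ k * m"
    proof -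
      have "((1 / 2 :: real) ^ k)\<^sup>2 * 16 ^ k = 4 ^ k"
        by (simp add: power2_eq_square power_mult_distrib[symmetric])
      then show ?thesis
        by (simp add: T_def m_def n power_mult_distrib field_simps)
    qed
    moreover have "(T / 4)\<^sup>2 \<le> (real l)\<^sup>2" using L T8 by (intro power_mono) auto
    ultimately have "- (real l)\<^sup>2 / (2 * m) \<le> - (x\<^sup>2 * 4 ^ k / 32)"
      using m by (simp add: field_simps)
    also have "\<dots> \<le> - x\<^sup>2 / 32 - 6 * k"
    proof -
      have "1 + real k * 3 \<le> (1 + 3) ^ k" by (rule Bernoulli_inequality) simp
      then have "x\<^sup>2 * (1 + real k * 3) \<le> x\<^sup>2 * 4 ^ k" by (intro mult_left_mono) auto
      moreover have "8\<^sup>2 * (real k * 3) \<le> x\<^sup>2 * (real k * 3)"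
        using x by (intro mult_right_mono power_mono) auto
      ultimately show ?thesis by (simp add: algebra_simps)
    qed
    finally have "exp (- (real l)\<^sup>2 / (2 * m)) \<le> exp (- x\<^sup>2 / 32) * exp (- (6 * real k))"
      by (simp flip: exp_add)
    also have "exp (- (6 * real k)) = 1 / exp 6 ^ k"
      by (simp add: exp_minus exp_of_nat_mult[symmetric] mult.commute divide_inverse)
    also have "exp (- x\<^sup>2 / 32) * (1 / exp 6 ^ k) \<le> exp (- x\<^sup>2 / 32) * (1 / 16 ^ k)"
    proof -
      have "(2::real) ^ 6 \<le> exp 1 ^ 6"
        using exp_ge_add_one_self[of 1] by (intro power_mono) auto
      also have "exp 1 ^ 6 = exp (6::real)" by (simp flip: exp_of_nat_mult)
      finally have "(16::real) ^ k \<le> exp 6 ^ k" by (intro power_mono) auto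
      then show ?thesis by (intro mult_left_mono) (auto simp: frac_le)
    qed
    finally show ?thesis by simp
  qed
  have finB: "finite B" "B \<subseteq> attachments V D \<pi>"
    using finite_attachments[OF P] by (auto simp: B_def)
  have "real (card B) * (real (Suc l) * (m / 16)) \<le> (\<Sum>p \<in> B. real (card (deep_pairs V D \<pi> p m (Suc l))))"
    using sum_mono[of B "\<lambda>_. real (Suc l) * (m / 16)"] X by simp
  also have "\<dots> \<le> (\<Sum>p \<in> attachments V D \<pi>. real (card (deep_pairs V D \<pi> p m (Suc l))))"
    using finB by (intro sum_mono2 finite_attachments[OF P]) auto
  also have "\<dots> \<le> exp (- (real l)\<^sup>2 / (2 * m)) * (\<Sum>p \<in> attachments V D \<pi>. real (card (deep_pairs V D \<pi> p m 0)))"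
    using sum_deep_pairs_decay[OF P] m by simp
  also have "\<dots> \<le> (exp (- x\<^sup>2 / 32) / 16 ^ k) * (9 * card V * sqrt m * A)"
    unfolding A_def using E sum_deep_pairs_0[OF P m] by (intro mult_mono) (auto intro: sum_nonneg)
  finally have main: "real (card B) * (real (Suc l) * (m / 16)) \<le>
      (exp (- x\<^sup>2 / 32) / 16 ^ k) * (9 * card V * sqrt m * A)" .
  have "real (card B) * (T / 4 * (m / 16)) \<le> real (card B) * (real (Suc l) * (m / 16))"
    using L m by (intro mult_left_mono mult_right_mono) auto
  also note main
  finally have "real (card B) * (T / 4 * (m / 16)) \<le>
      (exp (- x\<^sup>2 / 32) / 16 ^ k) * (9 * card V * sqrt m * A)" .
  moreover have "T / 4 * (m / 16) = x * (s ^ 3 / (64 * 2 ^ k * 16 ^ k))"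
    by (simp add: T_def m_def n power3_eq_cube power2_eq_square power_one_over field_simps)
  moreover have "(exp (- x\<^sup>2 / 32) / 16 ^ k) * (9 * card V * sqrt m * A) =
      576 * exp (- x\<^sup>2 / 32) * (1 / 2) ^ k * A * (s ^ 3 / (64 * 2 ^ k * 16 ^ k))"
  proof -
    have "(4::real) ^ k = 2 ^ k * 2 ^ k" by (simp add: power_mult_distrib[symmetric])
    then show ?thesis
      by (simp add: n sm power3_eq_cube power2_eq_square power_one_over field_simps)
  qed
  ultimately have "(real (card B) * x) * (s ^ 3 / (64 * 2 ^ k * 16 ^ k)) \<le>
      (576 * exp (- x\<^sup>2 / 32) * (1 / 2) ^ k * A) * (s ^ 3 / (64 * 2 ^ k * 16 ^ k))"
    by (simp only: mult.assoc)
  then have "real (card B) * x \<le> 576 * exp (- x\<^sup>2 / 32) * (1 / 2) ^ k * A"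
    by (rule mult_right_le_imp_le) (use s0 in simp)
  \<comment> \<open>Here \<open>576 = 9 * 64\<close>, with \<open>64 = 4 * 16\<close> from
    \<open>T / 4\<close> and \<open>m / 16\<close>; dividing by \<open>x \<ge> 8\<close> leaves
    \<open>72\<close>.\<close>
  moreover have "real (card B) * 8 \<le> real (card B) * x" using x by (intro mult_left_mono) auto
  ultimately have "real (card B) \<le> 72 * exp (- x\<^sup>2 / 32) * (1 / 2) ^ k * A" by linarith
  then show ?thesis by (simp add: B_def T_def A_def s_def)
qed

text \<open>A deep branch is long in one of the bands; the bounds \<open>72 * 2^-k\<close> for the
  bands sum to at most \<open>144\<close>.\<close>

theorem depth_sub_gaussian:
  assumes P: "pieces V D \<pi>" and x: "8 \<le> x"
  shows "real (card {p \<in> attachments V D \<pi>. \<exists>v \<in> V. 2 * x * sqrt (card V) \<le> depth \<pi> p v})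
    \<le> 144 * exp (- x\<^sup>2 / 32) * card (attachments V D \<pi>)"
proof (cases "V = {}")
  case False
  let ?K = "{k. (16::nat) ^ k \<le> card V}"
  let ?B = "\<lambda>k. {p \<in> attachments V D \<pi>. \<exists>v \<in> V. x * sqrt (card V) * (1 / 2) ^ k \<le> card (level V \<pi> p v k)}"
  have n: "0 < card V" using P False by (auto simp: pieces_def card_gt_0_iff)
  have finK: "finite ?K" by (rule finite_16_powers)
  have "{p \<in> attachments V D \<pi>. \<exists>v \<in> V. 2 * x * sqrt (card V) \<le> depth \<pi> p v} \<subseteq> (\<Union>k \<in> ?K. ?B k)"
  proof clarify
    fix p v assume p: "p \<in> attachments V D \<pi>" and v: "v \<in> V" "2 * x * sqrt (card V) \<le> depth \<pi> p v"
    have "0 < x * sqrt (card V)" using x n by simp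
    then show "p \<in> (\<Union>k \<in> ?K. ?B k)"
      using large_level[OF P p v(1), of "x * sqrt (card V)"] v p by (auto simp: mult.assoc)
  qed
  then have "card {p \<in> attachments V D \<pi>. \<exists>v \<in> V. 2 * x * sqrt (card V) \<le> depth \<pi> p v} \<le>
      card (\<Union>k \<in> ?K. ?B k)"
    using finite_attachments[OF P] by (intro card_mono finite_UN_I finK) auto
  also have "\<dots> \<le> (\<Sum>k \<in> ?K. card (?B k))" by (rule card_UN_le[OF finK])
  finally have "real (card {p \<in> attachments V D \<pi>. \<exists>v \<in> V. 2 * x * sqrt (card V) \<le> depth \<pi> p v}) \<le>
      real (\<Sum>k \<in> ?K. card (?B k))" by (rule of_nat_mono)
  also have "\<dots> = (\<Sum>k \<in> ?K. real (card (?B k)))" by (rule of_nat_sum)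
  also have "\<dots> \<le> (\<Sum>k \<in> ?K. 72 * exp (- x\<^sup>2 / 32) * card (attachments V D \<pi>) * (1 / 2) ^ k)"
  proof (rule sum_mono)
    fix k assume "k \<in> ?K"
    then show "real (card (?B k)) \<le> 72 * exp (- x\<^sup>2 / 32) * card (attachments V D \<pi>) * (1 / 2) ^ k"
      using card_large_level[OF P x, of k] by (simp add: mult_ac)
  qed
  also have "\<dots> \<le> 72 * exp (- x\<^sup>2 / 32) * card (attachments V D \<pi>) * 2"
    unfolding sum_distrib_left[symmetric] using sum_half_powers_le[OF finK] by (intro mult_left_mono) auto
  finally show ?thesis by simp
qed simp

section \<open>Blocks without separating vertices\<close>

text \<open>Walks are confined to \<open>S\<close>. In contrast to connectedness of a graph, the
  empty set is linked, so deleting vertices needs no case distinction.\<close>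

definition linked :: "'a rel \<Rightarrow> 'a set \<Rightarrow> bool" where
  "linked E S \<longleftrightarrow> (\<forall>x \<in> S. \<forall>y \<in> S. (x, y) \<in> rtrancl_on S E)"

lemma linkedD: "linked E S \<Longrightarrow> x \<in> S \<Longrightarrow> y \<in> S \<Longrightarrow> (x, y) \<in> rtrancl_on S E"
  by (simp add: linked_def)

lemma rtrancl_on_symD: "sym E \<Longrightarrow> (x, y) \<in> rtrancl_on S E \<Longrightarrow> (y, x) \<in> rtrancl_on S E"
  using rtrancl_on_sym by (auto dest: symD)

lemma linked_if_center:
  assumes "sym E" "\<And>x. x \<in> S \<Longrightarrow> (x, c) \<in> rtrancl_on S E"
  shows "linked E S"
  unfolding linked_def using assms by (blast intro: rtrancl_on_trans rtrancl_on_symD)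

lemma rtrancl_on_Restr:
  assumes "\<And>x y. x \<in> S \<Longrightarrow> y \<in> S \<Longrightarrow> (x, y) \<in> E \<Longrightarrow> (x, y) \<in> E'" and "(x, y) \<in> rtrancl_on S E"
  shows "(x, y) \<in> rtrancl_on S E'"
  using assms(2) by (induction rule: rtrancl_on_induct) (auto intro: assms(1) rtrancl_on_into_rtrancl_on)

lemma linked_cong:
  assumes "\<And>x y. x \<in> S \<Longrightarrow> y \<in> S \<Longrightarrow> (x, y) \<in> E \<longleftrightarrow> (x, y) \<in> E'"
  shows "linked E S \<longleftrightarrow> linked E' S"
  unfolding linked_def using rtrancl_on_Restr[of S E E'] rtrancl_on_Restr[of S E' E] assms by blast

lemma rtrancl_on_image:
  "(x, y) \<in> rtrancl_on S E \<Longrightarrow> (f x, f y) \<in> rtrancl_on (f ` S) (map_prod f f ` E)"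
proof (induction rule: rtrancl_on_induct)
  case (step y z)
  then have "(f y, f z) \<in> map_prod f f ` E" "f z \<in> f ` S" by (auto intro: rev_image_eqI)
  then show ?case using step.IH by (rule rtrancl_on_into_rtrancl_on[rotated])
qed simp

lemma linked_image: "linked E S \<Longrightarrow> linked (map_prod f f ` E) (f ` S)"
  unfolding linked_def by (auto intro: rtrancl_on_image)

lemma pair_graph_iff:
  "pair_graph G \<longleftrightarrow> finite (pverts G) \<and> parcs G \<subseteq> pverts G \<times> pverts G \<and> sym (parcs G) \<and> irrefl (parcs G)"
proof
  assume "pair_graph G"
  then interpret pair_graph G .
  show "finite (pverts G) \<and> parcs G \<subseteq> pverts G \<times> pverts G \<and> sym (parcs G) \<and> irrefl (parcs G)"
    using pair_finite_verts in_arcsD1 in_arcsD2 arcs_symmetric no_loops'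
    by (fastforce simp: sym_def irrefl_def)
next
  assume *: "finite (pverts G) \<and> parcs G \<subseteq> pverts G \<times> pverts G \<and> sym (parcs G) \<and> irrefl (parcs G)"
  then have "finite (parcs G)" by (auto intro: finite_subset)
  then show "pair_graph G"
    using * by unfold_locales (auto simp: symmetric_def irrefl_def)
qed

lemma symcl_sym: "sym E \<Longrightarrow> symcl E = E"
  by (auto simp: symcl_def dest: symD)

lemma connected_iff_linked:
  assumes "pair_graph G"
  shows "Digraph_Component.connected (with_proj G) \<longleftrightarrow> pverts G \<noteq> {} \<and> linked (parcs G) (pverts G)"
  using assms by (auto simp: connected_conv linked_def pair_graph_iff symcl_sym)

text \<open>Covers two-connected graphs and single edges at once. These are the possible blocks of a
  connected graph with at least two vertices, and the decomposition treats them alike.\<close>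

definition nonsep :: "'a pair_pre_digraph \<Rightarrow> bool" where
  "nonsep B \<longleftrightarrow> pair_graph B \<and> 2 \<le> card (pverts B) \<and> linked (parcs B) (pverts B) \<and>
     (\<forall>v \<in> pverts B. linked (parcs B) (pverts B - {v}))"

lemma connected_del_vert_iff:
  assumes "pair_graph G" "pverts G - {v} \<noteq> {}"
  shows "Digraph_Component.connected (pre_digraph.del_vert (with_proj G) v) \<longleftrightarrow> linked (parcs G) (pverts G - {v})"
proof -
  have "arcs_ends (pre_digraph.del_vert (with_proj G) v) = {a \<in> parcs G. fst a \<noteq> v \<and> snd a \<noteq> v}"
    by (auto simp: arcs_ends_conv pre_digraph.del_vert_simps)
  moreover have "symcl \<dots> = \<dots>"
    using assms by (intro symcl_sym) (auto simp: sym_def pair_graph_iff)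
  moreover have "linked \<dots> (pverts G - {v}) \<longleftrightarrow> linked (parcs G) (pverts G - {v})"
    by (rule linked_cong) auto
  ultimately show ?thesis
    using assms by (simp add: connected_conv pre_digraph.del_vert_simps linked_def)
qed

lemma graph_iff_pair_graph: "graph (with_proj G) \<longleftrightarrow> pair_graph G"
  using pair_graphI_graph pair_graph.pair_graphD_graph by blast

lemma two_connected_iff: "two_connected (with_proj B) \<longleftrightarrow> nonsep B \<and> 3 \<le> card (pverts B)"
proof (cases "pair_graph B \<and> 3 \<le> card (pverts B)")
  case True
  then have "pverts B - {v} \<noteq> {}" for v
    by (metis card.empty card_Diff_singleton_if diff_is_0_eq' le_numeral_extra(3) not_numeral_le_zero
        numeral_le_one_iff order_trans semiring_norm(70) diff_le_mono diff_is_0_eq)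
  moreover from True have "pverts B \<noteq> {}" by auto
  ultimately show ?thesis
    using True by (auto simp: two_connected_def nonsep_def graph_iff_pair_graph
        connected_iff_linked connected_del_vert_iff)
next
  case False
  then show ?thesis by (auto simp: two_connected_def nonsep_def graph_iff_pair_graph)
qed

lemma strongly_connected_iff_linked:
  "strongly_connected (with_proj G) \<longleftrightarrow> pverts G \<noteq> {} \<and> linked (parcs G) (pverts G)"
  by (auto simp: strongly_connected_def linked_def reachable_def)

lemma card_sccs_eq_1:
  assumes "pair_graph G" "pverts G \<noteq> {}" "linked (parcs G) (pverts G)"
  shows "card (pre_digraph.sccs (with_proj G)) = 1"
proof -
  interpret pair_graph G by fact
  have "strongly_connected (with_proj G)" using assms by (simp add: strongly_connected_iff_linked)
  then show ?thesis using strongly_connected_eq_iff by simp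
qed

lemma card_sccs_gt_1:
  assumes "pair_graph G" "\<not> linked (parcs G) (pverts G)"
  shows "1 < card (pre_digraph.sccs (with_proj G))"
proof -
  interpret pair_graph G by fact
  obtain u v where uv: "u \<in> pverts G" "v \<in> pverts G" "(u, v) \<notin> rtrancl_on (pverts G) (parcs G)"
    using assms by (auto simp: linked_def)
  then have "\<not> reachable (with_proj G) u v" by (simp add: reachable_def)
  then have "v \<notin> scc_of u" by (simp add: scc_of_def)
  moreover have "v \<in> scc_of v" using uv by (simp add: in_scc_of_self)
  ultimately have ne: "scc_of u \<noteq> scc_of v" by blast
  have "{scc_of u, scc_of v} \<subseteq> sccs_verts" using uv scc_of_in_sccs_verts by auto
  then have "card {scc_of u, scc_of v} \<le> card sccs_verts"
    by (intro card_mono finite_sccs_verts)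
  then show ?thesis using ne by (simp add: card_sccs_verts)
qed

lemma is_bridge_iff:
  assumes G: "pair_graph G" "linked (parcs G) (pverts G)"
  shows "is_bridge G u v \<longleftrightarrow> (u, v) \<in> parcs G \<and> \<not> linked (parcs G - {(u, v), (v, u)}) (pverts G)"
proof (cases "(u, v) \<in> parcs G")
  case True
  then have ne: "pverts G \<noteq> {}" using G by (auto simp: pair_graph_iff)
  have G': "pair_graph (delete_edge G u v)"
    using G by (auto simp: pair_graph_iff delete_edge_def sym_def irrefl_def)
  have "card (pre_digraph.sccs (with_proj (delete_edge G u v))) = 1"
    if "linked (parcs G - {(u, v), (v, u)}) (pverts G)"
    using card_sccs_eq_1[OF G'] ne that by (simp add: delete_edge_def)
  moreover have "1 < card (pre_digraph.sccs (with_proj (delete_edge G u v)))"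
    if "\<not> linked (parcs G - {(u, v), (v, u)}) (pverts G)"
    using card_sccs_gt_1[OF G'] that by (simp add: delete_edge_def)
  ultimately show ?thesis
    using card_sccs_eq_1[OF G(1) ne G(2)] True by (auto simp: is_bridge_def)
qed (simp add: is_bridge_def)

lemma subgraph_with_proj_iff:
  assumes "pair_graph G"
  shows "subgraph (with_proj B) (with_proj G) \<longleftrightarrow>
    pverts B \<subseteq> pverts G \<and> parcs B \<subseteq> parcs G \<and> parcs B \<subseteq> pverts B \<times> pverts B"
proof -
  have "wf_digraph (with_proj G)"
    using assms by (auto simp: wf_digraph_wp_iff pair_graph_iff pair_wf_digraph_def)
  moreover have "wf_digraph (with_proj B) \<longleftrightarrow> parcs B \<subseteq> pverts B \<times> pverts B"
    by (auto simp: wf_digraph_wp_iff pair_wf_digraph_def)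
  ultimately show ?thesis
    by (auto simp: subgraph_def)
qed

text \<open>Translates maximality among arbitrary digraphs into maximality among pair graphs. A
  graph \<open>H\<close> containing \<open>B\<close> has at least three vertices, so for it
  \<open>nonsep\<close> already means two-connected.\<close>

lemma max_subgraph_two_connected_iff:
  assumes G: "pair_graph G"
  shows "pre_digraph.max_subgraph (with_proj G) two_connected (with_proj B) \<longleftrightarrow>
    nonsep B \<and> 3 \<le> card (pverts B) \<and> pverts B \<subseteq> pverts G \<and> parcs B \<subseteq> parcs G \<and>
    (\<forall>H. nonsep H \<and> pverts B \<subseteq> pverts H \<and> parcs B \<subseteq> parcs H \<and> pverts H \<subseteq> pverts G \<and>
       parcs H \<subseteq> parcs G \<longrightarrow> H = B)" (is "?L \<longleftrightarrow> ?R")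
proof
  assume L: ?L
  then have sub: "subgraph (with_proj B) (with_proj G)" and two: "two_connected (with_proj B)"
    and max: "\<And>H'. H' \<noteq> with_proj B \<Longrightarrow> subgraph (with_proj B) H' \<Longrightarrow> subgraph H' (with_proj G) \<Longrightarrow> \<not> two_connected H'"
    by (auto simp: pre_digraph.max_subgraph_def)
  have B: "nonsep B" "3 \<le> card (pverts B)" using two by (auto simp: two_connected_iff)
  have "H = B" if H: "nonsep H" "pverts B \<subseteq> pverts H" "parcs B \<subseteq> parcs H" "pverts H \<subseteq> pverts G" "parcs H \<subseteq> parcs G" for H
  proof (rule ccontr)
    assume "H \<noteq> B"
    then have "pverts H \<noteq> pverts B \<or> parcs H \<noteq> parcs B" by auto
    then have "with_proj H \<noteq> with_proj B" by (metis with_proj_simps(1,2))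
    moreover have pg: "pair_graph H" "pair_graph B" using H B by (auto simp: nonsep_def)
    then have "subgraph (with_proj B) (with_proj H)" "subgraph (with_proj H) (with_proj G)"
      using H by (auto simp: subgraph_with_proj_iff[OF G] subgraph_with_proj_iff[of H] pair_graph_iff)
    moreover have "card (pverts B) \<le> card (pverts H)"
      using H pg by (intro card_mono) (auto simp: pair_graph_iff)
    then have "two_connected (with_proj H)" using H B by (auto simp: two_connected_iff)
    ultimately show False using max by blast
  qed
  then show ?R using sub B by (auto simp: subgraph_with_proj_iff[OF G])
next
  assume R: ?R
  show ?L
    unfolding pre_digraph.max_subgraph_def
  proof (intro conjI allI impI notI)
    show "subgraph (with_proj B) (with_proj G)"
      using R by (auto simp: subgraph_with_proj_iff[OF G] nonsep_def pair_graph_iff)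
    show "two_connected (with_proj B)" using R by (simp add: two_connected_iff)
    fix H' assume H': "H' \<noteq> with_proj B \<and> subgraph (with_proj B) H'"
      and H'G: "subgraph H' (with_proj G) \<and> two_connected H'"
    define H where "H = \<lparr>pverts = verts H', parcs = arcs H'\<rparr>"
    \<comment> \<open>A digraph compatible with \<open>with_proj B\<close> has the same head and
      tail maps, the projections, and is thus determined by its vertices and arcs.\<close>
    have eq: "H' = with_proj H"
      using H' by (auto simp: H_def with_proj_def subgraph_def compatible_def intro!: pre_digraph.equality)
    have "nonsep H" using H'G by (simp add: eq two_connected_iff)
    moreover have "pverts B \<subseteq> pverts H" "parcs B \<subseteq> parcs H" "pverts H \<subseteq> pverts G" "parcs H \<subseteq> parcs G"
      using H' H'G by (auto simp: eq subgraph_def)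
    ultimately have "H = B" using R by blast
    then show False using H' eq by simp
  qed
qed

lemma nonsep_card_2:
  assumes "nonsep B" "card (pverts B) < 3" "x \<in> pverts B" "y \<in> pverts B" "x \<noteq> y"
  shows "B = \<lparr>pverts = {x, y}, parcs = {(x, y), (y, x)}\<rparr>"
proof -
  have B: "pair_graph B" "2 \<le> card (pverts B)" "linked (parcs B) (pverts B)"
    using assms by (auto simp: nonsep_def)
  then have fin: "finite (pverts B)" by (simp add: pair_graph_iff)
  have "{x, y} = pverts B"
    using assms fin by (intro card_seteq) auto
  then have V: "pverts B = {x, y}" by simp
  have "(x, y) \<in> rtrancl_on (pverts B) (parcs B)" using B assms by (auto intro: linkedD)
  then obtain z where "(x, z) \<in> parcs B"
    using assms(5) by (auto elim: converse_rtrancl_on_cases)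
  then have "(x, y) \<in> parcs B" using B V by (auto simp: pair_graph_iff irrefl_def)
  then have "parcs B = {(x, y), (y, x)}"
    using B V by (auto simp: pair_graph_iff irrefl_def sym_def)
  then show ?thesis using V by simp
qed

text \<open>A third vertex \<open>w\<close> serves as centre. Deleting \<open>u\<close> or
  \<open>v\<close> also removes the edge between them, so every vertex reaches \<open>w\<close>
  without it: those other than \<open>u\<close> in the graph minus \<open>u\<close>, and
  \<open>u\<close> itself in the graph minus \<open>v\<close>.\<close>

lemma nonsep_delete_edge:
  assumes B: "nonsep B" "3 \<le> card (pverts B)" and uv: "u \<in> pverts B" "v \<in> pverts B" "u \<noteq> v"
  shows "linked (parcs B - {(u, v), (v, u)}) (pverts B)"
proof -
  let ?E = "parcs B - {(u, v), (v, u)}"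
  have fin: "finite (pverts B)" and sym: "sym (parcs B)" using B by (auto simp: nonsep_def pair_graph_iff)
  have "card {u, v} < card (pverts B)" using B uv by simp
  then obtain w where w: "w \<in> pverts B" "w \<noteq> u" "w \<noteq> v"
    using fin by (metis card_mono insertCI not_le subsetI finite.intros)
  have avoid: "(x, w) \<in> rtrancl_on (pverts B) ?E" if "a = u \<or> a = v" "x \<in> pverts B - {a}" for x a
  proof -
    have "linked (parcs B) (pverts B - {a})" using B that uv by (auto simp: nonsep_def)
    then have "(x, w) \<in> rtrancl_on (pverts B - {a}) (parcs B)"
      using that w by (auto intro: linkedD)
    then have "(x, w) \<in> rtrancl_on (pverts B - {a}) ?E"
      by (rule rtrancl_on_Restr[rotated]) (use that in auto)
    then show ?thesis by (rule rtrancl_on_mono[rotated 2]) auto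
  qed
  show ?thesis
  proof (rule linked_if_center)
    show "sym ?E" using sym by (auto simp: sym_def)
    fix x assume x: "x \<in> pverts B"
    show "(x, w) \<in> rtrancl_on (pverts B) ?E"
      using avoid[of u x] avoid[of v x] x uv by (cases "x = u") auto
  qed
qed

section \<open>Sets left through a single vertex\<close>

lemma rtrancl_on_stay:
  assumes exit: "\<And>x y. x \<in> S \<Longrightarrow> y \<notin> S \<Longrightarrow> (x, y) \<in> E \<Longrightarrow> y = c"
    and "(x, y) \<in> rtrancl_on T E" "c \<notin> T" "x \<in> S"
  shows "y \<in> S"
  using assms(2) by (induction rule: rtrancl_on_induct) (use assms in blast)+

text \<open>Every excursion of the walk into \<open>S\<close> starts and ends at \<open>c\<close>,
  by symmetry of \<open>E\<close>; sending all of \<open>S\<close> to \<open>c\<close> shrinks it to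
  a stay at \<open>c\<close>.\<close>

lemma rtrancl_on_collapse:
  assumes exit: "\<And>x y. x \<in> S \<Longrightarrow> y \<notin> S \<Longrightarrow> (x, y) \<in> E \<Longrightarrow> y = c"
    and "sym E" and xy: "(x, y) \<in> rtrancl_on V E" "x \<notin> S" "y \<notin> S" and c: "c \<in> V - S"
  shows "(x, y) \<in> rtrancl_on (V - S) E"
proof -
  let ?f = "\<lambda>x. if x \<in> S then c else x"
  have "(x, ?f y) \<in> rtrancl_on (V - S) E"
    using xy(1)
  proof (induction rule: rtrancl_on_induct)
    case base
    then show ?case using xy by simp
  next
    case (step y z)
    have "?f y = ?f z \<or> (?f y, ?f z) \<in> E"
      using exit[of y z] exit[of z y] step \<open>sym E\<close> by (auto dest: symD)
    moreover have "?f z \<in> V - S" using step c by auto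
    ultimately show ?case
      using step.IH rtrancl_on_into_rtrancl_on[OF step.IH, of "?f z"] by (elim disjE) (simp_all only:)
  qed
  then show ?thesis using xy by simp
qed

section \<open>Graphs built from rooted blocks\<close>

definition map_graph :: "('a \<Rightarrow> 'b) \<Rightarrow> 'a pair_pre_digraph \<Rightarrow> 'b pair_pre_digraph" where
  "map_graph f B = \<lparr>pverts = f ` pverts B, parcs = map_prod f f ` parcs B\<rparr>"

lemma map_graph_simps [simp]:
  "pverts (map_graph f B) = f ` pverts B" "parcs (map_graph f B) = map_prod f f ` parcs B"
  by (simp_all add: map_graph_def)

lemma map_graph_comp: "map_graph f (map_graph g B) = map_graph (f \<circ> g) B"
  by (auto simp: map_graph_def image_image map_prod_def split_def comp_def)

lemma map_graph_ident:
  assumes "parcs B \<subseteq> pverts B \<times> pverts B" "\<And>x. x \<in> pverts B \<Longrightarrow> f x = x"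
  shows "map_graph f B = B"
proof -
  have "map_prod f f e = e" if "e \<in> parcs B" for e
    using assms that by (cases e) auto
  then have "map_prod f f ` parcs B = parcs B" by force
  moreover have "f ` pverts B = pverts B" using assms by force
  ultimately show ?thesis by (simp add: map_graph_def)
qed

lemma pair_graph_map_graph:
  assumes "pair_graph B" "inj_on f (pverts B)"
  shows "pair_graph (map_graph f B)"
proof -
  have B: "finite (pverts B)" "parcs B \<subseteq> pverts B \<times> pverts B" "sym (parcs B)" "irrefl (parcs B)"
    using assms(1) by (auto simp: pair_graph_iff)
  have "sym (parcs (map_graph f B))"
  proof (rule symI)
    fix a b assume "(a, b) \<in> parcs (map_graph f B)"
    then obtain x y where "(x, y) \<in> parcs B" "a = f x" "b = f y" by auto
    then show "(b, a) \<in> parcs (map_graph f B)"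
      using B(3) by (auto dest: symD intro: rev_image_eqI[of "(y, x)"])
  qed
  moreover have "irrefl (parcs (map_graph f B))"
  proof (rule irreflI, rule notI)
    fix a assume "(a, a) \<in> parcs (map_graph f B)"
    then obtain x y where xy: "(x, y) \<in> parcs B" "f x = f y" by auto
    then have "x = y" using B(2) assms(2) by (auto dest: inj_onD)
    then show False using B(4) xy by (auto simp: irrefl_def)
  qed
  moreover have "parcs (map_graph f B) \<subseteq> pverts (map_graph f B) \<times> pverts (map_graph f B)"
    using B(2) by auto
  ultimately show ?thesis using B(1) by (simp add: pair_graph_iff)
qed

lemma nonsep_map_graph:
  assumes B: "nonsep B" and f: "inj_on f (pverts B)"
  shows "nonsep (map_graph f B)"
  unfolding nonsep_def
proof (intro conjI ballI)
  show "pair_graph (map_graph f B)" using B f pair_graph_map_graph by (auto simp: nonsep_def)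
  show "2 \<le> card (pverts (map_graph f B))" using B f by (simp add: nonsep_def card_image)
  show "linked (parcs (map_graph f B)) (pverts (map_graph f B))"
    using B by (simp add: nonsep_def linked_image)
  fix v assume "v \<in> pverts (map_graph f B)"
  then obtain x where x: "x \<in> pverts B" "v = f x" by auto
  have "f ` pverts B - {v} = f ` (pverts B - {x})"
    using x f by (simp add: inj_on_image_set_diff[of f "pverts B"])
  then show "linked (parcs (map_graph f B)) (pverts (map_graph f B) - {v})"
    using B x by (simp add: nonsep_def linked_image)
qed

lemma digraph_iso_map_graph:
  assumes "pair_graph B" "inj_on f (pverts B)"
  shows "digraph_iso (with_proj B) (with_proj (map_graph f B))"
proof -
  let ?h = "\<lparr>iso_verts = f, iso_arcs = map_prod f f, iso_head = snd, iso_tail = fst\<rparr>"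
  have "inj_on (map_prod f f) (pverts B \<times> pverts B)"
    using assms by (intro map_prod_inj_on)
  then have "inj_on (map_prod f f) (parcs B)"
    using assms by (auto simp: pair_graph_iff elim: inj_on_subset)
  moreover have "wf_digraph (with_proj B)"
    using assms by (auto simp: wf_digraph_wp_iff pair_graph_iff pair_wf_digraph_def)
  ultimately have "pre_digraph.digraph_isomorphism (with_proj B) ?h"
    using assms by (auto simp: pre_digraph.digraph_isomorphism_def)
  moreover have "with_proj (map_graph f B) = app_iso ?h (with_proj B)"
    by (simp add: with_proj_def app_iso_def map_graph_def)
  ultimately show ?thesis unfolding digraph_iso_def by blast
qed

text \<open>
  A rooted block is stored with its root renamed to \<open>0\<close>, which is not a vertex; placing it at
  \<open>v\<close> turns the root into \<open>v\<close>.
\<close>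

definition ren :: "nat \<Rightarrow> nat \<Rightarrow> nat" where
  "ren v x = (if x = 0 then v else x)"

abbreviation place :: "nat pair_pre_digraph \<Rightarrow> nat \<Rightarrow> nat pair_pre_digraph" where
  "place d v \<equiv> map_graph (ren v) d"

text \<open>The label \<open>0\<close> lies in every stored block and must not be owned. For other
  labels the description is well defined because blocks of a family share only
  \<open>0\<close>.\<close>

definition owner :: "nat pair_pre_digraph set \<Rightarrow> nat \<Rightarrow> nat pair_pre_digraph option" where
  "owner D v = (if v \<noteq> 0 \<and> (\<exists>d \<in> D. v \<in> pverts d) then Some (THE d. d \<in> D \<and> v \<in> pverts d) else None)"

definition block_family :: "nat set \<Rightarrow> nat \<Rightarrow> nat pair_pre_digraph set \<Rightarrow> bool" where
  "block_family V r D \<longleftrightarrow> finite V \<and> r \<in> V \<and> 0 \<notin> V \<and> (\<forall>d \<in> D. nonsep d \<and> 0 \<in> pverts d) \<and>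
     (\<forall>d \<in> D. \<forall>e \<in> D. \<forall>x. x \<noteq> 0 \<longrightarrow> x \<in> pverts d \<longrightarrow> x \<in> pverts e \<longrightarrow> d = e) \<and>
     (\<Union>d \<in> D. pverts d) - {0} = V - {r}"

definition build :: "nat set \<Rightarrow> nat pair_pre_digraph set \<Rightarrow> (nat pair_pre_digraph \<Rightarrow> nat) \<Rightarrow> nat pair_pre_digraph" where
  "build V D p = \<lparr>pverts = V, parcs = (\<Union>d \<in> D. parcs (place d (p d)))\<rparr>"

lemma inj_on_ren: "v \<notin> pverts d \<Longrightarrow> inj_on (ren v) (pverts d)"
  by (auto simp: inj_on_def ren_def split: if_splits)

lemma pverts_place: "0 \<in> pverts d \<Longrightarrow> pverts (place d v) = insert v (pverts d - {0})"
  by (force simp: ren_def)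

lemma place_inverse:
  assumes "pair_graph d" "v \<notin> pverts d"
  shows "map_graph (\<lambda>x. if x = v then 0 else x) (place d v) = d"
  unfolding map_graph_comp
  using assms by (intro map_graph_ident) (auto simp: pair_graph_iff ren_def)

lemma owner_SomeI:
  assumes "block_family V r D" "d \<in> D" "x \<in> pverts d" "x \<noteq> 0"
  shows "owner D x = Some d"
proof -
  have "(THE d. d \<in> D \<and> x \<in> pverts d) = d"
    using assms by (intro the_equality) (auto simp: block_family_def)
  then show ?thesis using assms by (auto simp: owner_def)
qed

lemma owner_SomeD:
  assumes "block_family V r D" "owner D x = Some d"
  shows "d \<in> D" "x \<in> pverts d" "x \<noteq> 0"
proof -
  obtain e where e: "e \<in> D" "x \<in> pverts e" "x \<noteq> 0"
    using assms by (auto simp: owner_def split: if_splits)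
  then have "e = d" using owner_SomeI[OF assms(1)] assms(2) by force
  then show "d \<in> D" "x \<in> pverts d" "x \<noteq> 0" using e by auto
qed

lemma owner_None_iff:
  assumes "block_family V r D" "x \<in> V"
  shows "owner D x = None \<longleftrightarrow> x = r"
proof -
  have U: "(\<Union>d \<in> D. pverts d) - {0} = V - {r}" and z: "0 \<notin> V"
    using assms(1) by (simp_all add: block_family_def)
  have x0: "x \<noteq> 0" using z assms(2) by metis
  moreover have "(\<exists>d \<in> D. x \<in> pverts d) \<longleftrightarrow> x \<in> (\<Union>d \<in> D. pverts d) - {0}" using x0 by simp
  then have "(\<exists>d \<in> D. x \<in> pverts d) \<longleftrightarrow> x \<noteq> r" unfolding U using assms(2) by simp
  ultimately show ?thesis by (simp add: owner_def)
qed

lemma block_family_piece: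
  assumes "block_family V r D" "d \<in> D"
  shows "pverts d - {0} \<subseteq> V - {r}" "pverts d - {0} \<noteq> {}" "nonsep d" "0 \<in> pverts d"
proof -
  show "nonsep d" "0 \<in> pverts d" using assms by (auto simp: block_family_def)
  have "(\<Union>d \<in> D. pverts d) - {0} = V - {r}" using assms by (simp add: block_family_def)
  then show "pverts d - {0} \<subseteq> V - {r}" using assms(2) by blast
  have "2 \<le> card (pverts d)" using \<open>nonsep d\<close> by (simp add: nonsep_def)
  then have "\<not> pverts d \<subseteq> {0}" using card_mono[of "{0}" "pverts d"] by auto
  then show "pverts d - {0} \<noteq> {}" by blast
qed

lemma pieces_block_family:
  assumes F: "block_family V r D"
  shows "pieces V D (owner D)"
proof -
  have ex: "\<exists>v\<in>V. owner D v = Some d" if "d \<in> D" for d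
    using block_family_piece(1,2)[OF F that] owner_SomeI[OF F that] by blast
  have fin: "finite V" using F by (simp add: block_family_def)
  have "D \<subseteq> (\<lambda>v. the (owner D v)) ` V"
    using ex by force
  then have "finite D" using fin by (meson finite_imageI finite_subset)
  moreover have "owner D ` V \<subseteq> insert None (Some ` D)"
  proof
    fix a assume "a \<in> owner D ` V"
    then obtain v where "a = owner D v" by blast
    then show "a \<in> insert None (Some ` D)" using owner_SomeD(1)[OF F, of v] by (cases a) auto
  qed
  ultimately show ?thesis using fin ex by (simp add: pieces_def)
qed

declare map_graph_simps [simp del]

section \<open>The blocks of a graph built from a family\<close>

locale block_tree =
  fixes V r D p
  assumes F: "block_family V r D" and att: "p \<in> attachments V D (owner D)"
begin

abbreviation G where "G \<equiv> build V D p"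
abbreviation P where "P d \<equiv> pverts d - {0}"
abbreviation below where "below d \<equiv> sub V (owner D) p d"
abbreviation dp where "dp v \<equiv> depth (owner D) p v"

lemma fin: "finite V" and r: "r \<in> V" and zero: "0 \<notin> V"
  using F by (auto simp: block_family_def)

lemma pieces: "pieces V D (owner D)" by (rule pieces_block_family[OF F])

lemma p_in: "d \<in> D \<Longrightarrow> p d \<in> V" using att by (rule attachment_in)

lemma grounded: "v \<in> V \<Longrightarrow> grounded (owner D) p v" using att by (rule attachment_grounded)

lemma P_V: "d \<in> D \<Longrightarrow> P d \<subseteq> V" using block_family_piece(1)[OF F] by blast

lemma owner_P: "d \<in> D \<Longrightarrow> x \<in> P d \<Longrightarrow> owner D x = Some d"
  using owner_SomeI[OF F] by auto

lemma ownerD: "owner D x = Some d \<Longrightarrow> d \<in> D \<and> x \<in> P d"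
  using owner_SomeD[OF F] by auto

lemma P_below: "d \<in> D \<Longrightarrow> x \<in> P d \<Longrightarrow> x \<in> below d"
  using P_V owner_P by (intro sub_own) auto

lemma p_notin_below: "d \<in> D \<Longrightarrow> p d \<notin> below d"
  by (rule attachment_root_notin_sub[OF pieces att])

lemma p_notin: "d \<in> D \<Longrightarrow> p d \<notin> pverts d"
  using p_notin_below[of d] P_below[of d "p d"] p_in[of d] zero by (cases "p d = 0") auto

lemma r_notin_below: "r \<notin> below d"
  using owner_None_iff[OF F r] by (intro sub_None) simp

lemma depth_P: "d \<in> D \<Longrightarrow> x \<in> P d \<Longrightarrow> dp x = Suc (dp (p d))"
  using depth_Some[of "owner D" p x d] grounded P_V owner_P by blast

lemma verts_place: "d \<in> D \<Longrightarrow> pverts (place d (p d)) = insert (p d) (P d)"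
  using block_family_piece(4)[OF F] by (rule pverts_place)

lemma nonsep_place: "d \<in> D \<Longrightarrow> nonsep (place d (p d))"
  using block_family_piece(3)[OF F] p_notin inj_on_ren by (intro nonsep_map_graph) auto

lemma arcs_place: "d \<in> D \<Longrightarrow> (x, y) \<in> parcs (place d (p d)) \<Longrightarrow>
    x \<in> insert (p d) (P d) \<and> y \<in> insert (p d) (P d) \<and> x \<noteq> y"
  using nonsep_place[of d] verts_place[of d] unfolding nonsep_def pair_graph_iff irrefl_def by blast

lemma verts_place_V: "d \<in> D \<Longrightarrow> insert (p d) (P d) \<subseteq> V"
  using P_V p_in by auto

lemma G_simps [simp]: "pverts G = V" "parcs G = (\<Union>d \<in> D. parcs (place d (p d)))"
  by (simp_all add: build_def)

lemma pair_graph_G: "pair_graph G"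
proof -
  have "sym (parcs (place d (p d)))" if "d \<in> D" for d
    using nonsep_place[OF that] by (simp only: nonsep_def pair_graph_iff)
  then have "sym (parcs G)" unfolding G_simps sym_def by blast
  moreover have "x \<in> V \<and> y \<in> V \<and> x \<noteq> y" if xy: "(x, y) \<in> parcs G" for x y
  proof -
    obtain d where d: "d \<in> D" "(x, y) \<in> parcs (place d (p d))" using xy by auto
    show ?thesis using arcs_place[OF d] verts_place_V[OF d(1)] by blast
  qed
  then have "parcs G \<subseteq> V \<times> V" "irrefl (parcs G)" by (auto simp: irrefl_def simp del: G_simps)
  ultimately show ?thesis using fin by (simp only: pair_graph_iff G_simps(1))
qed

lemma sym_G: "sym (parcs G)" using pair_graph_G by (simp only: pair_graph_iff)

lemma below_same:
  assumes "d \<in> D" "e \<in> D" "e \<noteq> d" "x \<in> insert (p e) (P e)"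
  shows "x \<in> below d \<longleftrightarrow> p e \<in> below d"
proof (cases "x \<in> P e")
  case True
  show ?thesis
    using True assms P_V[of e] p_in[of e] owner_P[of e x]
    by (intro sub_step) auto
qed (use assms in auto)

text \<open>Every other block lies, with its attachment point, entirely on one side of the set below
  \<open>d\<close>. Only \<open>d\<close> straddles it, and its sole vertex outside is
  \<open>p d\<close>.\<close>

lemma below_exit:
  assumes d: "d \<in> D" and xy: "x \<in> below d" "y \<notin> below d" "(x, y) \<in> parcs G"
  shows "y = p d"
proof -
  obtain e where e: "e \<in> D" "(x, y) \<in> parcs (place e (p e))" using xy by auto
  have "x \<in> insert (p e) (P e)" "y \<in> insert (p e) (P e)" using arcs_place[OF e] by auto
  show ?thesis
  proof (cases "e = d")
    case True
    then show ?thesis using \<open>y \<in> insert (p e) (P e)\<close> P_below[OF d, of y] xy(2) by blast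
  next
    case False
    then show ?thesis
      using below_same[OF d e(1) False, of x] below_same[OF d e(1) False, of y] xy
        \<open>x \<in> insert (p e) (P e)\<close> \<open>y \<in> insert (p e) (P e)\<close> by blast
  qed
qed

text \<open>The pieces are disjoint, so two common vertices would have to be \<open>p e\<close> in
  the piece \<open>d\<close> and \<open>p d\<close> in the piece \<open>e\<close>; then each block
  would be deeper than the other.\<close>

lemma two_common:
  assumes de: "d \<in> D" "e \<in> D" and x: "x \<in> insert (p d) (P d)" "x \<in> insert (p e) (P e)"
    and y: "y \<in> insert (p d) (P d)" "y \<in> insert (p e) (P e)" and "x \<noteq> y"
  shows "d = e"
proof (rule ccontr)
  assume ne: "d \<noteq> e"
  have disj: "z \<notin> P d \<or> z \<notin> P e" for z
    using F de ne by (auto simp: block_family_def)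
  then have "p e \<in> P d \<and> p d \<in> P e"
    using x y \<open>x \<noteq> y\<close> by auto
  then show False using depth_P[OF de(1), of "p e"] depth_P[OF de(2), of "p d"] by simp
qed

lemma place_induced:
  assumes "d \<in> D" "x \<in> insert (p d) (P d)" "y \<in> insert (p d) (P d)" "(x, y) \<in> parcs G"
  shows "(x, y) \<in> parcs (place d (p d))"
proof -
  obtain e where e: "e \<in> D" "(x, y) \<in> parcs (place e (p e))" using assms by auto
  then have "e = d" using two_common[of e d x y] arcs_place[OF e] assms by blast
  then show ?thesis using e by simp
qed

lemma linked_G: "linked (parcs G) V"
proof (rule linked_if_center[OF sym_G])
  fix v assume v: "v \<in> V"
  show "(v, r) \<in> rtrancl_on V (parcs G)"
    using grounded[OF v] v
  proof (induction rule: grounded_induct)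
    case (None v)
    then show ?case using owner_None_iff[OF F] by auto
  next
    case (Some v d)
    then have d: "d \<in> D" "v \<in> P d" using ownerD by auto
    have "linked (parcs (place d (p d))) (insert (p d) (P d))"
      using nonsep_place[OF d(1)] verts_place[OF d(1)] by (simp only: nonsep_def)
    then have "(v, p d) \<in> rtrancl_on (insert (p d) (P d)) (parcs (place d (p d)))"
      using d by (intro linkedD) auto
    then have "(v, p d) \<in> rtrancl_on V (parcs G)"
      using d verts_place_V by (elim rtrancl_on_mono[rotated 2]) (unfold G_simps, blast+)
    then show ?case using Some p_in[OF d(1)] by (blast intro: rtrancl_on_trans)
  qed
qed

text \<open>Take a vertex \<open>x\<close> of \<open>H\<close> of maximal depth, in the piece
  \<open>d\<close>. Without \<open>p d\<close> the graph \<open>H\<close> is still linked, and the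
  set below \<open>d\<close> can only be left through \<open>p d\<close>, so all other vertices of
  \<open>H\<close> lie below \<open>d\<close>. Being no deeper than \<open>x\<close>, they belong to
  the piece itself.\<close>

lemma nonsep_in_piece:
  assumes H: "nonsep H" "pverts H \<subseteq> V" "parcs H \<subseteq> parcs G"
  shows "\<exists>d \<in> D. pverts H \<subseteq> insert (p d) (P d)"
proof -
  have finH: "finite (pverts H)" and "2 \<le> card (pverts H)"
    using H by (auto simp: nonsep_def pair_graph_iff)
  then have "pverts H \<noteq> {}" by auto
  then have "Max (dp ` pverts H) \<in> dp ` pverts H" using finH by (intro Max_in) auto
  then obtain x where x: "x \<in> pverts H" "dp x = Max (dp ` pverts H)" by auto
  have xmax: "dp y \<le> dp x" if "y \<in> pverts H" for y using that finH x(2) by simp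
  have "owner D x \<noteq> None"
  proof
    assume N: "owner D x = None"
    have "pverts H \<subseteq> {r}"
    proof
      fix y assume y: "y \<in> pverts H"
      then have "dp y = 0" using xmax[OF y] N by simp
      then have "owner D y = None" using depth_eq_0_iff[OF grounded] y H by blast
      then show "y \<in> {r}" using owner_None_iff[OF F] y H by blast
    qed
    then have "card (pverts H) \<le> 1" using card_mono[of "{r}" "pverts H"] by simp
    then show False using \<open>2 \<le> card (pverts H)\<close> by simp
  qed
  then obtain d where "owner D x = Some d" by blast
  then have d: "d \<in> D" "x \<in> P d" using ownerD by auto
  have xp: "x \<noteq> p d" using d p_notin by auto
  have "linked (parcs H) (pverts H - {p d})"
    using H by (cases "p d \<in> pverts H") (auto simp: nonsep_def)
  have "y \<in> P d" if y: "y \<in> pverts H - {p d}" for y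
  proof -
    have "(x, y) \<in> rtrancl_on (pverts H - {p d}) (parcs H)"
      using \<open>linked (parcs H) (pverts H - {p d})\<close> x xp y by (auto intro: linkedD)
    then have "(x, y) \<in> rtrancl_on (pverts H - {p d}) (parcs G)"
      using H(3) by (elim rtrancl_on_mono[rotated 2]) auto
    then have "y \<in> below d"
      using rtrancl_on_stay[of "below d" "parcs G" "p d" x y] below_exit[OF d(1)] P_below[OF d] by blast
    then obtain j where j: "owner D (up (owner D) p j y) = Some d" by (auto simp: sub_def)
    have gy: "grounded (owner D) p y" using y H grounded by blast
    have "dp (up (owner D) p j y) = dp x"
      using j depth_P[OF d] depth_P[OF d(1)] ownerD[OF j] by simp
    then have "dp x = dp y - j" using depth_up[OF gy] by simp
    moreover have "dp y \<le> dp x" using xmax y by blast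
    moreover have "0 < dp x" using depth_P[OF d] by simp
    ultimately have "j = 0" by linarith
    then show "y \<in> P d" using j ownerD by auto
  qed
  then show ?thesis using d by blast
qed

text \<open>A walk using the deleted edge is rerouted inside the block, which stays linked without
  it.\<close>

lemma not_bridge_in_large:
  assumes d: "d \<in> D" "3 \<le> card (insert (p d) (P d))" and uv: "(u, v) \<in> parcs (place d (p d))"
  shows "\<not> is_bridge G u v"
proof -
  let ?B = "place d (p d)" and ?E = "parcs G - {(u, v), (v, u)}"
  have "u \<in> pverts ?B" "v \<in> pverts ?B" "u \<noteq> v"
    using arcs_place[OF d(1) uv] verts_place[OF d(1)] by auto
  then have B: "linked (parcs ?B - {(u, v), (v, u)}) (pverts ?B)"
    using nonsep_place d verts_place by (intro nonsep_delete_edge) auto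
  have E: "parcs ?B - {(u, v), (v, u)} \<subseteq> ?E" using d unfolding G_simps by blast
  have edge: "(x, y) \<in> rtrancl_on V ?E" if xy: "(x, y) \<in> parcs G" "x \<in> V" "y \<in> V" for x y
  proof (cases "(x, y) \<in> ?E")
    case True
    then show ?thesis using xy by (meson rtrancl_on_into_rtrancl_on rtrancl_on_refl)
  next
    case False
    then have "x \<in> pverts ?B" "y \<in> pverts ?B"
      using xy \<open>u \<in> pverts ?B\<close> \<open>v \<in> pverts ?B\<close> by blast+
    then have xy': "(x, y) \<in> rtrancl_on (pverts ?B) (parcs ?B - {(u, v), (v, u)})"
      by (rule linkedD[OF B])
    show ?thesis
      using rtrancl_on_mono[OF E _ xy', of V] verts_place[OF d(1)] verts_place_V[OF d(1)] by simp
  qed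
  have "(x, y) \<in> rtrancl_on V ?E" if "(x, y) \<in> rtrancl_on V (parcs G)" for x y
    using that
  proof (induction rule: rtrancl_on_induct)
    case (step y z)
    show ?case by (rule rtrancl_on_trans[OF step.IH edge[OF step.hyps(2-4)]])
  qed simp
  then have "linked ?E V" using linked_G unfolding linked_def by blast
  then show ?thesis
    using is_bridge_iff[OF pair_graph_G] linked_G by simp
qed

text \<open>Everything below \<open>d\<close> hangs on the single vertex \<open>x\<close>; without
  the edge to \<open>p d\<close> no arc leaves this set.\<close>

lemma bridge_in_small:
  assumes d: "d \<in> D" "P d = {x}"
  shows "is_bridge G x (p d)" "place d (p d) = \<lparr>pverts = {x, p d}, parcs = {(x, p d), (p d, x)}\<rparr>"
proof -
  have V: "pverts (place d (p d)) = {x, p d}" and ne: "x \<noteq> p d"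
    using verts_place[OF d(1)] d p_notin[OF d(1)] by auto
  show pl: "place d (p d) = \<lparr>pverts = {x, p d}, parcs = {(x, p d), (p d, x)}\<rparr>"
    using nonsep_place[OF d(1)] V ne by (intro nonsep_card_2) auto
  let ?E = "parcs G - {(x, p d), (p d, x)}"
  have xd: "x \<in> below d" using P_below[OF d(1), of x] d(2) by blast
  have exit: "z = p d" if "y \<in> below d" "z \<notin> below d" "(y, z) \<in> parcs G" for y z
    using below_exit[OF d(1)] that by blast
  have stay: "z \<in> below d" if yz: "y \<in> below d" "(y, z) \<in> ?E" for y z
  proof (rule ccontr)
    assume z: "z \<notin> below d"
    then have zp: "z = p d" using exit yz by blast
    obtain e where e: "e \<in> D" "(y, z) \<in> parcs (place e (p e))" using yz by auto
    then have "e = d"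
      using below_same[OF d(1) e(1)] arcs_place[OF e] yz z by blast
    then have "(y, z) \<in> {(x, p d), (p d, x)}" using e(2) pl by simp
    then show False using yz(2) by blast
  qed
  have "y \<in> below d" if "(x, y) \<in> rtrancl_on V ?E" for y
    using that by (induction rule: rtrancl_on_induct) (use xd stay in blast)+
  then have "(x, p d) \<notin> rtrancl_on V ?E" using p_notin_below[OF d(1)] by blast
  moreover have "x \<in> V" "p d \<in> V" using verts_place_V[OF d(1)] d by auto
  ultimately have "\<not> linked ?E V" by (auto simp: linked_def)
  moreover have "(x, p d) \<in> parcs G" using d pl unfolding G_simps by force
  ultimately show "is_bridge G x (p d)"
    using is_bridge_iff[OF pair_graph_G] linked_G by simp
qed

text \<open>Subgraphs without separating vertex lie in one placed block and two placed blocks share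
  at most one vertex, so placed blocks are maximal. Those with three or more vertices are the
  two-connected blocks, the others are the bridges; a connected graph on at least two vertices has
  no isolated vertex.\<close>

theorem is_block_iff:
  assumes n: "2 \<le> card V"
  shows "is_block G B \<longleftrightarrow> (\<exists>d \<in> D. B = place d (p d))"
proof
  assume "is_block G B"
  then consider (two) "pre_digraph.max_subgraph (with_proj G) two_connected (with_proj B)"
    | (bridge) u v where "is_bridge G u v" "B = \<lparr>pverts = {u, v}, parcs = {(u, v), (v, u)}\<rparr>"
    | (isolated) v where "v \<in> V" "\<And>w. (v, w) \<notin> parcs G"
    unfolding is_block_def by (auto simp del: G_simps(2))
  then show "\<exists>d \<in> D. B = place d (p d)"
  proof cases
    case two
    then have B: "nonsep B" "pverts B \<subseteq> V" "parcs B \<subseteq> parcs G"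
      and max: "\<And>H. nonsep H \<Longrightarrow> pverts B \<subseteq> pverts H \<Longrightarrow> parcs B \<subseteq> parcs H \<Longrightarrow> pverts H \<subseteq> V \<Longrightarrow>
         parcs H \<subseteq> parcs G \<Longrightarrow> H = B"
      unfolding max_subgraph_two_connected_iff[OF pair_graph_G] G_simps(1) by blast+
    obtain d where d: "d \<in> D" "pverts B \<subseteq> insert (p d) (P d)"
      using nonsep_in_piece[OF B] by blast
    have "parcs B \<subseteq> parcs (place d (p d))"
    proof clarify
      fix x y assume xy: "(x, y) \<in> parcs B"
      then have "x \<in> pverts B" "y \<in> pverts B" using B by (auto simp: nonsep_def pair_graph_iff)
      then show "(x, y) \<in> parcs (place d (p d))"
        using place_induced[OF d(1), of x y] xy d(2) B(3) by blast
    qed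
    then have "place d (p d) = B"
      using d nonsep_place verts_place verts_place_V unfolding G_simps by (intro max) auto
    then show ?thesis using d by blast
  next
    case (bridge u v)
    then have "(u, v) \<in> parcs G" by (simp add: is_bridge_def)
    then obtain d where d: "d \<in> D" "(u, v) \<in> parcs (place d (p d))" by auto
    have "\<not> 3 \<le> card (insert (p d) (P d))"
      using not_bridge_in_large[OF d(1) _ d(2)] bridge(1) by blast
    then have "card (insert (p d) (P d)) < 3" by linarith
    then have "place d (p d) = B"
      using nonsep_card_2[OF nonsep_place[OF d(1)], of u v] arcs_place[OF d] verts_place[OF d(1)] bridge by simp
    then show ?thesis using d by blast
  next
    case isolated
    have "V \<noteq> {v}" using n by auto
    then obtain w where w: "w \<in> V" "w \<noteq> v" using isolated by blast
    have "(v, w) \<in> rtrancl_on V (parcs G)" using linkedD[OF linked_G] isolated w by blast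
    then show ?thesis using isolated w by (auto elim: converse_rtrancl_on_cases)
  qed
next
  assume "\<exists>d \<in> D. B = place d (p d)"
  then obtain d where d: "d \<in> D" and B: "B = place d (p d)" by blast
  have V: "pverts B = insert (p d) (P d)" using verts_place[OF d] B by simp
  have nB: "nonsep B" using nonsep_place[OF d] B by simp
  show "is_block G B"
  proof (cases "3 \<le> card (pverts B)")
    case True
    have "H = B" if H: "nonsep H" "pverts B \<subseteq> pverts H" "parcs B \<subseteq> parcs H" "pverts H \<subseteq> V" "parcs H \<subseteq> parcs G" for H
    proof -
      obtain e where e: "e \<in> D" "pverts H \<subseteq> insert (p e) (P e)"
        using nonsep_in_piece[OF H(1,4,5)] by blast
      obtain x where x: "x \<in> P d" using block_family_piece(2)[OF F d] by blast
      then have "x \<noteq> p d" using p_notin[OF d] by auto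
      then have "d = e" using two_common[OF d e(1), of x "p d"] x e(2) H(2) V by blast
      then have pv: "pverts H = pverts B" using e V H(2) by blast
      have "parcs H \<subseteq> parcs B"
      proof clarify
        fix y z assume yz: "(y, z) \<in> parcs H"
        then have "y \<in> pverts H" "z \<in> pverts H" using H by (auto simp: nonsep_def pair_graph_iff)
        then show "(y, z) \<in> parcs B"
          using place_induced[OF d, of y z] yz pv V H(5) B by blast
      qed
      then show "H = B" using pv H(3) by auto
    qed
    moreover have "pverts B \<subseteq> V" "parcs B \<subseteq> parcs G"
      using V verts_place_V[OF d] B d unfolding G_simps by auto
    ultimately show ?thesis
      using nB True unfolding is_block_def max_subgraph_two_connected_iff[OF pair_graph_G] by auto
  next
    case False
    have "finite (P d)" using P_V[OF d] fin by (rule finite_subset)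
    then have "card (P d) < 2" using False V p_notin[OF d] by simp
    moreover have "P d \<noteq> {}" by (rule block_family_piece(2)[OF F d])
    ultimately have "card (P d) = 1" using \<open>finite (P d)\<close> by (metis One_nat_def card_0_eq less_2_cases)
    then obtain x where x: "P d = {x}" by (auto simp: card_1_singleton_iff)
    show ?thesis using bridge_in_small[OF d x] B unfolding is_block_def by blast
  qed
qed

end

section \<open>Uniqueness and block-diameter\<close>

lemma (in block_tree) root_reachable_outside:
  assumes "d \<in> D"
  shows "(p d, r) \<in> rtrancl_on (V - below d) (parcs G)"
proof (rule rtrancl_on_collapse[where c = "p d"])
  show "y = p d" if "x \<in> below d" "y \<notin> below d" "(x, y) \<in> parcs G" for x y
    using below_exit[OF assms that] .
  show "(p d, r) \<in> rtrancl_on V (parcs G)"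
    using linkedD[OF linked_G p_in[OF assms] r] .
qed (use sym_G p_notin_below r_notin_below p_in assms in blast)+

text \<open>Blocks are read off the graph, so only the root of a common block could differ. If it
  did, \<open>p d\<close> would lie below \<open>d'\<close> in the second tree and
  \<open>p' d'\<close> below \<open>d\<close> in the first. But \<open>p d\<close> reaches
  \<open>r\<close> without meeting the set below \<open>d\<close>, hence without
  \<open>p' d'\<close>, the only exit from the set below \<open>d'\<close>, and \<open>r\<close> is
  outside that set.\<close>

lemma build_subset:
  assumes A: "block_tree V r D p" and B: "block_tree V r D' p'"
    and eq: "build V D p = build V D' p'" and n: "2 \<le> card V" and d: "d \<in> D"
  shows "d \<in> D' \<and> p' d = p d"
proof -
  interpret A: block_tree V r D p by fact
  interpret B: block_tree V r D' p' by fact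
  have "is_block B.G (place d (p d))" using A.is_block_iff[OF n] d eq by auto
  then obtain d' where d': "d' \<in> D'" "place d (p d) = place d' (p' d')"
    using B.is_block_iff[OF n] by auto
  have V: "insert (p d) (pverts d - {0}) = insert (p' d') (pverts d' - {0})"
    using A.verts_place[OF d] B.verts_place[OF d'(1)] d'(2) by simp
  have root: "p d = p' d'"
  proof (rule ccontr)
    assume ne: "p d \<noteq> p' d'"
    have "p d \<in> insert (p' d') (B.P d')" "p' d' \<in> insert (p d) (A.P d)" using V by (metis insertI1)+
    then have "p d \<in> B.P d'" "p' d' \<in> A.P d" using ne by simp_all
    then have 1: "p d \<in> B.below d'" and 2: "p' d' \<in> A.below d"
      using A.P_below[OF d] B.P_below[OF d'(1)] by blast+
    have "(p d, r) \<in> rtrancl_on (V - A.below d) (parcs B.G)"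
      using A.root_reachable_outside[OF d] eq by simp
    then have "r \<in> B.below d'"
      by (rule rtrancl_on_stay[rotated]) (use 1 2 B.below_exit[OF d'(1)] in blast)+
    then show False using B.r_notin_below by blast
  qed
  have "pair_graph d" "pair_graph d'"
    using block_family_piece(3)[OF A.F d] block_family_piece(3)[OF B.F d'(1)] by (auto simp: nonsep_def)
  then have "d = d'"
    using place_inverse[of d "p d"] place_inverse[of d' "p d"] A.p_notin[OF d] B.p_notin[OF d'(1)] d'(2) root
    by metis
  then show ?thesis using d' root by simp
qed

lemma build_unique:
  assumes A: "block_tree V r D p" and B: "block_tree V r D' p'"
    and eq: "build V D p = build V D' p'" and n: "2 \<le> card V"
  shows "D = D'" "p = p'"
proof -
  show D: "D = D'"
    using build_subset[OF A B eq n] build_subset[OF B A eq[symmetric] n] by blast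
  have "p \<in> D \<rightarrow>\<^sub>E V" "p' \<in> D \<rightarrow>\<^sub>E V"
    using A B D by (auto simp: block_tree_def attachments_def)
  then show "p = p'"
    by (rule PiE_ext) (use build_subset[OF A B eq n] in simp)
qed

section \<open>Paths and the block-diameter\<close>

lemma vwalk_exit:
  assumes exit: "\<And>x y. x \<in> S \<Longrightarrow> y \<notin> S \<Longrightarrow> (x, y) \<in> E \<Longrightarrow> y = c"
  shows "set (vwalk_arcs (x # xs)) \<subseteq> E \<Longrightarrow> x \<in> S \<Longrightarrow> last (x # xs) \<notin> S \<Longrightarrow> c \<in> set xs"
proof (induction xs arbitrary: x)
  case (Cons y ys)
  show ?case
  proof (cases "y \<in> S")
    case True
    then show ?thesis using Cons.IH[of y] Cons.prems by simp
  next
    case False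
    then have "y = c" using Cons.prems by (intro exit[of x y]) auto
    then show ?thesis by simp
  qed
qed simp

lemma vwalk_enter:
  assumes exit: "\<And>x y. x \<in> S \<Longrightarrow> y \<notin> S \<Longrightarrow> (x, y) \<in> E \<Longrightarrow> y = c" and "sym E"
  shows "set (vwalk_arcs (x # xs)) \<subseteq> E \<Longrightarrow> x \<notin> S \<Longrightarrow> last (x # xs) \<in> S \<Longrightarrow> c \<in> set (butlast (x # xs))"
proof (induction xs arbitrary: x)
  case (Cons y ys)
  show ?case
  proof (cases "y \<in> S")
    case False
    then show ?thesis using Cons.IH[of y] Cons.prems by simp
  next
    case True
    have "(y, x) \<in> E" using Cons.prems \<open>sym E\<close> by (auto dest: symD)
    then have "x = c" using True Cons.prems by (intro exit[of y x]) auto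
    then show ?thesis by simp
  qed
qed simp

text \<open>A walk that enters \<open>S\<close> and leaves it again passes \<open>c\<close> both
  before and after \<open>x\<close>, which a path cannot do.\<close>

lemma vpath_meets_end:
  assumes exit: "\<And>x y. x \<in> S \<Longrightarrow> y \<notin> S \<Longrightarrow> (x, y) \<in> E \<Longrightarrow> y = c" and sym: "sym E"
    and q: "set (vwalk_arcs q) \<subseteq> E" "distinct q" "x \<in> set q" "x \<in> S"
  shows "hd q \<in> S \<or> last q \<in> S"
proof (rule ccontr)
  assume "\<not> ?thesis"
  then have out: "hd q \<notin> S" "last q \<notin> S" by auto
  obtain as bs where split: "q = as @ x # bs" using q(3) by (meson split_list)
  have "set (vwalk_arcs (x # bs)) \<subseteq> E"
    using q(1) set_vwalk_arcs_append2[of "x # bs" as] split by auto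
  then have 1: "c \<in> set bs"
    using vwalk_exit[of S E c x bs, OF exit] q(4) out(2) split by auto
  obtain y ys where y: "as @ [x] = y # ys" by (cases "as @ [x]") auto
  have "set (vwalk_arcs (as @ [x])) \<subseteq> E"
    using q(1) set_vwalk_arcs_append1[of "as @ [x]" bs] split by auto
  moreover have "y \<notin> S" using out(1) y split by (cases as) auto
  moreover have "last (y # ys) \<in> S" using q(4) unfolding y[symmetric] by simp
  ultimately have "c \<in> set (butlast (as @ [x]))"
    using vwalk_enter[of S E c y ys, OF exit sym] y by auto
  then have "c \<in> set as" by simp
  with 1 show False using q(2) split by auto
qed

context block_tree
begin

lemma card_above:
  assumes v: "v \<in> V"
  shows "card {d \<in> D. v \<in> below d} \<le> dp v"
proof -
  have "{d \<in> D. v \<in> below d} \<subseteq> (\<lambda>j. the (owner D (up (owner D) p j v))) ` {..<dp v}"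
  proof clarify
    fix d assume "d \<in> D" "v \<in> below d"
    then obtain j where j: "owner D (up (owner D) p j v) = Some d" by (auto simp: sub_def)
    then have "j < dp v" using up_eq_None_iff[OF grounded[OF v], of j] by (simp add: not_le[symmetric])
    then show "d \<in> (\<lambda>j. the (owner D (up (owner D) p j v))) ` {..<dp v}"
      using j by (intro image_eqI[of _ _ j]) auto
  qed
  then have "card {d \<in> D. v \<in> below d} \<le> card ((\<lambda>j. the (owner D (up (owner D) p j v))) ` {..<dp v})"
    by (intro card_mono) auto
  also have "\<dots> \<le> card {..<dp v}" by (rule card_image_le) simp
  finally show ?thesis by simp
qed

lemma card_blocks_on_path:
  assumes n: "2 \<le> card V" and q: "vpath q (with_proj G)"
  shows "card {B. is_block G B \<and> passes_through q B} \<le> dp (hd q) + dp (last q)"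
proof -
  have q': "set q \<subseteq> V" "set (vwalk_arcs q) \<subseteq> parcs G" "q \<noteq> []" "distinct q"
    using q by (auto simp: vpath_def vwalk_def simp del: G_simps(2))
  have finD: "finite D" using pieces by (simp add: pieces_def)
  let ?X = "\<lambda>v. {d \<in> D. v \<in> below d}"
  have "{B. is_block G B \<and> passes_through q B} \<subseteq> (\<lambda>d. place d (p d)) ` (?X (hd q) \<union> ?X (last q))"
  proof clarify
    fix B assume "is_block G B" and pass: "passes_through q B"
    then obtain d where d: "d \<in> D" "B = place d (p d)" using is_block_iff[OF n] by blast
    \<comment> \<open>Rules out the clause of \<open>passes_through\<close> about single-vertex
      paths, so that \<open>q\<close> uses an arc of the block.\<close>
    have "2 \<le> card (pverts B)" using nonsep_place[OF d(1)] d(2) by (simp add: nonsep_def)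
    then have "pverts B \<noteq> {v}" for v by auto
    then obtain x y where xy: "(x, y) \<in> set (vwalk_arcs q)" "(x, y) \<in> parcs (place d (p d))"
      using pass d(2) unfolding passes_through_def by auto
    have "x \<in> set q" "y \<in> set q" using xy(1) by (induction q rule: vwalk_arcs.induct) auto
    moreover have "x \<in> P d \<or> y \<in> P d" using arcs_place[OF d(1) xy(2)] by auto
    ultimately obtain z where z: "z \<in> set q" "z \<in> below d" using P_below[OF d(1)] by blast
    have "hd q \<in> below d \<or> last q \<in> below d"
      using vpath_meets_end[OF _ sym_G q'(2,4) z, of "p d"] below_exit[OF d(1)] by blast
    then show "B \<in> (\<lambda>d. place d (p d)) ` (?X (hd q) \<union> ?X (last q))" using d by blast
  qed
  then have "card {B. is_block G B \<and> passes_through q B} \<le> card ((\<lambda>d. place d (p d)) ` (?X (hd q) \<union> ?X (last q)))"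
    using finD by (intro card_mono) auto
  also have "\<dots> \<le> card (?X (hd q) \<union> ?X (last q))" using finD by (intro card_image_le) auto
  also have "\<dots> \<le> card (?X (hd q)) + card (?X (last q))" by (rule card_Un_le)
  also have "\<dots> \<le> dp (hd q) + dp (last q)"
    using q' by (intro add_mono card_above) auto
  finally show ?thesis .
qed

lemma block_diam_le:
  assumes n: "2 \<le> card V"
  shows "\<exists>v \<in> V. block_diam G \<le> 2 * dp v"
proof -
  have "dp ` V \<noteq> {}" "finite (dp ` V)" using r fin by auto
  then have "Max (dp ` V) \<in> dp ` V" by (intro Max_in)
  then obtain v where v: "v \<in> V" "dp v = Max (dp ` V)" by auto
  have max: "dp w \<le> dp v" if "w \<in> V" for w using that fin v(2) by simp
  let ?M = "{card {B. is_block G B \<and> passes_through q B} | q. vpath q (with_proj G)}"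
  have le: "m \<le> 2 * dp v" if mM: "m \<in> ?M" for m
  proof -
    obtain q where q: "vpath q (with_proj G)" "m = card {B. is_block G B \<and> passes_through q B}"
      using mM by blast
    have "set q \<subseteq> V" "q \<noteq> []" using q by (auto simp: vpath_def vwalk_def)
    then have "hd q \<in> V" "last q \<in> V" by auto
    then have "dp (hd q) \<le> dp v" "dp (last q) \<le> dp v" using max by blast+
    then show ?thesis using card_blocks_on_path[OF n q(1)] q(2) by linarith
  qed
  have "finite ?M" by (rule finite_subset[of _ "{..2 * dp v}"]) (use le in auto)
  moreover have "vpath [r] (with_proj G)" using r by (auto simp: vpath_def vwalk_def)
  then have "?M \<noteq> {}" by blast
  ultimately have "block_diam G \<le> 2 * dp v"
    unfolding block_diam_def using le by (intro Max.boundedI) auto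
  then show ?thesis using v by blast
qed

end

section \<open>Existence of the decomposition\<close>

text \<open>
  A nonempty set of vertices avoiding the root that is left only through one vertex \<open>c\<close> and is
  minimal with these properties spans, together with \<open>c\<close>, a block.
\<close>

definition exit_set :: "nat set \<Rightarrow> nat rel \<Rightarrow> nat \<Rightarrow> nat set \<Rightarrow> nat \<Rightarrow> bool" where
  "exit_set V E r S c \<longleftrightarrow> S \<noteq> {} \<and> S \<subseteq> V - {r} \<and> c \<in> V - S \<and>
     (\<forall>x \<in> S. \<forall>y. y \<notin> S \<longrightarrow> (x, y) \<in> E \<longrightarrow> y = c)"

text \<open>If \<open>S\<close> were not linked, a component of it would again be left only through
  \<open>c\<close>. If deleting \<open>v\<close> cut a vertex off from \<open>c\<close>, the
  vertices still reached from it would form a smaller set left only through \<open>v\<close>. Both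
  contradict minimality, which therefore has to range over all exit vertices.\<close>

lemma minimal_exit_set_nonsep:
  assumes V: "finite V" "r \<in> V" "E \<subseteq> V \<times> V" "sym E" "irrefl E" "linked E V"
    and S: "exit_set V E r S c"
    and min: "\<And>T b. exit_set V E r T b \<Longrightarrow> card S \<le> card T"
  shows "nonsep \<lparr>pverts = insert c S, parcs = E \<inter> insert c S \<times> insert c S\<rparr>"
proof -
  have SV: "S \<noteq> {}" "S \<subseteq> V - {r}" "c \<in> V" "c \<notin> S"
    and exit: "\<And>x y. x \<in> S \<Longrightarrow> y \<notin> S \<Longrightarrow> (x, y) \<in> E \<Longrightarrow> y = c"
    using S by (auto simp: exit_set_def)
  have finS: "finite S" using SV V(1) by (meson finite_Diff finite_subset)
  have inner: "linked E S"
    unfolding linked_def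
  proof (intro ballI)
    fix x y assume x: "x \<in> S" and y: "y \<in> S"
    define K where "K = {z. (x, z) \<in> rtrancl_on S E}"
    have KS: "K \<subseteq> S" by (auto simp: K_def dest: in_rtrancl_on_in_F)
    have "x \<in> K" using x by (simp add: K_def)
    moreover have "b = c" if a: "a \<in> K" and b: "b \<notin> K" "(a, b) \<in> E" for a b
    proof (cases "b \<in> S")
      case True
      then have "b \<in> K" using a b(2) rtrancl_on_into_rtrancl_on[of x a S E b] by (simp add: K_def)
      then show ?thesis using b by simp
    next
      case False
      then show ?thesis using exit[of a b] a b KS by blast
    qed
    ultimately have "exit_set V E r K c"
      using KS SV by (auto simp: exit_set_def)
    then have "card S \<le> card K" by (rule min)
    then have "K = S" using KS finS by (simp add: card_seteq)
    then show "(x, y) \<in> rtrancl_on S E" using y by (auto simp: K_def)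
  qed
  obtain x0 where x0: "x0 \<in> S" using SV by blast
  \<comment> \<open>Without an arc from \<open>S\<close> to \<open>c\<close>, no walk from
    \<open>S\<close> could reach the root.\<close>
  obtain s0 where s0: "s0 \<in> S" "(s0, c) \<in> E"
  proof (rule ccontr)
    assume no: "\<not> thesis"
    have "(x0, r) \<in> rtrancl_on V E" using linkedD[OF V(6)] x0 SV V(2) by blast
    then have "r \<in> S"
    proof (induction rule: rtrancl_on_induct)
      case (step y z)
      then show ?case using exit[of y z] no that by blast
    qed (use x0 in simp)
    then show False using SV by blast
  qed
  have whole: "linked E (insert c S)"
  proof (rule linked_if_center[OF V(4)])
    fix x assume x: "x \<in> insert c S"
    show "(x, c) \<in> rtrancl_on (insert c S) E"
    proof (cases "x = c")
      case False
      then have "(x, s0) \<in> rtrancl_on S E" using linkedD[OF inner] x s0 by blast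
      then have "(x, s0) \<in> rtrancl_on (insert c S) E"
        using rtrancl_on_mono[of E E S "insert c S" x s0] by blast
      then show ?thesis using s0(2) by (rule rtrancl_on_into_rtrancl_on) simp
    qed simp
  qed
  have del: "linked E (insert c S - {v})" if v: "v \<in> S" for v
  proof (rule linked_if_center[OF V(4)])
    fix x assume x: "x \<in> insert c S - {v}"
    let ?T = "insert c S - {v}"
    show "(x, c) \<in> rtrancl_on ?T E"
    proof (rule ccontr)
      assume no: "(x, c) \<notin> rtrancl_on ?T E"
      define K where "K = {z. (x, z) \<in> rtrancl_on ?T E}"
      have KS: "K \<subseteq> S - {v}"
      proof
        fix z assume "z \<in> K"
        then have z: "(x, z) \<in> rtrancl_on ?T E" by (simp add: K_def)
        then have "z \<in> ?T" by (rule in_rtrancl_on_in_F)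
        moreover have "z \<noteq> c" using z no by blast
        ultimately show "z \<in> S - {v}" by blast
      qed
      have xK: "x \<in> K" using x by (simp add: K_def)
      have "b = v" if a: "a \<in> K" and b: "b \<notin> K" "(a, b) \<in> E" for a b
      proof (rule ccontr)
        assume "b \<noteq> v"
        have "b \<in> insert c S" using exit[of a b] a b KS by blast
        then have "b \<in> K"
          using a b(2) \<open>b \<noteq> v\<close> rtrancl_on_into_rtrancl_on[of x a ?T E b] by (simp add: K_def)
        then show False using b by simp
      qed
      moreover have "v \<in> V - K" using v SV KS by blast
      moreover have "K \<subseteq> V - {r}" using KS SV by blast
      ultimately have "exit_set V E r K v"
        using xK unfolding exit_set_def by blast
      then have "card S \<le> card K" by (rule min)
      moreover have "card K < card S" using KS v finS by (intro psubset_card_mono) auto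
      ultimately show False by simp
    qed
  qed
  let ?B = "\<lparr>pverts = insert c S, parcs = E \<inter> insert c S \<times> insert c S\<rparr>"
  have restr: "linked (parcs ?B) T" if "linked E T" "T \<subseteq> insert c S" for T
    using that linked_cong[of T "parcs ?B" E] by auto
  have "pair_graph ?B"
    using V(4,5) finS by (auto simp: pair_graph_iff sym_def irrefl_def)
  moreover have "2 \<le> card (pverts ?B)"
    using finS SV by (simp add: Suc_le_eq card_gt_0_iff)
  moreover have "linked (parcs ?B) (pverts ?B - {v})" if "v \<in> pverts ?B" for v
  proof (rule restr)
    show "linked E (pverts ?B - {v})"
    proof (cases "v = c")
      case True
      then have "pverts ?B - {v} = S" using SV by auto
      then show ?thesis using inner by simp
    next
      case False
      then show ?thesis using del that by simp
    qed
  qed auto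
  moreover have "linked (parcs ?B) (pverts ?B)" using restr[OF whole] by simp
  ultimately show ?thesis unfolding nonsep_def by blast
qed

lemma ex_minimal_exit_set:
  assumes V: "finite V" "r \<in> V" "E \<subseteq> V \<times> V" and x: "x \<in> V" "x \<noteq> r"
  shows "\<exists>S c. exit_set V E r S c \<and> (\<forall>T b. exit_set V E r T b \<longrightarrow> card S \<le> card T)"
proof -
  have "exit_set V E r (V - {r}) r" using assms by (auto simp: exit_set_def)
  then have "\<exists>c. exit_set V E r (V - {r}) c" by blast
  from ex_has_least_nat[of "\<lambda>S. \<exists>c. exit_set V E r S c", OF this, of card]
  show ?thesis by blast
qed

text \<open>Hanging a new piece at \<open>c\<close> changes neither the owner nor the climb of an
  old vertex, and a new vertex reaches \<open>c\<close> in one step, so the map stays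
  acyclic.\<close>

lemma attach_block:
  assumes T: "block_tree V' r D' p'"
    and d: "nonsep d" "0 \<in> pverts d" "(pverts d - {0}) \<inter> V' = {}" and c: "c \<in> V'"
  shows "block_tree (V' \<union> (pverts d - {0})) r (insert d D') (p'(d := c))" and "d \<notin> D'"
proof -
  interpret T: block_tree V' r D' p' by fact
  let ?D = "insert d D'" and ?V = "V' \<union> (pverts d - {0})" and ?p = "p'(d := c)"
  have P': "pverts e - {0} \<subseteq> V'" if "e \<in> D'" for e using T.P_V[OF that] .
  have fin: "finite (pverts d)" using d(1) by (simp add: nonsep_def pair_graph_iff)
  have F: "block_family ?V r ?D"
    unfolding block_family_def
  proof (intro conjI ballI allI impI)
    show "finite ?V" using T.fin fin by simp
    show "r \<in> ?V" using T.r by simp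
    show "0 \<notin> ?V" using T.zero by simp
    show "nonsep e" if "e \<in> ?D" for e using that d block_family_piece(3)[OF T.F] by auto
    show "0 \<in> pverts e" if "e \<in> ?D" for e using that d block_family_piece(4)[OF T.F] by auto
    show "e = e'" if "e \<in> ?D" "e' \<in> ?D" "x \<noteq> 0" "x \<in> pverts e" "x \<in> pverts e'" for e e' x
    proof -
      have "e = e'" if "e \<in> D'" "e' \<in> D'"
        using T.F that \<open>x \<noteq> 0\<close> \<open>x \<in> pverts e\<close> \<open>x \<in> pverts e'\<close> unfolding block_family_def by blast
      then show ?thesis using that P'[of e] P'[of e'] d(3) by blast
    qed
    have "(\<Union>e \<in> D'. pverts e) - {0} = V' - {r}" using T.F by (simp add: block_family_def)
    then show "(\<Union>e \<in> ?D. pverts e) - {0} = ?V - {r}"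
      using d(3) T.r by auto
  qed
  have dV: "pverts d - {0} \<noteq> {}" using block_family_piece(2)[OF F] by blast
  show dD: "d \<notin> D'" using P'[of d] dV d(3) by blast
  have o: "owner ?D x = owner D' x" if x: "x \<in> V'" for x
  proof (cases "owner D' x")
    case None
    then have "x = r" using owner_None_iff[OF T.F x] by simp
    then show ?thesis using None owner_None_iff[OF F, of x] x by simp
  next
    case (Some e)
    then show ?thesis using owner_SomeI[OF F, of e x] owner_SomeD[OF T.F Some] by simp
  qed
  have g: "grounded (owner ?D) ?p x" if x: "x \<in> V'" for x
    using T.grounded[OF x] x
  proof (induction rule: grounded_induct)
    case (None v)
    then show ?case using o[of v] by (intro grounded_None) simp
  next
    case (Some v e)
    then have e: "e \<in> D'" using owner_SomeD[OF T.F] by blast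
    then have eq: "?p e = p' e" using dD by auto
    have own: "owner ?D v = Some e" using Some.hyps(1) o[OF Some.prems] by simp
    show ?case unfolding grounded_Some[of "owner ?D" v e ?p, OF own] eq by (rule Some.IH[OF T.p_in[OF e]])
  qed
  have "grounded (owner ?D) ?p x" if x: "x \<in> ?V" for x
  proof (cases "x \<in> V'")
    case False
    then have own: "owner ?D x = Some d" using x owner_SomeI[OF F, of d x] by simp
    show ?thesis unfolding grounded_Some[of "owner ?D" x d ?p, OF own] fun_upd_same by (rule g[OF c])
  qed (rule g)
  moreover have "?p \<in> ?D \<rightarrow>\<^sub>E ?V"
    using T.att c by (auto simp: attachments_def PiE_def extensional_def Pi_def)
  ultimately have "?p \<in> attachments ?V ?D (owner ?D)" by (simp add: attachments_def)
  then show "block_tree ?V r ?D ?p" using F by (simp add: block_tree_def)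
qed

text \<open>A minimal exit set is stripped off; with its exit vertex \<open>c\<close> it is a block
  hanging at \<open>c\<close>. The rest is still linked, since walks can be contracted to avoid
  \<open>S\<close>, and every arc lies in the block or in the rest.\<close>

lemma ex_block_tree:
  assumes "finite V" "r \<in> V" "0 \<notin> V" "E \<subseteq> V \<times> V" "sym E" "irrefl E" "linked E V"
  shows "\<exists>D p. block_tree V r D p \<and> build V D p = \<lparr>pverts = V, parcs = E\<rparr>"
  using assms
proof (induction "card V" arbitrary: V E rule: less_induct)
  case less
  note V = less.prems
  show ?case
  proof (cases "V = {r}")
    case True
    have "E = {}" using V True by (auto simp: irrefl_def)
    have F: "block_family V r {}" using V True by (simp add: block_family_def)
    have "(\<lambda>_. undefined) \<in> attachments V {} (owner {})"
      by (auto simp: attachments_def owner_def intro: grounded_None)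
    then have "block_tree V r {} (\<lambda>_. undefined)" using F by (simp add: block_tree_def)
    moreover have "build V {} (\<lambda>_. undefined) = \<lparr>pverts = V, parcs = E\<rparr>"
      using \<open>E = {}\<close> by (simp add: build_def)
    ultimately show ?thesis by blast
  next
    case False
    then obtain x where "x \<in> V" "x \<noteq> r" using V(2) by blast
    then obtain S c where S: "exit_set V E r S c" and min: "\<And>T b. exit_set V E r T b \<Longrightarrow> card S \<le> card T"
      using ex_minimal_exit_set[OF V(1,2,4)] by blast
    let ?V' = "V - S" and ?E' = "E \<inter> (V - S) \<times> (V - S)"
    let ?B = "\<lparr>pverts = insert c S, parcs = E \<inter> insert c S \<times> insert c S\<rparr>"
    let ?f = "\<lambda>x. if x = c then 0 else x :: nat"
    define d where "d = map_graph ?f ?B"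
    have B: "nonsep ?B" by (rule minimal_exit_set_nonsep[OF V(1,2,4,5,6,7) S min])
    have SV: "S \<noteq> {}" "S \<subseteq> V - {r}" "c \<in> V - S"
      and exit: "\<And>x y. x \<in> S \<Longrightarrow> y \<notin> S \<Longrightarrow> (x, y) \<in> E \<Longrightarrow> y = c"
      using S by (auto simp: exit_set_def)
    have zero: "0 \<notin> insert c S" using SV V(3) by auto
    have nz: "x \<noteq> 0" if "x \<in> insert c S" for x using zero that by metis
    have "inj_on ?f (pverts ?B)"
    proof (rule inj_onI)
      fix x y assume "x \<in> pverts ?B" "y \<in> pverts ?B" "?f x = ?f y"
      then show "x = y" using nz[of x] nz[of y] by (simp split: if_splits)
    qed
    then have d1: "nonsep d" unfolding d_def by (rule nonsep_map_graph[OF B])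
    have d2: "0 \<in> pverts d" by (simp add: d_def map_graph_def)
    have pv: "pverts d = ?f ` insert c S" by (simp only: d_def map_graph_simps pair_pre_digraph.simps)
    have Pd: "pverts d - {0} = S"
    proof (intro set_eqI iffI)
      fix x assume "x \<in> pverts d - {0}"
      then obtain y where "y \<in> insert c S" "x = ?f y" "x \<noteq> 0" unfolding pv by blast
      then show "x \<in> S" by (auto split: if_splits)
    next
      fix x assume x: "x \<in> S"
      then have "?f x = x" "x \<noteq> 0" using SV(3) nz by auto
      then show "x \<in> pverts d - {0}" unfolding pv using x by (intro DiffI image_eqI[of _ _ x]) auto
    qed
    have pl: "place d c = ?B"
      unfolding d_def map_graph_comp
    proof (rule map_graph_ident)
      show "(ren c \<circ> ?f) x = x" if "x \<in> pverts ?B" for x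
        using nz[of x] that by (simp add: ren_def)
    qed auto
    have "linked E ?V'"
      unfolding linked_def
    proof (intro ballI)
      fix x y assume "x \<in> ?V'" "y \<in> ?V'"
      then show "(x, y) \<in> rtrancl_on ?V' E"
        using linkedD[OF V(7), of x y] SV(3)
        by (intro rtrancl_on_collapse[of S E c, OF exit V(5)]) auto
    qed
    then have lV': "linked ?E' ?V'" using linked_cong[of ?V' E ?E'] by auto
    have cV': "card ?V' < card V" using V(1) SV by (intro psubset_card_mono) auto
    have "finite ?V'" "r \<in> ?V'" "0 \<notin> ?V'" "?E' \<subseteq> ?V' \<times> ?V'" "sym ?E'" "irrefl ?E'"
      using V SV(2) by (auto simp: sym_def irrefl_def)
    from less.hyps[OF cV' this lV'] obtain D' p' where T: "block_tree ?V' r D' p'"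
      and bE: "build ?V' D' p' = \<lparr>pverts = ?V', parcs = ?E'\<rparr>"
      by blast
    have att: "block_tree (?V' \<union> (pverts d - {0})) r (insert d D') (p'(d := c))" "d \<notin> D'"
      using attach_block[OF T d1 d2 _ SV(3)] Pd by auto
    have VV: "?V' \<union> (pverts d - {0}) = V" using Pd SV by auto
    have E': "(\<Union>e \<in> D'. parcs (place e (p' e))) = ?E'" using bE by (simp add: build_def)
    have "(\<Union>e \<in> D'. parcs (place e ((p'(d := c)) e))) = (\<Union>e \<in> D'. parcs (place e (p' e)))"
      by (rule SUP_cong) (use att(2) in auto)
    then have "(\<Union>e \<in> insert d D'. parcs (place e ((p'(d := c)) e))) =
        parcs (place d c) \<union> (\<Union>e \<in> D'. parcs (place e (p' e)))"
      by (simp only: UN_insert fun_upd_same)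
    also have "\<dots> = (E \<inter> insert c S \<times> insert c S) \<union> ?E'" using pl E' by simp
    also have "\<dots> = E"
    proof
      show "E \<subseteq> (E \<inter> insert c S \<times> insert c S) \<union> ?E'"
      proof (rule subrelI)
        fix x y assume xy: "(x, y) \<in> E"
        then have "(y, x) \<in> E" "x \<in> V" "y \<in> V" using V(4,5) by (auto dest: symD)
        then show "(x, y) \<in> (E \<inter> insert c S \<times> insert c S) \<union> ?E'"
          using exit[of x y] exit[of y x] xy by auto
      qed
    qed auto
    finally have "build V (insert d D') (p'(d := c)) = \<lparr>pverts = V, parcs = E\<rparr>"
      by (simp add: build_def)
    then show ?thesis using att(1) unfolding VV by blast
  qed
qed

section \<open>Connected graphs of a block-stable class\<close>

text \<open>Stored blocks carry the label \<open>0\<close> and are not subgraphs on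
  \<open>{1..n}\<close>; by closure under isomorphism they lie in the class exactly when the placed
  blocks do.\<close>

definition block_families :: "nat pair_pre_digraph set \<Rightarrow> nat \<Rightarrow> nat pair_pre_digraph set set" where
  "block_families \<A> n = {D. block_family {1..n} 1 D \<and> D \<subseteq> \<A>}"

definition graphs_of :: "nat \<Rightarrow> nat pair_pre_digraph set \<Rightarrow> nat pair_pre_digraph set" where
  "graphs_of n D = build {1..n} D ` attachments {1..n} D (owner D)"

lemma graph_class_map_graph:
  assumes "graph_class \<A>" "B \<in> \<A>" "inj_on f (pverts B)"
  shows "map_graph f B \<in> \<A>"
  using assms digraph_iso_map_graph unfolding graph_class_def by blast

text \<open>Uses block-stability from blocks to the graph: the blocks of a built graph are renamed
  members of the family. The converse direction serves to show that every connected graph of the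
  class arises in this way.\<close>

lemma graphs_of_subset:
  assumes \<A>: "graph_class \<A>" "block_stable \<A>" and n: "2 \<le> n" and D: "D \<in> block_families \<A> n"
  shows "graphs_of n D \<subseteq> connected_on \<A> n"
proof
  fix G assume "G \<in> graphs_of n D"
  then obtain p where p: "p \<in> attachments {1..n} D (owner D)" and G: "G = build {1..n} D p"
    by (auto simp: graphs_of_def)
  interpret T: block_tree "{1..n}" 1 D p
    using D p by (simp add: block_tree_def block_families_def)
  have "B \<in> \<A>" if "is_block G B" for B
  proof -
    obtain d where d: "d \<in> D" "B = place d (p d)" using T.is_block_iff[of B] n \<open>is_block G B\<close> G by auto
    then have "d \<in> \<A>" using D by (auto simp: block_families_def)
    then show "B \<in> \<A>"
      unfolding d(2) using T.p_notin[OF d(1)] by (intro graph_class_map_graph[OF \<A>(1)] inj_on_ren)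
  qed
  then have "G \<in> \<A>" using \<A>(2) T.pair_graph_G G unfolding block_stable_def by blast
  moreover have "Digraph_Component.connected (with_proj G)"
    unfolding G connected_iff_linked[OF T.pair_graph_G] using T.linked_G n by (simp add: build_def)
  moreover have "pverts G = {1..n}" by (simp add: G build_def)
  ultimately show "G \<in> connected_on \<A> n" unfolding connected_on_def by blast
qed

lemma connected_on_cover:
  assumes \<A>: "graph_class \<A>" "block_stable \<A>" and n: "2 \<le> n" and G: "G \<in> connected_on \<A> n"
  shows "\<exists>D \<in> block_families \<A> n. G \<in> graphs_of n D"
proof -
  have GA: "G \<in> \<A>" and V: "pverts G = {1..n}" and pg: "pair_graph G"
    and conn: "Digraph_Component.connected (with_proj G)"
    using G \<A>(1) by (auto simp: connected_on_def graph_class_def)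
  have E: "parcs G \<subseteq> {1..n} \<times> {1..n}" "sym (parcs G)" "irrefl (parcs G)"
    using pg V by (auto simp: pair_graph_iff)
  have L: "linked (parcs G) {1..n}" using conn connected_iff_linked[OF pg] V by simp
  obtain D p where T: "block_tree {1..n} 1 D p" and b: "build {1..n} D p = \<lparr>pverts = {1..n}, parcs = parcs G\<rparr>"
    using ex_block_tree[of "{1..n}" 1 "parcs G", OF _ _ _ E L] n by auto
  interpret T: block_tree "{1..n}" 1 D p by fact
  have eq: "T.G = G" using b V by simp
  have "d \<in> \<A>" if d: "d \<in> D" for d
  proof -
    have "is_block G (place d (p d))" using T.is_block_iff[of "place d (p d)"] n d eq by auto
    then have B: "place d (p d) \<in> \<A>" using \<A>(2) GA pg unfolding block_stable_def by blast
    let ?g = "\<lambda>x. if x = p d then 0 else x :: nat"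
    have "0 \<notin> pverts (place d (p d))"
      using T.verts_place[OF d] T.p_in[OF d] by auto
    then have "inj_on ?g (pverts (place d (p d)))"
      by (intro inj_onI) (metis (full_types))
    then have "map_graph ?g (place d (p d)) \<in> \<A>" by (rule graph_class_map_graph[OF \<A>(1) B])
    moreover have "pair_graph d" using block_family_piece(3)[OF T.F d] by (simp add: nonsep_def)
    ultimately show "d \<in> \<A>" using place_inverse[of d "p d"] T.p_notin[OF d] by simp
  qed
  then have "D \<in> block_families \<A> n" using T.F by (auto simp: block_families_def)
  moreover have "G \<in> graphs_of n D" using T.att eq by (auto simp: graphs_of_def)
  ultimately show ?thesis by blast
qed

lemma graphs_of_eq:
  assumes "2 \<le> n" "D \<in> block_families \<A> n" "D' \<in> block_families \<A> n" "G \<in> graphs_of n D" "G \<in> graphs_of n D'"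
  shows "D = D'"
proof -
  obtain p p' where "p \<in> attachments {1..n} D (owner D)" "p' \<in> attachments {1..n} D' (owner D')"
    and eq: "build {1..n} D p = build {1..n} D' p'"
    using assms by (auto simp: graphs_of_def)
  then have "block_tree {1..n} 1 D p" "block_tree {1..n} 1 D' p'"
    using assms by (auto simp: block_tree_def block_families_def)
  then show ?thesis by (rule build_unique(1)[OF _ _ eq]) (use assms in simp)
qed

lemma card_graphs_of_large_diam:
  assumes n: "2 \<le> n" and D: "D \<in> block_families \<A> n" and x: "8 \<le> x"
  shows "real (card {G \<in> graphs_of n D. 4 * x * sqrt n \<le> block_diam G}) \<le>
    144 * exp (- x\<^sup>2 / 32) * card (graphs_of n D)"
proof -
  let ?V = "{1..n}" and ?A = "attachments {1..n} D (owner D)"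
  have F: "block_family ?V 1 D" using D by (simp add: block_families_def)
  note P = pieces_block_family[OF F]
  have T: "block_tree ?V 1 D p" if "p \<in> ?A" for p using F that by (simp add: block_tree_def)
  have "inj_on (build ?V D) ?A"
  proof (rule inj_onI)
    fix p p' assume "p \<in> ?A" "p' \<in> ?A" "build ?V D p = build ?V D p'"
    then show "p = p'" using build_unique(2)[OF T T] n by simp
  qed
  then have card: "card (graphs_of n D) = card ?A" unfolding graphs_of_def by (rule card_image)
  let ?X = "{p \<in> ?A. \<exists>v \<in> ?V. 2 * x * sqrt (card ?V) \<le> depth (owner D) p v}"
  have "{G \<in> graphs_of n D. 4 * x * sqrt n \<le> block_diam G} \<subseteq> build ?V D ` ?X"
  proof clarify
    fix G assume "G \<in> graphs_of n D" and large: "4 * x * sqrt n \<le> block_diam G"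
    then obtain p where p: "p \<in> ?A" "G = build ?V D p" by (auto simp: graphs_of_def)
    have "2 \<le> card ?V" using n by simp
    then obtain v where v: "v \<in> ?V" "block_diam G \<le> 2 * depth (owner D) p v"
      using block_tree.block_diam_le[OF T[OF p(1)]] p(2) by blast
    then have "real (block_diam G) \<le> 2 * real (depth (owner D) p v)" by linarith
    \<comment> \<open>Half of the factor \<open>4\<close> goes into the passage from block-diameter
      to depth.\<close>
    then have "2 * x * sqrt (card ?V) \<le> depth (owner D) p v" using large by simp
    then have "p \<in> ?X" using p(1) v(1) by blast
    then show "G \<in> build ?V D ` ?X" using p(2) by blast
  qed
  moreover have "finite ?X" using finite_attachments[OF P] by simp
  ultimately have "card {G \<in> graphs_of n D. 4 * x * sqrt n \<le> block_diam G} \<le> card ?X"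
    by (meson card_image_le card_mono finite_imageI order_trans)
  then have "real (card {G \<in> graphs_of n D. 4 * x * sqrt n \<le> block_diam G}) \<le> real (card ?X)"
    by (rule of_nat_mono)
  also have "\<dots> \<le> 144 * exp (- x\<^sup>2 / 32) * card ?A" by (rule depth_sub_gaussian[OF P x])
  finally show ?thesis by (simp only: card)
qed

text \<open>The sets \<open>graphs_of n D\<close> are disjoint and cover the connected graphs of the
  class. The bound has the same constants for every family, so it adds up over them.\<close>

lemma card_large_diam:
  assumes \<A>: "graph_class \<A>" "block_stable \<A>" and n: "2 \<le> n" and x: "8 \<le> x"
  shows "real (card {G \<in> connected_on \<A> n. 4 * x * sqrt n \<le> block_diam G}) \<le>
    144 * exp (- x\<^sup>2 / 32) * card (connected_on \<A> n)"
proof -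
  let ?S = "connected_on \<A> n" and ?Q = "\<lambda>G. 4 * x * sqrt n \<le> block_diam G"
  define f where "f G = (SOME D. D \<in> block_families \<A> n \<and> G \<in> graphs_of n D)" for G
  have f: "f G \<in> block_families \<A> n" "G \<in> graphs_of n (f G)" if "G \<in> ?S" for G
  proof -
    have "\<exists>D. D \<in> block_families \<A> n \<and> G \<in> graphs_of n D"
      using connected_on_cover[OF \<A> n that] by blast
    then have "f G \<in> block_families \<A> n \<and> G \<in> graphs_of n (f G)" unfolding f_def by (rule someI_ex)
    then show "f G \<in> block_families \<A> n" "G \<in> graphs_of n (f G)" by blast+
  qed
  have fin: "finite ?S" by (rule finite_connected_on[OF \<A>(1)])
  have fiber: "{G \<in> ?S. f G = D} = graphs_of n D" if D: "D \<in> f ` ?S" for D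
  proof -
    have DF: "D \<in> block_families \<A> n" using D f by blast
    have "G \<in> ?S \<and> f G = D" if G: "G \<in> graphs_of n D" for G
    proof -
      have GS: "G \<in> ?S" using graphs_of_subset[OF \<A> n DF] G by blast
      then show ?thesis using graphs_of_eq[OF n f(1)[OF GS] DF f(2)[OF GS] G] by blast
    qed
    then show ?thesis using f(2) by blast
  qed
  have split: "card {G \<in> ?S. R G} = (\<Sum>D \<in> f ` ?S. card {G \<in> graphs_of n D. R G})" for R
  proof -
    have "card {G \<in> ?S. R G} = (\<Sum>G \<in> ?S. if R G then 1 else 0)"
      using fin by (simp add: sum.inter_filter[symmetric])
    also have "\<dots> = (\<Sum>D \<in> f ` ?S. \<Sum>G \<in> {G \<in> ?S. f G = D}. if R G then 1 else 0)"
      by (rule sum.image_gen[OF fin])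
    also have "\<dots> = (\<Sum>D \<in> f ` ?S. card {G \<in> graphs_of n D. R G})"
    proof (rule sum.cong[OF refl])
      fix D assume D: "D \<in> f ` ?S"
      have "finite (graphs_of n D)" using fin fiber[OF D] by (metis (no_types, lifting) finite_Collect_conjI finite_subset mem_Collect_eq subsetI)
      then show "(\<Sum>G \<in> {G \<in> ?S. f G = D}. if R G then 1 else 0) = card {G \<in> graphs_of n D. R G}"
        unfolding fiber[OF D] by (simp add: sum.inter_filter[symmetric])
    qed
    finally show ?thesis .
  qed
  have "real (card {G \<in> ?S. ?Q G}) = (\<Sum>D \<in> f ` ?S. real (card {G \<in> graphs_of n D. ?Q G}))"
    by (subst split) (rule of_nat_sum)
  also have "\<dots> \<le> (\<Sum>D \<in> f ` ?S. 144 * exp (- x\<^sup>2 / 32) * real (card (graphs_of n D)))"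
    by (rule sum_mono, rule card_graphs_of_large_diam[OF n _ x]) (use f in blast)
  also have "\<dots> = 144 * exp (- x\<^sup>2 / 32) * (\<Sum>D \<in> f ` ?S. real (card (graphs_of n D)))"
    by (rule sum_distrib_left[symmetric])
  also have "(\<Sum>D \<in> f ` ?S. real (card (graphs_of n D))) = real (card ?S)"
    using split[of "\<lambda>_. True"] by simp
  finally show ?thesis .
qed

lemma block_diam_single_vertex:
  assumes "pair_graph G" "pverts G = {v}"
  shows "block_diam G \<le> 1"
proof -
  have E: "parcs G = {}" using assms by (auto simp: pair_graph_iff irrefl_def)
  have "B = \<lparr>pverts = {v}, parcs = {}\<rparr>" if "is_block G B" for B
  proof -
    have "\<not> is_bridge G a b" for a b using E by (simp add: is_bridge_def)
    moreover have "\<not> pre_digraph.max_subgraph (with_proj G) two_connected (with_proj B)"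
    proof
      assume "pre_digraph.max_subgraph (with_proj G) two_connected (with_proj B)"
      then have "3 \<le> card (pverts B)" "pverts B \<subseteq> {v}"
        using assms by (auto simp: max_subgraph_two_connected_iff)
      then show False using card_mono[of "{v}" "pverts B"] by simp
    qed
    ultimately show ?thesis using that assms by (auto simp: is_block_def)
  qed
  then have sub: "{B. is_block G B \<and> passes_through p B} \<subseteq> {\<lparr>pverts = {v}, parcs = {}\<rparr>}" for p by blast
  let ?M = "{card {B. is_block G B \<and> passes_through p B} | p. vpath p (with_proj G)}"
  have le: "m \<le> 1" if m: "m \<in> ?M" for m
    using m card_mono[OF _ sub] by auto
  have "finite ?M" by (rule finite_subset[of _ "{..1}"]) (use le in auto)
  moreover have "vpath [v] (with_proj G)" using assms by (auto simp: vpath_def vwalk_def)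
  then have "?M \<noteq> {}" by blast
  ultimately show ?thesis unfolding block_diam_def using le by (intro Max.boundedI) auto
qed

theorem theorem25:
  fixes \<A> :: "nat pair_pre_digraph set"
  assumes "graph_class \<A>" and "block_stable \<A>"
  shows "\<exists>c1 > 0. \<exists>c2 > 0. \<forall>t > (1 :: real). \<forall>n :: nat. connected_on \<A> n \<noteq> {} \<longrightarrow>
    measure_pmf.prob (pmf_of_set (connected_on \<A> n)) {G. real (block_diam G) \<ge> t * sqrt (real n)}
      < c1 * exp (- c2 * t\<^sup>2)"
proof (rule exI[of _ "150 :: real"], rule conjI, simp, rule exI[of _ "1 / 512 :: real"],
    intro conjI allI impI)
  fix t :: real and n :: nat
  assume t: "1 < t" and ne: "connected_on \<A> n \<noteq> {}"
  let ?S = "connected_on \<A> n" and ?bad = "{G. real (block_diam G) \<ge> t * sqrt (real n)}"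
  have fin: "finite ?S" by (rule finite_connected_on[OF assms(1)])
  have prob: "measure_pmf.prob (pmf_of_set ?S) ?bad = real (card (?S \<inter> ?bad)) / real (card ?S)"
    by (rule measure_pmf_of_set[OF ne fin])
  have card: "0 < real (card ?S)" using ne fin by (simp add: card_gt_0_iff)
  obtain G0 where "G0 \<in> ?S" using ne by blast
  then have "pverts G0 = {1..n}" "Digraph_Component.connected (with_proj G0)"
    by (auto simp: connected_on_def)
  then have "n \<noteq> 0" by (auto simp: connected_conv)
  \<comment> \<open>The bound is applied with \<open>x = t / 4\<close>, so \<open>x \<ge> 8\<close>
    requires \<open>t \<ge> 32\<close>, and \<open>(t / 4)^2 / 32 = t^2 / 512\<close>. For smaller
    \<open>t\<close> the right-hand side is at least \<open>150 exp (- 2) > 1\<close>. On one vertex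
    the only block is an isolated vertex, and the block-diameter is at most
    \<open>1 < t\<close>.\<close>
  then consider "n = 1" | "2 \<le> n" "t < 32" | "2 \<le> n" "32 \<le> t" by linarith
  then show "measure_pmf.prob (pmf_of_set ?S) ?bad < 150 * exp (- (1 / 512) * t\<^sup>2)"
  proof cases
    case 1
    have "block_diam G \<le> 1" if "G \<in> ?S" for G
      using that assms(1) 1 by (intro block_diam_single_vertex[of G 1]) (auto simp: connected_on_def graph_class_def)
    then have "?S \<inter> ?bad = {}" using t 1 by fastforce
    then show ?thesis unfolding prob by simp
  next
    case 2
    have "t\<^sup>2 \<le> 32\<^sup>2" using 2 t by (intro power_mono) auto
    then have "exp (- 2) \<le> exp (- (1 / 512) * t\<^sup>2)" by simp
    moreover have "1 < 150 * exp (- 2 :: real)"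
    proof -
      have "exp (2 :: real) = exp 1 ^ 2" by (simp flip: exp_of_nat_mult)
      also have "\<dots> \<le> 3 ^ 2" by (rule power_mono[OF exp_le]) simp
      finally show ?thesis by (simp add: exp_minus field_simps)
    qed
    moreover have "measure_pmf.prob (pmf_of_set ?S) ?bad \<le> 1" by (rule measure_pmf.prob_le_1)
    ultimately show ?thesis by linarith
  next
    case 3
    have "?S \<inter> ?bad = {G \<in> ?S. 4 * (t / 4) * sqrt n \<le> block_diam G}" by auto
    then have "real (card (?S \<inter> ?bad)) \<le> 144 * exp (- (t / 4)\<^sup>2 / 32) * card ?S"
      using card_large_diam[OF assms 3(1), of "t / 4"] 3(2) by simp
    moreover have "- (t / 4)\<^sup>2 / 32 = - (1 / 512) * t\<^sup>2" by (simp add: power_divide)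
    ultimately have "measure_pmf.prob (pmf_of_set ?S) ?bad \<le> 144 * exp (- (1 / 512) * t\<^sup>2)"
      unfolding prob using card by (simp only: divide_le_eq) simp
    \<comment> \<open>The gap between \<open>144\<close> and \<open>150\<close> makes the inequality
      strict.\<close>
    also have "\<dots> < 150 * exp (- (1 / 512) * t\<^sup>2)" by simp
    finally show ?thesis .
  qed
qed simp_all

end
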